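(* Let $N\geq 2$ be an integer, and let $d,i$ be positive integers with $i\geq 2$ such that $N=\frac{d(d+i)}{i-1}$. Then the entropy function $\alpha\mapsto h(T_\alpha)$ is constant on $[A,B]=\overline X_{N,d,i}$, and for every $\alpha\in[A,B]$ it is given by $$\begin{aligned} h(T_\alpha)=\log N-2H\bigg(&\Big(\mathrm{Li}_2(-\tfrac{Ex}{N})+(\log x)\log(\tfrac{Ex}{N}+1)\Big)\Big|_{x=B}^{B+1}\\ &-\Big(\mathrm{Li}_2(-\tfrac{Ax}{N})+(\log x)\log(\tfrac{Ax}{N}+1)\Big)\Big|_{x=B}^{D}-\Big(\mathrm{Li}_2(-\tfrac{Cx}{N})+(\log x)\log(\tfrac{Cx}{N}+1)\Big)\Big|_{x=D}^{B+1}\bigg),\end{aligned}$$ where $H^{-1}=2\log A+2\log(B+1)-\log\big(N-(A+1)d\big)-\log\big(N-(d+i)B\big)$ is the normalising constant for the $T_\alpha$-invariant measure $\mu_\alpha$ for $\alpha\in X_{N,d,i}$.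
   Context: For an integer $N\ge 2$ and a real $\alpha$ with $0<\alpha\le\sqrt N-1$, put $I_\alpha=[\alpha,\alpha+1]$ and define $T_\alpha:I_\alpha\to[\alpha,\alpha+1)$ by $T_\alpha(x)=\frac Nx-d(x)$, where $d(x)=\lfloor \frac Nx-\alpha\rfloor$ (the dependence on $N$ is suppressed). The values of $d(\cdot)$ are the digits; they form a finite set of consecutive integers $\{d,d+1,\dots,d+i\}$ with smallest digit $d=d(\alpha+1)$ and largest digit $d+i$. The cylinders are $I_k=\{x\in I_\alpha : d(x)=k\}$; the largest digit is always chosen so that every cylinder is an interval (in the exceptional case that $N/\alpha-\alpha$ is an integer, the single point $\alpha$ is given the digit $N/\alpha-\alpha-1$, so that $T_\alpha(\alpha)=\alpha+1$). The interior of $I_k$ is denoted $I_k^{o}$. For positive integers $d,i$, let $\mathcal A_{N,d,i}$ be the set of all $\alpha\in(0,\sqrt N-1]$ for which $T_\alpha$ has digit set $\{d,d+1,\dots,d+i\}$, and let $X_{N,d,i}=\{\alpha\in\mathcal A_{N,d,i} : T_\alpha(\alpha)\in I_d^{o},\ T_\alpha(\alpha+1)\in I_{d+i}^{o}\}$; $\overline X_{N,d,i}$ is its closure. Put $A=\frac{-(d+i+1)+\sqrt{(d+i+1)^2+4N}}{2}$, $E=A+1$, $B=\frac{-(d+1)+\sqrt{(d-1)^2+4N}}{2}$, $F=B+1$, $C=\frac{N(-(d+i-1)+\sqrt{(d+i+1)^2+4N})}{2(d+i+N)}$, $D=\frac{N(-(d+1)+\sqrt{(d-1)^2+4N})}{2(N-d)}$.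 $\mu_\alpha$ is the unique absolutely continuous $T_\alpha$-invariant probability measure on $I_\alpha$ (with respect to which $T_\alpha$ is ergodic), and $h(T_\alpha)$ is the measure-theoretic entropy of $T_\alpha$ with respect to $\mu_\alpha$. For $\alpha\in X_{N,d,i}$, $\mu_\alpha$ is the projection on the first coordinate of the probability measure with density $H\frac{N}{(N+xy)^2}$ on the polygon $\Omega_\alpha$ with vertices (in clockwise order) $(\alpha,A)$, $(T_\alpha^2(\alpha+1),A)$, $(T_\alpha^2(\alpha+1),B)$, $(T_\alpha(\alpha),B)$, $(T_\alpha(\alpha),C)$, $(\alpha+1,C)$, $(\alpha+1,F)$, $(T_\alpha^2(\alpha),F)$, $(T_\alpha^2(\alpha),E)$, $(T_\alpha(\alpha+1),E)$, $(T_\alpha(\alpha+1),D)$, $(\alpha,D)$; $H$ is the normalising constant in this sense. The dilogarithm is $\mathrm{Li}_2(z)=\int_z^0\frac{\log(1-t)}{t}\,dt$ (equal to $\sum_{k\ge1}z^k/k^2$ for $|z|\le1$). *)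

theory Defs
  imports "HOL-Probability.Probability"
begin

section \<open>Kolmogorov--Sinai entropy\<close>

definition finite_meas_partition :: "'a measure \<Rightarrow> 'a set set \<Rightarrow> bool" where
  "finite_meas_partition M P \<longleftrightarrow> finite P \<and> P \<subseteq> sets M \<and> partition_on (space M) P"

(* Null cells contribute 0, since 0 * ln 0 = 0. *)
definition partition_entropy :: "'a measure \<Rightarrow> 'a set set \<Rightarrow> real" where
  "partition_entropy M P = - (\<Sum>A\<in>P. measure M A * ln (measure M A))"

(* The join of P, T^-1 P, ..., T^-(n-1) P.  The empty set may occur among its cells, which
   does not affect partition_entropy. *)
primrec iterated_join :: "'a measure \<Rightarrow> ('a \<Rightarrow> 'a) \<Rightarrow> 'a set set \<Rightarrow> nat \<Rightarrow> 'a set set" where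
  "iterated_join M T P 0 = {space M}"
| "iterated_join M T P (Suc n) =
     {A \<inter> (T -` B \<inter> space M) | A B. A \<in> P \<and> B \<in> iterated_join M T P n}"

definition entropy_wrt :: "'a measure \<Rightarrow> ('a \<Rightarrow> 'a) \<Rightarrow> 'a set set \<Rightarrow> real" where
  "entropy_wrt M T P = lim (\<lambda>n. partition_entropy M (iterated_join M T P n) / real n)"

(* Extended real valued, so that the supremum is meaningful without a boundedness side condition. *)
definition ks_entropy :: "'a measure \<Rightarrow> ('a \<Rightarrow> 'a) \<Rightarrow> ereal" where
  "ks_entropy M T = (SUP P \<in> Collect (finite_meas_partition M). ereal (entropy_wrt M T P))"


section \<open>The maps $T_\alpha$\<close>

definition I_alpha :: "real \<Rightarrow> real set" where
  "I_alpha \<alpha> = {\<alpha>..\<alpha> + 1}"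

(* The first case is the exceptional convention at the left endpoint: it makes
   T_alpha(alpha) = alpha + 1 and avoids a one-point cylinder. *)
definition digit :: "nat \<Rightarrow> real \<Rightarrow> real \<Rightarrow> int" where
  "digit N \<alpha> x =
     (if x = \<alpha> \<and> real N / \<alpha> - \<alpha> \<in> \<int> then \<lfloor>real N / \<alpha> - \<alpha>\<rfloor> - 1
      else \<lfloor>real N / x - \<alpha>\<rfloor>)"

definition T_alpha :: "nat \<Rightarrow> real \<Rightarrow> real \<Rightarrow> real" where
  "T_alpha N \<alpha> x = real N / x - of_int (digit N \<alpha> x)"

definition cylinder :: "nat \<Rightarrow> real \<Rightarrow> int \<Rightarrow> real set" where
  "cylinder N \<alpha> k = {x \<in> I_alpha \<alpha>. digit N \<alpha> x = k}"

definition A_set :: "nat \<Rightarrow> nat \<Rightarrow> nat \<Rightarrow> real set" where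
  "A_set N d i = {\<alpha>. 0 < \<alpha> \<and> \<alpha> \<le> sqrt (real N) - 1 \<and>
                     digit N \<alpha> ` I_alpha \<alpha> = {int d..int (d + i)}}"

definition X_set :: "nat \<Rightarrow> nat \<Rightarrow> nat \<Rightarrow> real set" where
  "X_set N d i = {\<alpha> \<in> A_set N d i.
      T_alpha N \<alpha> \<alpha> \<in> interior (cylinder N \<alpha> (int d)) \<and>
      T_alpha N \<alpha> (\<alpha> + 1) \<in> interior (cylinder N \<alpha> (int (d + i)))}"

definition is_acip :: "nat \<Rightarrow> real \<Rightarrow> real measure \<Rightarrow> bool" where
  "is_acip N \<alpha> \<mu> \<longleftrightarrow>
     sets \<mu> = sets (restrict_space borel (I_alpha \<alpha>)) \<and>
     prob_space \<mu> \<and>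
     absolutely_continuous (restrict_space lborel (I_alpha \<alpha>)) \<mu> \<and>
     T_alpha N \<alpha> \<in> measurable \<mu> \<mu> \<and>
     distr \<mu> \<mu> (T_alpha N \<alpha>) = \<mu>"

definition mu_alpha :: "nat \<Rightarrow> real \<Rightarrow> real measure" where
  "mu_alpha N \<alpha> = (THE \<mu>. is_acip N \<alpha> \<mu>)"

definition entropy_T :: "nat \<Rightarrow> real \<Rightarrow> ereal" where
  "entropy_T N \<alpha> = ks_entropy (mu_alpha N \<alpha>) (T_alpha N \<alpha>)"


section \<open>The planar domain $\Omega_\alpha$\<close>

(* The heights of the horizontal sides: A (A + d + i + 1) = N and F (F + d - 1) = N with F = B + 1,
   i.e. N/A - (d + i) = E and N/F - d = B, while C = N / (d + i + A) and D = N / (d + F). *)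
definition cA :: "nat \<Rightarrow> nat \<Rightarrow> nat \<Rightarrow> real" where
  "cA N d i = (- (real d + real i + 1) + sqrt ((real d + real i + 1)\<^sup>2 + 4 * real N)) / 2"

definition cE :: "nat \<Rightarrow> nat \<Rightarrow> nat \<Rightarrow> real" where
  "cE N d i = cA N d i + 1"

definition cB :: "nat \<Rightarrow> nat \<Rightarrow> real" where
  "cB N d = (- (real d + 1) + sqrt ((real d - 1)\<^sup>2 + 4 * real N)) / 2"

definition cF :: "nat \<Rightarrow> nat \<Rightarrow> real" where
  "cF N d = cB N d + 1"

definition cC :: "nat \<Rightarrow> nat \<Rightarrow> nat \<Rightarrow> real" where
  "cC N d i = real N * (- (real d + real i - 1) + sqrt ((real d + real i + 1)\<^sup>2 + 4 * real N))
                / (2 * (real d + real i + real N))"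

definition cD :: "nat \<Rightarrow> nat \<Rightarrow> real" where
  "cD N d = real N * (- (real d + 1) + sqrt ((real d - 1)\<^sup>2 + 4 * real N))
              / (2 * (real N - real d))"

(* The closed region bounded by the closed polygonal curve through the listed vertices. *)
definition polygon :: "(real \<times> real) list \<Rightarrow> (real \<times> real) set" where
  "polygon vs =
     (let \<Gamma> = (\<Union>k<length vs. closed_segment (vs ! k) (vs ! (Suc k mod length vs)))
      in \<Gamma> \<union> inside \<Gamma>)"

definition Omega_alpha :: "nat \<Rightarrow> nat \<Rightarrow> nat \<Rightarrow> real \<Rightarrow> (real \<times> real) set" where
  "Omega_alpha N d i \<alpha> =
     (let T = T_alpha N \<alpha>;
          A = cA N d i; B = cB N d; C = cC N d i; D = cD N d; E = cE N d i; F = cF N d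
      in polygon
        [(\<alpha>, A), (T (T (\<alpha> + 1)), A), (T (T (\<alpha> + 1)), B), (T \<alpha>, B), (T \<alpha>, C), (\<alpha> + 1, C),
         (\<alpha> + 1, F), (T (T \<alpha>), F), (T (T \<alpha>), E), (T (\<alpha> + 1), E), (T (\<alpha> + 1), D), (\<alpha>, D)])"

definition Omega_measure :: "nat \<Rightarrow> nat \<Rightarrow> nat \<Rightarrow> real \<Rightarrow> real \<Rightarrow> (real \<times> real) measure" where
  "Omega_measure N d i H \<alpha> =
     density (restrict_space lborel (Omega_alpha N d i \<alpha>))
       (\<lambda>(x, y). ennreal (H * (real N / (real N + x * y)\<^sup>2)))"


section \<open>Dilogarithm\<close>

(* Oriented integral from z to 0; the real dilogarithm on the range z \<le> 1. *)
definition Li2 :: "real \<Rightarrow> real" where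
  "Li2 z = (LBINT t=ereal z..ereal 0. ln (1 - t) / t)"

end

theory Submission
  imports Defs
begin

text \<open>
  Write \<open>T\<close> for \<open>T_\<alpha>\<close>, \<open>p = T \<alpha>\<close>, \<open>q = T (\<alpha> + 1)\<close>, \<open>p\<^sub>2 = T p\<close>, \<open>q\<^sub>2 = T q\<close>.  Two
  things have to be understood: why the entropy of the abstract measure \<open>\<mu>_\<alpha>\<close> is an integral, and
  why that integral does not move with \<open>\<alpha>\<close>.

  \<^emph>\<open>The entropy is an integral.\<close>  Suppose an invariant probability density \<open>f\<close> on \<open>I_\<alpha>\<close> is
  known which is bounded away from \<open>0\<close> and \<open>\<infinity>\<close>.  Since \<open>x T x = N - d(x) x \<le> N - \<alpha>\<close>, the square of \<open>T\<close>
  is uniformly expanding, so itineraries of length \<open>n\<close> determine points up to an exponentially small error and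
  the digit partition, or any finite refinement of it, generates.  For a generating labelling \<open>X\<close> the
  entropy of \<open>n + 1\<close> steps exceeds that of \<open>n\<close> steps by an average of \<open>-t ln t\<close> over conditional
  probabilities of \<open>X\<close> given the next \<open>n\<close> labels.  These are averages over small cells of the
  conditional probability given the whole future, which is \<open>f(x) x\<^sup>2 / (N f(T x))\<close>, and they converge to
  it in \<open>L\<^sup>1\<close>.  Hence every finite refinement of the digit partition has entropy rate
  \<open>\<integral> ln (N / x\<^sup>2) d\<mu>\<close>, the terms \<open>ln f(T x) - ln f(x)\<close> cancelling by invariance, and therefore
  so has the supremum over all partitions (\<open>entropy_rate\<close>, \<open>entropy_rate_refinement\<close>,
  \<open>ks_entropy_mu\<close>).

  That \<open>\<mu>_\<alpha>\<close> is this measure follows from ergodicity.  An invariant set of positive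
  measure fills, by bounded distortion, almost all of some interval of a fixed size, hence in a
  compactness limit a whole interval up to a null set.  A longest such interval cannot be mapped
  injectively by \<open>T\<close>, which strictly expands, so it contains a discontinuity; points just to the left
  of a discontinuity are mapped to points just to the right of \<open>\<alpha>\<close>.  So every invariant set of
  positive measure fills a neighbourhood of \<open>\<alpha>\<close> in \<open>I_\<alpha>\<close>, and there cannot be two disjoint ones
  (\<open>quasi_invariant_full_near_alpha\<close>, \<open>ergodic\<close>, \<open>acip_unique\<close>).

  \<^emph>\<open>The integral is constant.\<close>  The relation \<open>N (i - 1) = d (d + i)\<close> gives the
  matching \<open>N / q\<^sub>2 = N / p\<^sub>2 + 1\<close> (\<open>matching\<close>), so that the orbits of the two endpoints merge after three
  steps.  The density obtained by integrating \<open>N / (N + x y)\<^sup>2\<close> over the vertical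
  fibres of \<open>\<Omega>_\<alpha>\<close> is \<open>t / (N + t x) - b / (N + b x)\<close>, with \<open>t\<close> and \<open>b\<close> step functions of \<open>x\<close>
  jumping at \<open>q, p\<^sub>2\<close> and at \<open>q\<^sub>2, p\<close>.  Under a branch of the inverse, \<open>c / (N + c x)\<close> turns into a difference of two
  fractions of the same kind, and because \<open>E = A + 1\<close>, \<open>F = B + 1\<close>, and the jumps at \<open>p\<^sub>2\<close> and \<open>q\<^sub>2\<close> are matched, the
  sum over all branches telescopes to the density itself (\<open>fibre_mass_transfer\<close>).  When \<open>\<alpha>\<close> moves, each jump
  contributes to the derivative of \<open>\<integral> ln x d\<mu>\<close>; the jump weights are transported unchanged along
  the two orbits, so that the derivative is a multiple of
  \<open>ln ((\<alpha> + 1) q q\<^sub>2) - ln (\<alpha> p p\<^sub>2)\<close>, which is zero because both products equal \<open>N (i \<alpha> - d)\<close>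
  (\<open>log_moment_derivative\<close>).  Evaluating at \<open>\<alpha> = B\<close>, where three of the six pieces are empty, gives the
  formula with the dilogarithms.
\<close>

section \<open>Entropy of itineraries\<close>

definition eta :: "real \<Rightarrow> real" where
  "eta t = - (t * ln t)"

lemma eta_0 [simp]: "eta 0 = 0"
  by (simp add: eta_def)

lemma eta_nonneg: "0 \<le> t \<Longrightarrow> t \<le> 1 \<Longrightarrow> 0 \<le> eta t"
  unfolding eta_def by (cases "t = 0") (auto simp: mult_nonneg_nonpos)

lemma eta_le_1:
  assumes "0 \<le> t" "t \<le> 1"
  shows "eta t \<le> 1"
proof (cases "t = 0")
  case False
  then have "t > 0" using assms by simp
  then have "- ln t \<le> 1 / t - 1"
    using ln_le_minus_one[of "1 / t"] by (simp add: ln_div)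
  then have "t * (- ln t) \<le> t * (1 / t - 1)"
    using \<open>t > 0\<close> by (intro mult_left_mono) auto
  also have "\<dots> \<le> 1" using \<open>t > 0\<close> assms by (simp add: field_simps)
  finally show ?thesis by (simp add: eta_def)
qed simp

lemma continuous_on_eta: "continuous_on {0..1} eta"
proof -
  have "continuous (at x within {0..1}) eta" if x: "x \<in> {0..1}" for x
  proof (cases "x = 0")
    case True
    \<comment> \<open>continuity at 0, from \<open>ln u \<le> u - 1\<close> at \<open>u = 1 / sqrt t\<close>\<close>
    have le: "eta t \<le> 2 * sqrt t" if "0 \<le> t" for t
    proof (cases "t = 0")
      case False
      then have t: "t > 0" using that by simp
      have "- ln t \<le> 2 * (1 / sqrt t - 1)"
        using ln_le_minus_one[of "1 / sqrt t"] t by (simp add: ln_div ln_sqrt)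
      then have "t * - ln t \<le> t * (2 * (1 / sqrt t - 1))"
        using t by (intro mult_left_mono) auto
      also have "\<dots> \<le> 2 * (t / sqrt t)" using t by (simp add: algebra_simps)
      also have "t / sqrt t = sqrt t" using t by (simp add: real_div_sqrt)
      finally show ?thesis by (simp add: eta_def)
    qed simp
    have "((\<lambda>t. 2 * sqrt t) \<longlongrightarrow> 2 * sqrt 0) (at 0 within {0..1})"
      by (intro tendsto_intros)
    then have "(eta \<longlongrightarrow> 0) (at 0 within {0..1})"
      by (intro tendsto_sandwich[of "\<lambda>_. 0" eta _ "\<lambda>t. 2 * sqrt t"])
        (auto simp: eventually_at_filter eta_nonneg le)
    then show ?thesis using True by (simp add: continuous_within)
  next
    case False
    then have "x > 0" using x by auto
    then show ?thesis unfolding eta_def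
      by (intro continuous_intros) auto
  qed
  then show ?thesis by (simp add: continuous_on_eq_continuous_within)
qed

lemma eta_measurable [measurable]: "eta \<in> borel_measurable borel"
  unfolding eta_def by measurable

text \<open>A substitute for a modulus of continuity that can be integrated: near the diagonal uniform
  continuity gives \<open>\<epsilon>\<close>, and away from it the linear term dominates the bound \<open>1\<close>.\<close>

lemma eta_modulus:
  assumes "\<epsilon> > 0"
  obtains L where "L \<ge> 0"
    "\<And>s t. s \<in> {0..1} \<Longrightarrow> t \<in> {0..1} \<Longrightarrow> \<bar>eta s - eta t\<bar> \<le> \<epsilon> + L * \<bar>s - t\<bar>"
proof -
  have "uniformly_continuous_on {0..1} eta"
    by (intro compact_uniformly_continuous continuous_on_eta) auto
  then obtain \<delta> where \<delta>: "\<delta> > 0"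
    "\<And>s t. s \<in> {0..1} \<Longrightarrow> t \<in> {0..1} \<Longrightarrow> dist t s < \<delta> \<Longrightarrow> dist (eta t) (eta s) < \<epsilon>"
    using assms unfolding uniformly_continuous_on_def by metis
  have "\<bar>eta s - eta t\<bar> \<le> \<epsilon> + (1 / \<delta>) * \<bar>s - t\<bar>" if "s \<in> {0..1}" "t \<in> {0..1}" for s t
  proof (cases "\<bar>s - t\<bar> < \<delta>")
    case True
    then have "\<bar>eta s - eta t\<bar> < \<epsilon>" using \<delta>(2)[of t s] that by (auto simp: dist_real_def)
    moreover have "0 \<le> (1 / \<delta>) * \<bar>s - t\<bar>" using \<delta>(1) by auto
    ultimately show ?thesis by linarith
  next
    case False
    then have "1 \<le> (1 / \<delta>) * \<bar>s - t\<bar>" using \<delta>(1) by (simp add: field_simps)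
    moreover have "\<bar>eta s - eta t\<bar> \<le> 1"
      using that eta_nonneg[of s] eta_nonneg[of t] eta_le_1[of s] eta_le_1[of t] by auto
    ultimately show ?thesis using assms by linarith
  qed
  then show ?thesis using that[of "1 / \<delta>"] \<delta>(1) by auto
qed

text \<open>Fekete's lemma: the averages converge to their infimum \<open>L\<close>, since division of \<open>n\<close> with remainder
  by an \<open>m\<close> whose average is close to \<open>L\<close> bounds \<open>a n / n\<close> by that average up to \<open>O(1 / n)\<close>.\<close>

lemma subadditive_average_convergent:
  fixes a :: "nat \<Rightarrow> real"
  assumes sub: "\<And>m n. a (m + n) \<le> a m + a n" and nonneg: "\<And>n. 0 \<le> a n"
  shows "convergent (\<lambda>n. a n / real n)"
proof -
  define L where "L = (INF n\<in>{1..}. a n / real n)"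
  have bdd: "bdd_below ((\<lambda>n. a n / real n) ` {1..})"
    by (rule bdd_belowI2[of _ 0]) (auto simp: nonneg)
  have mult: "a (q * m + r) \<le> real q * a m + a r" for q m r
  proof (induction q)
    case (Suc q)
    have "a (Suc q * m + r) = a (m + (q * m + r))" by (simp add: algebra_simps)
    also have "\<dots> \<le> a m + a (q * m + r)" by (rule sub)
    finally show ?case using Suc by (simp add: algebra_simps)
  qed simp
  have "(\<lambda>n. a n / real n) \<longlonglongrightarrow> L"
  proof (rule LIMSEQ_I)
    fix e :: real assume e: "e > 0"
    have "\<exists>m\<in>{1..}. a m / real m < L + e / 2"
    proof (rule ccontr)
      assume "\<not> ?thesis"
      then have "L + e / 2 \<le> L"
        unfolding L_def by (intro cINF_greatest) (auto simp: not_less)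
      then show False using e by simp
    qed
    then obtain m where m: "m \<ge> 1" "a m / real m < L + e / 2" by auto
    define C where "C = Max (a ` {..<m})"
    have C: "a r \<le> C" if "r < m" for r unfolding C_def using that by (intro Max_ge) auto
    have C0: "0 \<le> C" using C[of 0] nonneg[of 0] m by auto
    obtain n0 :: nat where n0: "real n0 > 2 * C / e" using reals_Archimedean2 by blast
    show "\<exists>n0. \<forall>n\<ge>n0. norm (a n / real n - L) < e"
    proof (intro exI allI impI)
      fix n assume n: "n \<ge> max 1 n0"
      have npos: "real n > 0" using n by auto
      have lower: "L \<le> a n / real n"
        unfolding L_def using n by (intro cINF_lower bdd) auto
      have "a n = a (n div m * m + n mod m)" by simp
      also have "\<dots> \<le> real (n div m) * a m + a (n mod m)" by (rule mult)
      also have "\<dots> \<le> real (n div m) * a m + C" using m by (intro add_left_mono C) auto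
      also have "real (n div m) * a m \<le> (real n / real m) * a m"
        by (intro mult_right_mono nonneg of_nat_div_le_of_nat)
      finally have "a n / real n \<le> ((real n / real m) * a m + C) / real n"
        using npos by (simp add: divide_right_mono)
      also have "\<dots> = a m / real m + C / real n"
        using npos by (simp add: field_simps)
      also have "C / real n < e / 2"
      proof -
        have "2 * C / e < real n" using n0 n by (smt (verit) max.bounded_iff of_nat_le_iff)
        then show ?thesis using npos e by (simp add: field_simps)
      qed
      finally have "a n / real n < L + e" using m by auto
      then show "norm (a n / real n - L) < e" using lower by auto
    qed
  qed
  then show ?thesis by (auto simp: convergent_def)
qed

lemma cesaro_increments:
  fixes a :: "nat \<Rightarrow> real"
  assumes "(\<lambda>n. a (Suc n) - a n) \<longlonglongrightarrow> h"
  shows "(\<lambda>n. a n / real n) \<longlonglongrightarrow> h"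
proof (rule LIMSEQ_I)
  fix e :: real assume e: "e > 0"
  obtain m where m: "\<And>n. n \<ge> m \<Longrightarrow> \<bar>a (Suc n) - a n - h\<bar> < e / 2"
    using LIMSEQ_D[OF assms, of "e/2"] e by auto
  have bd: "\<bar>a (m + k) - a m - real k * h\<bar> \<le> real k * (e / 2)" for k
  proof (induction k)
    case (Suc k)
    have "\<bar>a (Suc (m + k)) - a (m + k) - h\<bar> < e / 2" by (rule m) simp
    moreover have "a (m + Suc k) - a m - real (Suc k) * h
        = (a (Suc (m + k)) - a (m + k) - h) + (a (m + k) - a m - real k * h)"
      by (simp add: algebra_simps)
    moreover have "real (Suc k) * (e / 2) = e / 2 + real k * (e / 2)"
      by (simp add: algebra_simps)
    ultimately show ?case using Suc by linarith
  qed simp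
  define K where "K = \<bar>a m\<bar> + real m * \<bar>h\<bar>"
  obtain n0 :: nat where n0: "real n0 > 2 * K / e" using reals_Archimedean2 by blast
  show "\<exists>n0. \<forall>n\<ge>n0. norm (a n / real n - h) < e"
  proof (intro exI allI impI)
    fix n assume n: "n \<ge> max (Suc m) n0"
    have npos: "real n > 0" using n by auto
    have nm: "n = m + (n - m)" using n by auto
    have "\<bar>a n - a m - real (n - m) * h\<bar> \<le> real (n - m) * (e / 2)" using bd[of "n - m"] nm by metis
    also have "\<dots> \<le> real n * (e / 2)" using e by (intro mult_right_mono) auto
    finally have 1: "\<bar>a n - a m - real (n - m) * h\<bar> \<le> real n * (e / 2)" .
    have "a n - real n * h = (a n - a m - real (n - m) * h) + (a m - real m * h)"
      using n by (simp add: of_nat_diff algebra_simps)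
    moreover have "\<bar>a m - real m * h\<bar> \<le> K" unfolding K_def
      using abs_triangle_ineq4[of "a m" "real m * h"] by (simp add: abs_mult)
    ultimately have "\<bar>a n - real n * h\<bar> \<le> real n * (e / 2) + K" using 1 by linarith
    also have "K < real n * (e / 2)"
    proof -
      have "2 * K / e < real n" using n0 n by (smt (verit) max.bounded_iff of_nat_le_iff)
      then show ?thesis using e by (simp add: field_simps)
    qed
    finally have "\<bar>a n - real n * h\<bar> < real n * e" by (simp add: mult.commute)
    moreover have "a n / real n - h = (a n - real n * h) / real n" using npos by (simp add: field_simps)
    ultimately show "norm (a n / real n - h) < e" using npos
      by (simp add: abs_divide field_simps)
  qed
qed

text \<open>Partitions are replaced by labellings \<open>X\<close> whose level sets are the cells; joins along the orbit then
  become lists of labels, and the entropy inequalities for random variables apply.\<close>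

definition level_entropy :: "'a measure \<Rightarrow> ('a \<Rightarrow> 'b) \<Rightarrow> real" where
  "level_entropy M X = (\<Sum>v\<in>X ` space M. eta (measure M (X -` {v} \<inter> space M)))"

primrec itinerary :: "('a \<Rightarrow> 'a) \<Rightarrow> ('a \<Rightarrow> 'b) \<Rightarrow> nat \<Rightarrow> 'a \<Rightarrow> 'b list" where
  "itinerary T X 0 = (\<lambda>x. [])"
| "itinerary T X (Suc n) = (\<lambda>x. X x # itinerary T X n (T x))"

lemma itinerary_add: "itinerary T X (m + n) x = itinerary T X m x @ itinerary T X n ((T ^^ m) x)"
  by (induction m arbitrary: x) (auto simp: funpow_swap1)

text \<open>The bridge to information theory: base \<open>exp 1\<close> makes the logarithm natural.\<close>

lemma (in prob_space) level_entropy_eq_entropy: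
  assumes "simple_function M X"
  shows "level_entropy M X = entropy (exp 1) (count_space (X ` space M)) X"
proof -
  interpret information_space M "exp 1" by unfold_locales simp
  show ?thesis
    using entropy_simple_distributed[OF simple_distributedI[OF assms measure_nonneg refl]]
    by (simp add: level_entropy_def eta_def log_def sum_negf)
qed

lemma (in prob_space) level_entropy_compose_le:
  assumes "simple_function M X"
  shows "level_entropy M (f \<circ> X) \<le> level_entropy M X"
proof -
  interpret information_space M "exp 1" by unfold_locales simp
  show ?thesis
    using entropy_data_processing[OF assms, of f] assms
    by (simp add: level_entropy_eq_entropy simple_function_compose)
qed

lemma (in prob_space) level_entropy_Pair_le:
  assumes "simple_function M X" "simple_function M Y"
  shows "level_entropy M (\<lambda>x. (X x, Y x)) \<le> level_entropy M X + level_entropy M Y"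
proof -
  interpret information_space M "exp 1" by unfold_locales simp
  show ?thesis
    using entropy_chain_rule[OF assms] conditional_entropy_less_eq_entropy[OF assms(2,1)]
      simple_function_Pair[OF assms] assms
    by (simp add: level_entropy_eq_entropy)
qed

lemma (in prob_space) level_entropy_nonneg: "0 \<le> level_entropy M X"
  unfolding level_entropy_def by (intro sum_nonneg eta_nonneg) auto

locale measure_preserving_map = prob_space M for M :: "'a measure" +
  fixes T :: "'a \<Rightarrow> 'a"
  assumes T_measurable [measurable]: "T \<in> measurable M M"
    and T_preserves: "distr M M T = M"
begin

lemma T_space: "x \<in> space M \<Longrightarrow> T x \<in> space M"
  by (rule measurable_space[OF T_measurable])

lemma prob_vimage: "A \<in> sets M \<Longrightarrow> prob (T -` A \<inter> space M) = prob A"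
  using measure_distr[OF T_measurable, of A] T_preserves by simp

lemma funpow_measurable [measurable]: "T ^^ n \<in> measurable M M"
  by (induction n) (auto intro: measurable_comp[OF _ T_measurable])

lemma distr_funpow: "distr M M (T ^^ n) = M"
proof (induction n)
  case (Suc n)
  have "distr M M (T \<circ> (T ^^ n)) = distr (distr M M (T ^^ n)) M T"
    by (subst distr_distr) auto
  then show ?case using Suc T_preserves by (simp add: comp_def)
qed (simp add: id_def distr_id)

lemma measure_preserving_funpow: "measure_preserving_map M (T ^^ n)"
  by unfold_locales (auto simp: distr_funpow)

lemma simple_function_comp_T: "simple_function M X \<Longrightarrow> simple_function M (\<lambda>x. X (T x))"
  by (rule simple_function_comp[OF T_measurable])

lemma level_entropy_comp_T:
  assumes X: "simple_function M X"
  shows "level_entropy M (\<lambda>x. X (T x)) = level_entropy M X"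
proof -
  have meas: "X -` {v} \<inter> space M \<in> sets M" for v
    using X by (rule simple_functionD)
  have eq: "prob ((\<lambda>x. X (T x)) -` {v} \<inter> space M) = prob (X -` {v} \<inter> space M)" for v
  proof -
    have "(\<lambda>x. X (T x)) -` {v} \<inter> space M = T -` (X -` {v} \<inter> space M) \<inter> space M"
      using T_space by auto
    then show ?thesis using prob_vimage[OF meas] by simp
  qed
  have "level_entropy M (\<lambda>x. X (T x)) = (\<Sum>v\<in>(\<lambda>x. X (T x)) ` space M. eta (prob (X -` {v} \<inter> space M)))"
    unfolding level_entropy_def eq ..
  also have "\<dots> = (\<Sum>v\<in>X ` space M. eta (prob (X -` {v} \<inter> space M)))"
  proof (rule sum.mono_neutral_left)
    show "finite (X ` space M)" using X by (rule simple_functionD)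
    show "(\<lambda>x. X (T x)) ` space M \<subseteq> X ` space M" using T_space by auto
    show "\<forall>v\<in>X ` space M - (\<lambda>x. X (T x)) ` space M. eta (prob (X -` {v} \<inter> space M)) = 0"
    proof
      fix v assume "v \<in> X ` space M - (\<lambda>x. X (T x)) ` space M"
      then have "(\<lambda>x. X (T x)) -` {v} \<inter> space M = {}" by (force simp: image_iff)
      then have "prob (X -` {v} \<inter> space M) = 0" using eq[of v] by simp
      then show "eta (prob (X -` {v} \<inter> space M)) = 0" by simp
    qed
  qed
  finally show ?thesis by (simp add: level_entropy_def)
qed

lemma simple_itinerary: "simple_function M X \<Longrightarrow> simple_function M (itinerary T X n)"
proof (induction n)
  case (Suc n)
  have "simple_function M (\<lambda>x. (X x, itinerary T X n (T x)))"
    using Suc by (intro simple_function_Pair simple_function_comp_T)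
  from simple_function_compose[OF this, of "\<lambda>(a, b). a # b"] show ?case
    by (simp add: comp_def)
qed simp

lemma level_entropy_itinerary_subadditive:
  assumes X: "simple_function M X"
  shows "level_entropy M (itinerary T X (m + n))
    \<le> level_entropy M (itinerary T X m) + level_entropy M (itinerary T X n)"
proof -
  interpret Tm: measure_preserving_map M "T ^^ m" by (rule measure_preserving_funpow)
  let ?Y = "\<lambda>x. itinerary T X n ((T ^^ m) x)"
  have Y: "simple_function M ?Y" by (intro Tm.simple_function_comp_T simple_itinerary X)
  have "itinerary T X (m + n) = (\<lambda>(a, b). a @ b) \<circ> (\<lambda>x. (itinerary T X m x, ?Y x))"
    by (auto simp: itinerary_add)
  then have "level_entropy M (itinerary T X (m + n)) \<le> level_entropy M (\<lambda>x. (itinerary T X m x, ?Y x))"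
    using level_entropy_compose_le[OF simple_function_Pair[OF simple_itinerary[OF X, of m] Y]] by simp
  also have "\<dots> \<le> level_entropy M (itinerary T X m) + level_entropy M ?Y"
    by (intro level_entropy_Pair_le simple_itinerary X Y)
  also have "level_entropy M ?Y = level_entropy M (itinerary T X n)"
    by (intro Tm.level_entropy_comp_T simple_itinerary X)
  finally show ?thesis .
qed

text \<open>Without this, the limit in the definition of the entropy of a partition would be an arbitrary
  number for partitions that are not generating.\<close>

lemma level_entropy_rate_convergent:
  assumes "simple_function M X"
  shows "convergent (\<lambda>n. level_entropy M (itinerary T X n) / real n)"
  by (intro subadditive_average_convergent level_entropy_itinerary_subadditive assms
      level_entropy_nonneg)

text \<open>A coarser labelling \<open>f \<circ> X\<close> cannot have a larger entropy rate; it transfers the value known for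
  generators to an upper bound for all partitions.\<close>

lemma level_entropy_rate_mono:
  assumes X: "simple_function M X" and f: "\<And>x. x \<in> space M \<Longrightarrow> Y x = f (X x)"
    and Y: "simple_function M Y"
    and limX: "(\<lambda>n. level_entropy M (itinerary T X n) / real n) \<longlonglongrightarrow> h"
  shows "lim (\<lambda>n. level_entropy M (itinerary T Y n) / real n) \<le> h"
proof -
  have eq: "itinerary T Y n x = map f (itinerary T X n x)" if "x \<in> space M" for n x
    using that
  proof (induction n arbitrary: x)
    case (Suc n)
    then show ?case using f T_space by auto
  qed simp
  have "level_entropy M (itinerary T Y n) \<le> level_entropy M (itinerary T X n)" for n
  proof -
    have "level_entropy M (itinerary T Y n) = level_entropy M (map f \<circ> itinerary T X n)"
      unfolding level_entropy_def
    proof (intro sum.cong arg_cong[where f=eta] arg_cong[where f=prob])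
      show "itinerary T Y n ` space M = (map f \<circ> itinerary T X n) ` space M"
        by (intro image_cong) (auto simp: eq)
      show "itinerary T Y n -` {v} \<inter> space M = (map f \<circ> itinerary T X n) -` {v} \<inter> space M" for v
        by (auto simp: eq)
    qed
    also have "\<dots> \<le> level_entropy M (itinerary T X n)"
      by (intro level_entropy_compose_le simple_itinerary X)
    finally show ?thesis .
  qed
  moreover have "(\<lambda>n. level_entropy M (itinerary T Y n) / real n) \<longlonglongrightarrow>
      lim (\<lambda>n. level_entropy M (itinerary T Y n) / real n)"
    using level_entropy_rate_convergent[OF Y] by (simp add: convergent_LIMSEQ_iff)
  ultimately show ?thesis
    by (intro LIMSEQ_le[OF _ limX]) (auto intro!: divide_right_mono)
qed

end

definition cell_of :: "'a set set \<Rightarrow> 'a \<Rightarrow> 'a set" where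
  "cell_of P x = (THE A. A \<in> P \<and> x \<in> A)"

lemma cell_of_eq:
  assumes "partition_on S P" "A \<in> P" "x \<in> A"
  shows "cell_of P x = A"
  unfolding cell_of_def
  using assms partition_onD2[OF assms(1)] by (intro the_equality) (auto simp: disjoint_def)

lemma cell_of_in:
  assumes "partition_on S P" "x \<in> S"
  shows "cell_of P x \<in> P" "x \<in> cell_of P x"
proof -
  obtain A where "A \<in> P" "x \<in> A" using assms partition_onD1[OF assms(1)] by auto
  then show "cell_of P x \<in> P" "x \<in> cell_of P x" using cell_of_eq[OF assms(1)] by auto
qed

lemma finite_meas_partitionD:
  assumes "finite_meas_partition M P"
  shows "finite P" "P \<subseteq> sets M" "partition_on (space M) P"
  using assms by (auto simp: finite_meas_partition_def)

lemma simple_cell_of: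
  assumes P: "finite_meas_partition M P"
  shows "simple_function M (cell_of P)"
proof -
  note P' = finite_meas_partitionD[OF P]
  have "cell_of P ` space M \<subseteq> P" using cell_of_in[OF P'(3)] by auto
  then have "finite (cell_of P ` space M)" using P'(1) finite_subset by blast
  moreover have "cell_of P -` {v} \<inter> space M \<in> sets M" if "v \<in> cell_of P ` space M" for v
  proof -
    have vP: "v \<in> P" using that cell_of_in[OF P'(3)] by auto
    have "cell_of P x = v \<longleftrightarrow> x \<in> v" if "x \<in> space M" for x
      using cell_of_in[OF P'(3) that] cell_of_eq[OF P'(3) vP] by auto
    moreover have "v \<subseteq> space M" using vP P'(2) sets.sets_into_space by auto
    ultimately have "cell_of P -` {v} \<inter> space M = v" by auto
    then show ?thesis using vP P'(2) by auto
  qed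
  ultimately show ?thesis by (auto simp: simple_function_def)
qed

text \<open>The join of a partition along the orbit may contain the empty set, the level sets of a labelling
  never do; adding it on both sides gives an equality.\<close>

lemma (in measure_preserving_map) iterated_join_eq_levels:
  assumes P: "partition_on (space M) P"
  shows "insert {} (iterated_join M T P n) =
    insert {} ((\<lambda>v. itinerary T (cell_of P) n -` {v} \<inter> space M) ` itinerary T (cell_of P) n ` space M)"
    (is "_ = insert {} (?L n ` ?I n ` space M)")
proof (induction n)
  case 0
  then show ?case using not_empty by (auto simp: image_image)
next
  case (Suc n)
  have level: "A \<inter> (T -` ?L n v \<inter> space M) = ?L (Suc n) (A # v)" if "A \<in> P" for A v
  proof -
    have "cell_of P x = A \<longleftrightarrow> x \<in> A" if "x \<in> space M" for x
      using cell_of_in[OF P that] cell_of_eq[OF P \<open>A \<in> P\<close>] by auto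
    then show ?thesis using T_space by auto
  qed
  have "B \<in> insert {} (?L (Suc n) ` ?I (Suc n) ` space M)" if "B \<in> iterated_join M T P (Suc n)" for B
  proof -
    obtain A B' where B: "A \<in> P" "B' \<in> iterated_join M T P n" "B = A \<inter> (T -` B' \<inter> space M)"
      using \<open>B \<in> iterated_join M T P (Suc n)\<close> by auto
    then have "B' \<in> insert {} (?L n ` ?I n ` space M)" unfolding Suc.IH[symmetric] by simp
    then consider "B' = {}" | v where "B' = ?L n v" by auto
    then show ?thesis
    proof cases
      case 1 then show ?thesis using B by simp
    next
      case 2
      then have BL: "B = ?L (Suc n) (A # v)" using B level by simp
      show ?thesis
      proof (cases "B = {}")
        case False
        then obtain x where x: "x \<in> B" by auto
        then have Av: "A # v = ?I (Suc n) x" and xM: "x \<in> space M" unfolding BL by auto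
        have "B = ?L (Suc n) (?I (Suc n) x)" unfolding BL Av ..
        then show ?thesis using xM by (intro insertI2) (rule image_eqI[OF _ imageI])
      qed simp
    qed
  qed
  moreover have "?L (Suc n) (?I (Suc n) x) \<in> iterated_join M T P (Suc n)" if x: "x \<in> space M" for x
  proof -
    let ?v = "?I n (T x)"
    have "T x \<in> ?L n ?v" using T_space x by auto
    moreover have "?L n ?v \<in> insert {} (iterated_join M T P n)"
      unfolding Suc.IH using T_space[OF x] by (intro insertI2 imageI)
    ultimately have "?L n ?v \<in> iterated_join M T P n" by auto
    moreover have "cell_of P x \<in> P" using cell_of_in[OF P x] by simp
    moreover have "?L (Suc n) (?I (Suc n) x) = cell_of P x \<inter> (T -` ?L n ?v \<inter> space M)"
      using level[of "cell_of P x" ?v] calculation by simp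
    ultimately show ?thesis unfolding iterated_join.simps
      by (intro CollectI exI[of _ "cell_of P x"] exI[of _ "?L n ?v"] conjI)
  qed
  ultimately show ?case
    by (intro subset_antisym insert_subsetI) (auto simp del: iterated_join.simps itinerary.simps)
qed

lemma (in measure_preserving_map) partition_entropy_join:
  assumes P: "finite_meas_partition M P"
  shows "partition_entropy M (iterated_join M T P n) = level_entropy M (itinerary T (cell_of P) n)"
proof -
  note P' = finite_meas_partitionD[OF P]
  let ?I = "itinerary T (cell_of P) n"
  let ?L = "\<lambda>v. ?I -` {v} \<inter> space M"
  have fin: "finite (?I ` space M)"
    by (rule simple_functionD(1)[OF simple_itinerary[OF simple_cell_of[OF P]]])
  have eq: "insert {} (iterated_join M T P n) = insert {} (?L ` ?I ` space M)"
    by (rule iterated_join_eq_levels[OF P'(3)])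
  have fin': "finite (iterated_join M T P n)"
    using eq fin by (metis finite_imageI finite_insert)
  have "partition_entropy M (iterated_join M T P n) = (\<Sum>A\<in>iterated_join M T P n. eta (prob A))"
    by (simp add: partition_entropy_def eta_def sum_negf)
  also have "\<dots> = (\<Sum>A\<in>insert {} (iterated_join M T P n). eta (prob A))"
    using fin' by (intro sum.mono_neutral_left) auto
  also have "\<dots> = (\<Sum>A\<in>?L ` ?I ` space M. eta (prob A))"
    unfolding eq using fin by (intro sum.mono_neutral_right) auto
  also have "\<dots> = level_entropy M ?I"
    unfolding level_entropy_def
    by (subst sum.reindex) (auto simp: inj_on_def o_def)
  finally show ?thesis .
qed

lemma (in measure_preserving_map) entropy_wrt_eq_rate:
  assumes "finite_meas_partition M P"
  shows "entropy_wrt M T P = lim (\<lambda>n. level_entropy M (itinerary T (cell_of P) n) / real n)"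
  using partition_entropy_join[OF assms] by (simp add: entropy_wrt_def)

section \<open>The entropy rate of a generator\<close>

text \<open>The conditional expectation of \<open>g\<close> given the finite-valued \<open>Y\<close>; on null cells it is \<open>0 / 0 = 0\<close>.\<close>

definition cell_avg :: "'a measure \<Rightarrow> ('a \<Rightarrow> 'b) \<Rightarrow> ('a \<Rightarrow> real) \<Rightarrow> 'a \<Rightarrow> real" where
  "cell_avg M Y g x =
     (LINT y|M. indicator (Y -` {Y x} \<inter> space M) y * g y) / measure M (Y -` {Y x} \<inter> space M)"

context prob_space
begin

lemma simple_levels_sets: "simple_function M Y \<Longrightarrow> Y -` W \<inter> space M \<in> sets M"
  by (rule simple_functionD)

lemma integral_simple_compose:
  fixes \<phi> :: "'b \<Rightarrow> real"
  assumes Y: "simple_function M Y"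
  shows "integrable M (\<lambda>x. \<phi> (Y x))"
    and "(LINT x|M. \<phi> (Y x)) = (\<Sum>v\<in>Y ` space M. \<phi> v * prob (Y -` {v} \<inter> space M))"
proof -
  have fin: "finite (Y ` space M)" using Y by (rule simple_functionD)
  have eq: "\<phi> (Y x) = (\<Sum>v\<in>Y ` space M. \<phi> v * indicator (Y -` {v} \<inter> space M) x)"
    if x: "x \<in> space M" for x
  proof -
    have "(\<Sum>v\<in>Y ` space M. \<phi> v * indicator (Y -` {v} \<inter> space M) x)
        = (\<Sum>v\<in>Y ` space M. if v = Y x then \<phi> v else 0)"
      using x by (intro sum.cong) (auto simp: indicator_def)
    also have "\<dots> = \<phi> (Y x)" using fin x by simp
    finally show ?thesis ..
  qed
  have int: "integrable M (\<lambda>x. \<Sum>v\<in>Y ` space M. \<phi> v * indicator (Y -` {v} \<inter> space M) x)"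
    using simple_levels_sets[OF Y]
    by (intro Bochner_Integration.integrable_sum integrable_mult_right integrable_real_indicator)
      (auto simp: emeasure_eq_measure)
  show "integrable M (\<lambda>x. \<phi> (Y x))"
    using int by (subst Bochner_Integration.integrable_cong[OF refl eq]) auto
  have "(LINT x|M. \<phi> (Y x)) = (LINT x|M. (\<Sum>v\<in>Y ` space M. \<phi> v * indicator (Y -` {v} \<inter> space M) x))"
    by (intro Bochner_Integration.integral_cong eq refl)
  also have "\<dots> = (\<Sum>v\<in>Y ` space M. \<phi> v * prob (Y -` {v} \<inter> space M))"
    using simple_levels_sets[OF Y]
    by (subst Bochner_Integration.integral_sum) (auto simp: emeasure_eq_measure)
  finally show "(LINT x|M. \<phi> (Y x)) = (\<Sum>v\<in>Y ` space M. \<phi> v * prob (Y -` {v} \<inter> space M))" .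
qed

lemma integrable_indicator_mult:
  fixes g :: "'a \<Rightarrow> real"
  assumes "A \<in> sets M" "integrable M g"
  shows "integrable M (\<lambda>x. indicator A x * g x)"
  using integrable_real_mult_indicator[OF assms] by (simp add: mult.commute)

lemma integral_sum_levels:
  fixes g :: "'a \<Rightarrow> real"
  assumes Y: "simple_function M Y" and g: "integrable M g"
  shows "(LINT x|M. g x) = (\<Sum>v\<in>Y ` space M. LINT x|M. indicator (Y -` {v} \<inter> space M) x * g x)"
proof -
  have fin: "finite (Y ` space M)" using Y by (rule simple_functionD)
  have "(LINT x|M. g x) = (LINT x|M. (\<Sum>v\<in>Y ` space M. indicator (Y -` {v} \<inter> space M) x * g x))"
  proof (intro Bochner_Integration.integral_cong refl)
    fix x assume x: "x \<in> space M"
    have "(\<Sum>v\<in>Y ` space M. indicator (Y -` {v} \<inter> space M) x * g x)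
        = (\<Sum>v\<in>Y ` space M. if v = Y x then g x else 0)"
      using x by (intro sum.cong) (auto simp: indicator_def)
    also have "\<dots> = g x" using fin x by simp
    finally show "g x = (\<Sum>v\<in>Y ` space M. indicator (Y -` {v} \<inter> space M) x * g x)" ..
  qed
  also have "\<dots> = (\<Sum>v\<in>Y ` space M. LINT x|M. indicator (Y -` {v} \<inter> space M) x * g x)"
    using simple_levels_sets[OF Y] g
    by (intro Bochner_Integration.integral_sum integrable_indicator_mult) auto
  finally show ?thesis .
qed

lemma cell_avg_integrable: "simple_function M Y \<Longrightarrow> integrable M (cell_avg M Y g)"
  unfolding cell_avg_def
  using integral_simple_compose(1)[of Y "\<lambda>v. (LINT y|M. indicator (Y -` {v} \<inter> space M) y * g y)
    / prob (Y -` {v} \<inter> space M)"] by simp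

lemma cell_avg_L1_contract:
  assumes Y: "simple_function M Y" and g: "integrable M g"
  shows "(LINT x|M. \<bar>cell_avg M Y g x\<bar>) \<le> (LINT x|M. \<bar>g x\<bar>)"
proof -
  let ?J = "\<lambda>v. LINT y|M. indicator (Y -` {v} \<inter> space M) y * g y"
  let ?p = "\<lambda>v. prob (Y -` {v} \<inter> space M)"
  have "(LINT x|M. \<bar>cell_avg M Y g x\<bar>) = (\<Sum>v\<in>Y ` space M. \<bar>?J v / ?p v\<bar> * ?p v)"
    unfolding cell_avg_def by (rule integral_simple_compose(2)[OF Y, of "\<lambda>v. \<bar>?J v / ?p v\<bar>"])
  also have "\<dots> \<le> (\<Sum>v\<in>Y ` space M. LINT x|M. indicator (Y -` {v} \<inter> space M) x * \<bar>g x\<bar>)"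
  proof (rule sum_mono)
    fix v
    have "\<bar>?J v / ?p v\<bar> * ?p v \<le> \<bar>?J v\<bar>"
      by (auto simp: abs_divide)
    also have "\<dots> \<le> (LINT x|M. \<bar>indicator (Y -` {v} \<inter> space M) x * g x\<bar>)"
      using integral_abs_bound by blast
    also have "\<dots> = (LINT x|M. indicator (Y -` {v} \<inter> space M) x * \<bar>g x\<bar>)"
      by (simp add: abs_mult)
    finally show "\<bar>?J v / ?p v\<bar> * ?p v \<le> (LINT x|M. indicator (Y -` {v} \<inter> space M) x * \<bar>g x\<bar>)" .
  qed
  also have "\<dots> = (LINT x|M. \<bar>g x\<bar>)"
    using g by (intro integral_sum_levels[OF Y, symmetric]) auto
  finally show ?thesis .
qed

lemma cell_avg_range:
  assumes Y: "simple_function M Y" and g: "g \<in> borel_measurable M"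
    "\<And>x. x \<in> space M \<Longrightarrow> 0 \<le> g x" "\<And>x. x \<in> space M \<Longrightarrow> g x \<le> 1"
  shows "cell_avg M Y g x \<in> {0..1}"
proof -
  let ?C = "Y -` {Y x} \<inter> space M"
  have C: "?C \<in> sets M" by (rule simple_levels_sets[OF Y])
  have "0 \<le> (LINT y|M. indicator ?C y * g y)"
    using g(2) by (intro Bochner_Integration.integral_nonneg) auto
  moreover have "(LINT y|M. indicator ?C y * g y) \<le> (LINT y|M. indicator ?C y)"
  proof (intro integral_mono_AE)
    show "integrable M (\<lambda>y. indicator ?C y * g y)"
      using g C by (intro integrable_indicator_mult integrable_const_bound[where B=1]) auto
    show "integrable M (indicator ?C :: _ \<Rightarrow> real)" using C by (auto simp: emeasure_eq_measure)
    show "AE y in M. indicator ?C y * g y \<le> indicator ?C y"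
      using g(3) by (auto simp: indicator_def)
  qed
  ultimately show ?thesis
    using C by (auto simp: cell_avg_def divide_le_eq_1 zero_less_measure_iff)
qed

text \<open>Averaging over cells fixes functions of \<open>Y\<close> and does not increase \<open>L\<^sup>1\<close> norms.  So it moves \<open>g\<close> by at
  most twice the distance from \<open>g\<close> to any function of \<open>Y\<close>.\<close>

lemma cell_avg_near:
  assumes Y: "simple_function M Y" and g: "integrable M g"
  shows "(LINT x|M. \<bar>cell_avg M Y g x - g x\<bar>) \<le> 2 * (LINT x|M. \<bar>g x - \<phi> (Y x)\<bar>)"
proof -
  let ?h = "\<lambda>x. \<phi> (Y x)"
  have h: "integrable M ?h" by (rule integral_simple_compose(1)[OF Y])
  have gh: "integrable M (\<lambda>x. g x - ?h x)" using g h by simp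
  have fix_h: "AE x in M. cell_avg M Y ?h x = ?h x"
  proof -
    have "AE x in M. \<forall>v\<in>{v \<in> Y ` space M. prob (Y -` {v} \<inter> space M) = 0}. x \<notin> Y -` {v} \<inter> space M"
    proof (rule AE_finite_allI)
      show "finite {v \<in> Y ` space M. prob (Y -` {v} \<inter> space M) = 0}"
        using simple_functionD(1)[OF Y] by simp
      fix v assume "v \<in> {v \<in> Y ` space M. prob (Y -` {v} \<inter> space M) = 0}"
      then have "Y -` {v} \<inter> space M \<in> null_sets M"
        using simple_levels_sets[OF Y] by (auto simp: null_sets_def emeasure_eq_measure)
      then show "AE x in M. x \<notin> Y -` {v} \<inter> space M" by (rule AE_not_in)
    qed
    then show ?thesis
    proof (rule AE_mp, intro AE_I2 impI)
      fix x assume x: "x \<in> space M"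
        and nz: "\<forall>v\<in>{v \<in> Y ` space M. prob (Y -` {v} \<inter> space M) = 0}. x \<notin> Y -` {v} \<inter> space M"
      let ?C = "Y -` {Y x} \<inter> space M"
      have "prob ?C \<noteq> 0" using nz x by auto
      moreover have "(LINT y|M. indicator ?C y * ?h y) = (LINT y|M. indicator ?C y * ?h x)"
        by (intro Bochner_Integration.integral_cong) (auto simp: indicator_def)
      moreover have "\<dots> = prob ?C * ?h x"
        using simple_levels_sets[OF Y, of "{Y x}"] by simp
      ultimately show "cell_avg M Y ?h x = ?h x" by (simp add: cell_avg_def)
    qed
  qed
  have lin: "cell_avg M Y g x - cell_avg M Y ?h x = cell_avg M Y (\<lambda>x. g x - ?h x) x" for x
  proof -
    let ?C = "Y -` {Y x} \<inter> space M"
    have C: "?C \<in> sets M" by (rule simple_levels_sets[OF Y])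
    show ?thesis
      unfolding cell_avg_def right_diff_distrib
      by (subst Bochner_Integration.integral_diff)
        (auto simp: diff_divide_distrib intro!: integrable_indicator_mult C g h)
  qed
  have "(LINT x|M. \<bar>cell_avg M Y g x - g x\<bar>)
      \<le> (LINT x|M. \<bar>cell_avg M Y (\<lambda>x. g x - ?h x) x\<bar> + \<bar>g x - ?h x\<bar>)"
  proof (intro integral_mono_AE)
    show "integrable M (\<lambda>x. \<bar>cell_avg M Y g x - g x\<bar>)"
      using cell_avg_integrable[OF Y] g by auto
    show "integrable M (\<lambda>x. \<bar>cell_avg M Y (\<lambda>x. g x - ?h x) x\<bar> + \<bar>g x - ?h x\<bar>)"
      using cell_avg_integrable[OF Y] gh by auto
    show "AE x in M. \<bar>cell_avg M Y g x - g x\<bar> \<le> \<bar>cell_avg M Y (\<lambda>x. g x - ?h x) x\<bar> + \<bar>g x - ?h x\<bar>"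
      using fix_h
    proof eventually_elim
      case (elim x)
      then show ?case unfolding lin[symmetric] by linarith
    qed
  qed
  also have "\<dots> = (LINT x|M. \<bar>cell_avg M Y (\<lambda>x. g x - ?h x) x\<bar>) + (LINT x|M. \<bar>g x - ?h x\<bar>)"
    using cell_avg_integrable[OF Y] gh by (intro Bochner_Integration.integral_add) auto
  also have "\<dots> \<le> 2 * (LINT x|M. \<bar>g x - ?h x\<bar>)"
    using cell_avg_L1_contract[OF Y gh] by simp
  finally show ?thesis .
qed

end

text \<open>A generating labelling: every measurable set is, up to arbitrarily small measure, a union of cells of
  \<open>n\<close>-step itineraries, for all large \<open>n\<close>.\<close>

locale generator = measure_preserving_map M T for M :: "'a measure" and T +
  fixes X :: "'a \<Rightarrow> 'b"
  assumes X_simple: "simple_function M X"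
    and generates: "\<And>A \<epsilon>. A \<in> sets M \<Longrightarrow> \<epsilon> > 0 \<Longrightarrow>
      \<exists>n0. \<forall>n\<ge>n0. \<exists>W. prob (sym_diff A (itinerary T X n -` W \<inter> space M)) < \<epsilon>"
begin

text \<open>From sets to integrable functions by the usual closure argument; the functions of the \<open>n\<close>-step
  itinerary form a linear space, and dominated convergence handles limits.\<close>

lemma L1_generates:
  fixes g :: "'a \<Rightarrow> real"
  assumes "integrable M g" "\<epsilon> > 0"
  shows "\<exists>n0. \<forall>n\<ge>n0. \<exists>\<phi>. (LINT x|M. \<bar>g x - \<phi> (itinerary T X n x)\<bar>) < \<epsilon>"
  using assms
proof (induction g arbitrary: \<epsilon> rule: integrable_induct)
  case (base A c)
  obtain n0 where n0: "\<And>n. n \<ge> n0 \<Longrightarrow>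
      \<exists>W. prob (sym_diff A (itinerary T X n -` W \<inter> space M)) < \<epsilon> / (\<bar>c\<bar> + 1)"
    using generates[OF base(1), of "\<epsilon> / (\<bar>c\<bar> + 1)"] base(3) by (auto simp: field_simps add_pos_nonneg)
  show ?case
  proof (rule exI, intro allI impI)
    fix n assume "n \<ge> n0"
    then obtain W where W: "prob (sym_diff A (itinerary T X n -` W \<inter> space M)) < \<epsilon> / (\<bar>c\<bar> + 1)"
      using n0 by blast
    let ?U = "itinerary T X n -` W \<inter> space M"
    have U: "?U \<in> sets M" by (rule simple_levels_sets[OF simple_itinerary[OF X_simple]])
    have "(LINT x|M. \<bar>indicator A x *\<^sub>R c - indicator W (itinerary T X n x) * c\<bar>)
        = (LINT x|M. indicator (sym_diff A ?U) x * \<bar>c\<bar>)"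
      by (intro Bochner_Integration.integral_cong) (auto simp: indicator_def)
    also have "\<dots> = prob (sym_diff A ?U) * \<bar>c\<bar>"
      using base(1) U by (subst integral_mult_left_zero) (auto intro!: sets.Un sets.Diff)
    also have "\<dots> \<le> prob (sym_diff A ?U) * (\<bar>c\<bar> + 1)"
      by (intro mult_left_mono) auto
    also have "\<dots> < \<epsilon>" using W by (simp add: field_simps add_pos_nonneg)
    finally have "(LINT x|M. \<bar>indicator A x *\<^sub>R c - indicator W (itinerary T X n x) * c\<bar>) < \<epsilon>" .
    then show "\<exists>\<phi>. (LINT x|M. \<bar>indicator A x *\<^sub>R c - \<phi> (itinerary T X n x)\<bar>) < \<epsilon>"
      by (intro exI[of _ "\<lambda>v. indicator W v * c"])
  qed
next
  case (add f g)
  obtain n1 where n1: "\<And>n. n \<ge> n1 \<Longrightarrow> \<exists>\<phi>. (LINT x|M. \<bar>f x - \<phi> (itinerary T X n x)\<bar>) < \<epsilon> / 2"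
    using add.IH(1)[of "\<epsilon> / 2"] add.prems by auto
  obtain n2 where n2: "\<And>n. n \<ge> n2 \<Longrightarrow> \<exists>\<phi>. (LINT x|M. \<bar>g x - \<phi> (itinerary T X n x)\<bar>) < \<epsilon> / 2"
    using add.IH(2)[of "\<epsilon> / 2"] add.prems by auto
  show ?case
  proof (intro exI[of _ "max n1 n2"] allI impI)
    fix n assume "n \<ge> max n1 n2"
    then obtain \<phi> \<psi> where \<phi>: "(LINT x|M. \<bar>f x - \<phi> (itinerary T X n x)\<bar>) < \<epsilon> / 2"
      and \<psi>: "(LINT x|M. \<bar>g x - \<psi> (itinerary T X n x)\<bar>) < \<epsilon> / 2"
      using n1 n2 by (meson max.bounded_iff)
    note int = integral_simple_compose(1)[OF simple_itinerary[OF X_simple, of n], of \<phi>]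
      integral_simple_compose(1)[OF simple_itinerary[OF X_simple, of n], of \<psi>]
    have "(LINT x|M. \<bar>f x + g x - (\<phi> (itinerary T X n x) + \<psi> (itinerary T X n x))\<bar>)
        \<le> (LINT x|M. \<bar>f x - \<phi> (itinerary T X n x)\<bar> + \<bar>g x - \<psi> (itinerary T X n x)\<bar>)"
      using add.hyps int
      by (intro integral_mono) (auto intro!: Bochner_Integration.integrable_add Bochner_Integration.integrable_diff integrable_abs)
    also have "\<dots> = (LINT x|M. \<bar>f x - \<phi> (itinerary T X n x)\<bar>) + (LINT x|M. \<bar>g x - \<psi> (itinerary T X n x)\<bar>)"
      using add.hyps int
      by (intro Bochner_Integration.integral_add) (auto intro!: Bochner_Integration.integrable_diff integrable_abs)
    finally have "(LINT x|M. \<bar>f x + g x - (\<phi> (itinerary T X n x) + \<psi> (itinerary T X n x))\<bar>) < \<epsilon>"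
      using \<phi> \<psi> by simp
    then show "\<exists>\<theta>. (LINT x|M. \<bar>f x + g x - \<theta> (itinerary T X n x)\<bar>) < \<epsilon>"
      by (intro exI[of _ "\<lambda>v. \<phi> v + \<psi> v"])
  qed
next
  case (lim f s)
  have "(\<lambda>i. LINT x|M. \<bar>f x - s i x\<bar>) \<longlonglongrightarrow> (LINT x|M. 0)"
  proof (rule integral_dominated_convergence[where w="\<lambda>x. 3 * \<bar>f x\<bar>"])
    show "AE x in M. (\<lambda>i. \<bar>f x - s i x\<bar>) \<longlonglongrightarrow> 0"
    proof (rule AE_I2)
      fix x assume "x \<in> space M"
      then have "(\<lambda>i. s i x) \<longlonglongrightarrow> f x" by (rule lim.hyps)
      then have "(\<lambda>i. \<bar>f x - s i x\<bar>) \<longlonglongrightarrow> \<bar>f x - f x\<bar>" by (intro tendsto_intros)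
      then show "(\<lambda>i. \<bar>f x - s i x\<bar>) \<longlonglongrightarrow> 0" by simp
    qed
    show "AE x in M. norm (\<bar>f x - s i x\<bar>) \<le> 3 * \<bar>f x\<bar>" for i
      using lim.hyps(3)[of _ i] by (intro AE_I2) (smt (verit) real_norm_def)
  qed (use lim.hyps in auto)
  then have "(\<lambda>i. LINT x|M. \<bar>f x - s i x\<bar>) \<longlonglongrightarrow> 0" by simp
  then have "eventually (\<lambda>i. (LINT x|M. \<bar>f x - s i x\<bar>) < \<epsilon> / 2) sequentially"
    by (rule order_tendstoD(2)) (use lim.prems in simp)
  then obtain i where i: "(LINT x|M. \<bar>f x - s i x\<bar>) < \<epsilon> / 2"
    by (auto simp: eventually_sequentially)
  have "\<exists>n0. \<forall>n\<ge>n0. \<exists>\<phi>. (LINT x|M. \<bar>s i x - \<phi> (itinerary T X n x)\<bar>) < \<epsilon> / 2"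
    by (rule lim.IH) (use lim.prems in simp)
  then obtain n1 where n1: "\<And>n. n \<ge> n1 \<Longrightarrow> \<exists>\<phi>. (LINT x|M. \<bar>s i x - \<phi> (itinerary T X n x)\<bar>) < \<epsilon> / 2"
    by auto
  show ?case
  proof (intro exI[of _ n1] allI impI)
    fix n assume "n \<ge> n1"
    then obtain \<phi> where \<phi>: "(LINT x|M. \<bar>s i x - \<phi> (itinerary T X n x)\<bar>) < \<epsilon> / 2"
      using n1 by blast
    note int = integral_simple_compose(1)[OF simple_itinerary[OF X_simple, of n], of \<phi>] lim.hyps(1)[of i] lim.hyps(4)
    have "(LINT x|M. \<bar>f x - \<phi> (itinerary T X n x)\<bar>)
        \<le> (LINT x|M. \<bar>f x - s i x\<bar> + \<bar>s i x - \<phi> (itinerary T X n x)\<bar>)"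
      using int
      by (intro integral_mono) (auto intro!: Bochner_Integration.integrable_add Bochner_Integration.integrable_diff integrable_abs)
    also have "\<dots> = (LINT x|M. \<bar>f x - s i x\<bar>) + (LINT x|M. \<bar>s i x - \<phi> (itinerary T X n x)\<bar>)"
      using int
      by (intro Bochner_Integration.integral_add) (auto intro!: Bochner_Integration.integrable_diff integrable_abs)
    finally have "(LINT x|M. \<bar>f x - \<phi> (itinerary T X n x)\<bar>) < \<epsilon>" using i \<phi> by simp
    then show "\<exists>\<phi>. (LINT x|M. \<bar>f x - \<phi> (itinerary T X n x)\<bar>) < \<epsilon>"
      by (intro exI[of _ \<phi>])
  qed
qed

lemma cell_avg_converges:
  assumes g: "integrable M g"
  shows "(\<lambda>n. LINT x|M. \<bar>cell_avg M (itinerary T X n) g x - g x\<bar>) \<longlonglongrightarrow> 0"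
proof (rule LIMSEQ_I)
  fix e :: real assume "e > 0"
  then obtain n0 where n0: "\<And>n. n \<ge> n0 \<Longrightarrow> \<exists>\<phi>. (LINT x|M. \<bar>g x - \<phi> (itinerary T X n x)\<bar>) < e / 2"
    using L1_generates[OF g, of "e / 2"] by auto
  show "\<exists>n0. \<forall>n\<ge>n0. norm ((LINT x|M. \<bar>cell_avg M (itinerary T X n) g x - g x\<bar>) - 0) < e"
  proof (intro exI allI impI)
    fix n assume "n \<ge> n0"
    then obtain \<phi> where \<phi>: "(LINT x|M. \<bar>g x - \<phi> (itinerary T X n x)\<bar>) < e / 2" using n0 by blast
    have "0 \<le> (LINT x|M. \<bar>cell_avg M (itinerary T X n) g x - g x\<bar>)"
      by (intro Bochner_Integration.integral_nonneg) auto
    then show "norm ((LINT x|M. \<bar>cell_avg M (itinerary T X n) g x - g x\<bar>) - 0) < e"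
      using cell_avg_near[OF simple_itinerary[OF X_simple, of n] g, of \<phi>] \<phi> by simp
  qed
qed

lemma eta_cell_avg_converges:
  assumes g: "g \<in> borel_measurable M" "\<And>x. x \<in> space M \<Longrightarrow> 0 \<le> g x" "\<And>x. x \<in> space M \<Longrightarrow> g x \<le> 1"
  shows "(\<lambda>n. LINT x|M. eta (cell_avg M (itinerary T X n) g x)) \<longlonglongrightarrow> (LINT x|M. eta (g x))"
proof (rule LIMSEQ_I)
  fix e :: real assume e: "e > 0"
  have g_int: "integrable M g" using g by (intro integrable_const_bound[where B=1]) auto
  obtain L where L: "L \<ge> 0"
    "\<And>s t. s \<in> {0..1} \<Longrightarrow> t \<in> {0..1} \<Longrightarrow> \<bar>eta s - eta t\<bar> \<le> e / 2 + L * \<bar>s - t\<bar>"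
    using eta_modulus[of "e / 2"] e by auto
  have "e / (2 * (L + 1)) > 0" using e L by simp
  then obtain n0 where n0: "\<And>n. n \<ge> n0 \<Longrightarrow>
      (LINT x|M. \<bar>cell_avg M (itinerary T X n) g x - g x\<bar>) < e / (2 * (L + 1))"
    using LIMSEQ_D[OF cell_avg_converges[OF g_int], of "e / (2 * (L + 1))"] by auto
  show "\<exists>n0. \<forall>n\<ge>n0. norm ((LINT x|M. eta (cell_avg M (itinerary T X n) g x)) - (LINT x|M. eta (g x))) < e"
  proof (intro exI allI impI)
    fix n assume n: "n \<ge> n0"
    let ?E = "cell_avg M (itinerary T X n) g"
    have Y: "simple_function M (itinerary T X n)" by (rule simple_itinerary[OF X_simple])
    have E_int: "integrable M ?E" by (rule cell_avg_integrable[OF Y])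
    have E01: "?E x \<in> {0..1}" for x by (rule cell_avg_range[OF Y g])
    have Em: "?E \<in> borel_measurable M" using E_int by auto
    have bE: "\<bar>eta (?E x)\<bar> \<le> 1" for x using eta_nonneg eta_le_1 E01[of x] by auto
    have bg: "\<bar>eta (g x)\<bar> \<le> 1" if "x \<in> space M" for x using eta_nonneg eta_le_1 g that by auto
    have i1: "integrable M (\<lambda>x. eta (?E x))"
      using bE Em by (intro integrable_const_bound[where B=1]) auto
    have i2: "integrable M (\<lambda>x. eta (g x))"
      using bg g(1) by (intro integrable_const_bound[where B=1]) auto
    have i3: "integrable M (\<lambda>x. \<bar>?E x - g x\<bar>)" using E_int g_int by auto
    have "\<bar>(LINT x|M. eta (?E x)) - (LINT x|M. eta (g x))\<bar> = \<bar>LINT x|M. eta (?E x) - eta (g x)\<bar>"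
      using i1 i2 by simp
    also have "\<dots> \<le> (LINT x|M. \<bar>eta (?E x) - eta (g x)\<bar>)"
      using integral_abs_bound by blast
    also have "\<dots> \<le> (LINT x|M. e / 2 + L * \<bar>?E x - g x\<bar>)"
      using i1 i2 i3 L(2) E01 g by (intro integral_mono) auto
    also have "\<dots> = e / 2 + L * (LINT x|M. \<bar>?E x - g x\<bar>)"
      using i3 by (simp add: prob_space)
    also have "L * (LINT x|M. \<bar>?E x - g x\<bar>) \<le> L * (e / (2 * (L + 1)))"
      using n0[OF n] L(1) by (intro mult_left_mono) auto
    also have "L * (e / (2 * (L + 1))) < e / 2" using e L(1) by (simp add: field_simps)
    finally show "norm ((LINT x|M. eta (?E x)) - (LINT x|M. eta (g x))) < e" by simp
  qed
qed

text \<open>The chain rule in concrete form.  Here \<open>g r\<close> is the conditional probability of the first label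
  \<open>r\<close> given the rest of the orbit; averaging it over a cell of the next \<open>n\<close> labels gives the
  conditional probability given these labels.\<close>

lemma level_entropy_increment:
  assumes g: "\<And>r. r \<in> X ` space M \<Longrightarrow> g r \<in> borel_measurable M"
    and cond: "\<And>r B. r \<in> X ` space M \<Longrightarrow> B \<in> sets M \<Longrightarrow>
      prob (X -` {r} \<inter> (T -` B \<inter> space M)) = (LINT y|M. indicator B y * g r y)"
  shows "level_entropy M (itinerary T X (Suc n)) - level_entropy M (itinerary T X n)
    = (\<Sum>r\<in>X ` space M. LINT y|M. eta (cell_avg M (itinerary T X n) (g r) y))"
proof -
  let ?Y = "itinerary T X n"
  let ?R = "X ` space M" and ?V = "?Y ` space M"
  let ?p = "\<lambda>v. prob (?Y -` {v} \<inter> space M)"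
  let ?m = "\<lambda>r v. prob (X -` {r} \<inter> (T -` (?Y -` {v} \<inter> space M) \<inter> space M))"
  have Y: "simple_function M ?Y" by (rule simple_itinerary[OF X_simple])
  have finR: "finite ?R" and finV: "finite ?V"
    using simple_functionD(1)[OF X_simple] simple_functionD(1)[OF Y] by auto
  have Ys: "?Y -` {v} \<inter> space M \<in> sets M" for v by (rule simple_levels_sets[OF Y])
  have Xs: "X -` {r} \<inter> space M \<in> sets M" for r by (rule simple_levels_sets[OF X_simple])
  have lev: "itinerary T X (Suc n) -` {r # v} \<inter> space M = X -` {r} \<inter> (T -` (?Y -` {v} \<inter> space M) \<inter> space M)" for r v
    using T_space by auto
  have "level_entropy M (itinerary T X (Suc n))
      = (\<Sum>w\<in>(\<lambda>(r, v). r # v) ` (?R \<times> ?V). eta (prob (itinerary T X (Suc n) -` {w} \<inter> space M)))"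
    unfolding level_entropy_def
  proof (rule sum.mono_neutral_left)
    show "finite ((\<lambda>(r, v). r # v) ` (?R \<times> ?V))" using finR finV by auto
    show "itinerary T X (Suc n) ` space M \<subseteq> (\<lambda>(r, v). r # v) ` (?R \<times> ?V)"
      using T_space by auto
    show "\<forall>w\<in>(\<lambda>(r, v). r # v) ` (?R \<times> ?V) - itinerary T X (Suc n) ` space M.
        eta (prob (itinerary T X (Suc n) -` {w} \<inter> space M)) = 0"
    proof
      fix w assume "w \<in> (\<lambda>(r, v). r # v) ` (?R \<times> ?V) - itinerary T X (Suc n) ` space M"
      then have "itinerary T X (Suc n) -` {w} \<inter> space M = {}"
        by (auto simp: image_iff simp del: itinerary.simps)
      then show "eta (prob (itinerary T X (Suc n) -` {w} \<inter> space M)) = 0"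
        by (simp only: measure_empty eta_0)
    qed
  qed
  also have "\<dots> = (\<Sum>(r, v)\<in>?R \<times> ?V. eta (?m r v))"
    by (subst sum.reindex) (auto simp: inj_on_def lev[unfolded itinerary.simps] intro!: sum.cong)
  also have "\<dots> = (\<Sum>v\<in>?V. \<Sum>r\<in>?R. eta (?m r v))"
    by (subst sum.cartesian_product[symmetric]) (rule sum.swap)
  also have "\<dots> = (\<Sum>v\<in>?V. eta (?p v) + (\<Sum>r\<in>?R. eta (?m r v / ?p v) * ?p v))"
  proof (rule sum.cong[OF refl])
    fix v assume "v \<in> ?V"
    have msum: "(\<Sum>r\<in>?R. ?m r v) = ?p v"
    proof -
      have "(\<Sum>r\<in>?R. ?m r v) = prob (\<Union>r\<in>?R. X -` {r} \<inter> (T -` (?Y -` {v} \<inter> space M) \<inter> space M))"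
      proof (rule finite_measure_finite_Union[symmetric, OF finR])
        have "X -` {r} \<inter> (T -` (?Y -` {v} \<inter> space M) \<inter> space M) \<in> sets M" for r
          using sets.Int[OF Xs measurable_sets[OF T_measurable Ys]] by (simp add: Int_ac)
        then show "(\<lambda>r. X -` {r} \<inter> (T -` (?Y -` {v} \<inter> space M) \<inter> space M)) ` ?R \<subseteq> sets M" by auto
        show "disjoint_family_on (\<lambda>r. X -` {r} \<inter> (T -` (?Y -` {v} \<inter> space M) \<inter> space M)) ?R"
          by (auto simp: disjoint_family_on_def)
      qed
      also have "(\<Union>r\<in>?R. X -` {r} \<inter> (T -` (?Y -` {v} \<inter> space M) \<inter> space M)) = T -` (?Y -` {v} \<inter> space M) \<inter> space M"
        by auto
      finally show ?thesis using prob_vimage[OF Ys] by simp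
    qed
    show "(\<Sum>r\<in>?R. eta (?m r v)) = eta (?p v) + (\<Sum>r\<in>?R. eta (?m r v / ?p v) * ?p v)"
    proof (cases "?p v = 0")
      case True
      then have "?m r v = 0" if "r \<in> ?R" for r
        using msum member_le_sum[of r ?R "\<lambda>r. ?m r v"] that finR measure_nonneg
        by (intro antisym) auto
      then show ?thesis using True by simp
    next
      case False
      then have p: "?p v > 0" by (simp add: zero_less_measure_iff)
      \<comment> \<open>splits off the entropy of the cell \<open>v\<close>; the last terms add up to \<open>eta (?p v)\<close>\<close>
      have "eta (?m r v) = eta (?m r v / ?p v) * ?p v - ?m r v * ln (?p v)" for r
      proof (cases "?m r v = 0")
        case False
        then have "?m r v > 0" by (simp add: zero_less_measure_iff)
        then show ?thesis using p by (simp add: eta_def ln_div field_simps)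
      qed simp
      then have "(\<Sum>r\<in>?R. eta (?m r v))
          = (\<Sum>r\<in>?R. eta (?m r v / ?p v) * ?p v) - (\<Sum>r\<in>?R. ?m r v) * ln (?p v)"
        by (simp add: sum_subtractf sum_distrib_right)
      then show ?thesis using msum by (simp add: eta_def)
    qed
  qed
  also have "\<dots> = level_entropy M ?Y + (\<Sum>v\<in>?V. \<Sum>r\<in>?R. eta (?m r v / ?p v) * ?p v)"
    by (simp add: sum.distrib level_entropy_def)
  also have "(\<Sum>v\<in>?V. \<Sum>r\<in>?R. eta (?m r v / ?p v) * ?p v) = (\<Sum>r\<in>?R. \<Sum>v\<in>?V. eta (?m r v / ?p v) * ?p v)"
    by (rule sum.swap)
  also have "\<dots> = (\<Sum>r\<in>?R. LINT y|M. eta (cell_avg M ?Y (g r) y))"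
  proof (rule sum.cong[OF refl])
    fix r assume r: "r \<in> ?R"
    have "(LINT y|M. eta (cell_avg M ?Y (g r) y)) =
        (\<Sum>v\<in>?V. eta ((LINT y|M. indicator (?Y -` {v} \<inter> space M) y * g r y) / ?p v) * ?p v)"
      unfolding cell_avg_def
      by (rule integral_simple_compose(2)[OF Y, of
          "\<lambda>v. eta ((LINT y|M. indicator (?Y -` {v} \<inter> space M) y * g r y) / ?p v)"])
    then show "(\<Sum>v\<in>?V. eta (?m r v / ?p v) * ?p v) = (LINT y|M. eta (cell_avg M ?Y (g r) y))"
      using cond[OF r Ys] by simp
  qed
  finally show ?thesis by simp
qed

text \<open>The conditional probabilities given \<open>n\<close> future labels converge in \<open>L\<^sup>1\<close> to those given the whole
  future, hence the entropy increments converge, and so do their averages.\<close>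

theorem entropy_rate:
  assumes g: "\<And>r. r \<in> X ` space M \<Longrightarrow> g r \<in> borel_measurable M"
    "\<And>r y. r \<in> X ` space M \<Longrightarrow> y \<in> space M \<Longrightarrow> 0 \<le> g r y"
    "\<And>r y. r \<in> X ` space M \<Longrightarrow> y \<in> space M \<Longrightarrow> g r y \<le> 1"
    and cond: "\<And>r B. r \<in> X ` space M \<Longrightarrow> B \<in> sets M \<Longrightarrow>
      prob (X -` {r} \<inter> (T -` B \<inter> space M)) = (LINT y|M. indicator B y * g r y)"
  shows "(\<lambda>n. level_entropy M (itinerary T X n) / real n) \<longlonglongrightarrow> (\<Sum>r\<in>X ` space M. LINT y|M. eta (g r y))"
proof (rule cesaro_increments)
  show "(\<lambda>n. level_entropy M (itinerary T X (Suc n)) - level_entropy M (itinerary T X n))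
      \<longlonglongrightarrow> (\<Sum>r\<in>X ` space M. LINT y|M. eta (g r y))"
  proof -
    have "level_entropy M (itinerary T X (Suc n)) - level_entropy M (itinerary T X n)
        = (\<Sum>r\<in>X ` space M. LINT y|M. eta (cell_avg M (itinerary T X n) (g r) y))" for n
      using g(1) cond by (rule level_entropy_increment)
    moreover have "(\<lambda>n. \<Sum>r\<in>X ` space M. LINT y|M. eta (cell_avg M (itinerary T X n) (g r) y))
        \<longlonglongrightarrow> (\<Sum>r\<in>X ` space M. LINT y|M. eta (g r y))"
      by (intro tendsto_sum eta_cell_avg_converges g)
    ultimately show ?thesis by (simp only:)
  qed
qed

end

section \<open>Expansion and distortion\<close>

text \<open>The second assumption is \<open>\<alpha> \<le> sqrt N - 1\<close> in polynomial form; it says that \<open>|T'| = N / x\<^sup>2 \<ge> 1\<close> on \<open>I\<close>.\<close>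

locale nexp =
  fixes N :: nat and \<alpha> :: real
  assumes alpha_pos: "0 < \<alpha>" and alpha_le: "(\<alpha> + 1)\<^sup>2 \<le> real N"
begin

abbreviation "I \<equiv> I_alpha \<alpha>"
abbreviation "T \<equiv> T_alpha N \<alpha>"
abbreviation "dig \<equiv> digit N \<alpha>"

text \<open>\<open>T\<^sup>2\<close> expands by a factor of at least \<open>1 / \<theta>\<^sup>2\<close>: one step alone may have derivative \<open>- 1\<close> at \<open>\<alpha> + 1 = sqrt N\<close>, but
  the product \<open>x T x\<close> never exceeds \<open>\<theta> N\<close>.\<close>

definition "\<theta> = (real N - \<alpha>) / real N"

lemma N_gt: "real N > \<alpha>" "real N > 1"
proof -
  have "(\<alpha> + 1)\<^sup>2 = \<alpha>\<^sup>2 + 2 * \<alpha> + 1" by (simp add: power2_eq_square algebra_simps)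
  then show "real N > \<alpha>" "real N > 1" using alpha_le alpha_pos zero_le_power2[of \<alpha>] by linarith+
qed

lemma theta: "0 < \<theta>" "\<theta> < 1"
  using N_gt alpha_pos by (auto simp: \<theta>_def field_simps)

lemma I_iff: "x \<in> I \<longleftrightarrow> \<alpha> \<le> x \<and> x \<le> \<alpha> + 1"
  by (auto simp: I_alpha_def)

lemma I_pos: "x \<in> I \<Longrightarrow> 0 < x"
  using alpha_pos by (auto simp: I_iff)

lemma mult_le_N:
  assumes "x \<in> I" "y \<in> I"
  shows "x * y \<le> real N"
proof -
  have "x * y \<le> (\<alpha> + 1) * (\<alpha> + 1)"
    using assms alpha_pos by (intro mult_mono) (auto simp: I_iff)
  then show ?thesis using alpha_le by (simp add: power2_eq_square)
qed

lemma N_div_ge: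
  assumes "x \<in> I"
  shows "real N / x \<ge> \<alpha> + 1"
  using mult_le_N[of "\<alpha> + 1" x] assms I_pos[OF assms] alpha_pos by (simp add: I_iff field_simps)

lemma dig_regular: "x > \<alpha> \<Longrightarrow> dig x = \<lfloor>real N / x - \<alpha>\<rfloor>"
  by (simp add: digit_def)

lemma T_in_I:
  assumes "x \<in> I"
  shows "T x \<in> I"
proof (cases "x = \<alpha> \<and> real N / \<alpha> - \<alpha> \<in> \<int>")
  case True
  then have "of_int \<lfloor>real N / \<alpha> - \<alpha>\<rfloor> = real N / \<alpha> - \<alpha>" by (auto elim: Ints_cases)
  then show ?thesis using True by (auto simp: T_alpha_def digit_def I_iff)
next
  case False
  then show ?thesis
    unfolding T_alpha_def digit_def I_iff if_not_P[OF False]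
    using of_int_floor_le[of "real N / x - \<alpha>"] real_of_int_floor_add_one_gt[of "real N / x - \<alpha>"]
    by (intro conjI; linarith)
qed

lemma funpow_T_in_I: "x \<in> I \<Longrightarrow> (T ^^ n) x \<in> I"
  by (induction n) (auto intro: T_in_I)

lemma dig_ge_1:
  assumes "x \<in> I"
  shows "dig x \<ge> 1"
proof (cases "x = \<alpha> \<and> real N / \<alpha> - \<alpha> \<in> \<int>")
  case True
  have "(\<alpha> + 1)\<^sup>2 / \<alpha> \<le> real N / \<alpha>" using alpha_le alpha_pos by (simp add: divide_right_mono)
  moreover have "(\<alpha> + 1)\<^sup>2 / \<alpha> = \<alpha> + 2 + 1 / \<alpha>"
    using alpha_pos by (simp add: power2_eq_square field_simps)
  ultimately have "real N / \<alpha> - \<alpha> \<ge> 2 + 1 / \<alpha>" by linarith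
  moreover have "1 / \<alpha> > 0" using alpha_pos by simp
  ultimately have "2 \<le> real N / \<alpha> - \<alpha>" by linarith
  then have "2 \<le> \<lfloor>real N / \<alpha> - \<alpha>\<rfloor>" by (subst le_floor_iff) auto
  then show ?thesis using True by (auto simp: digit_def)
next
  case False
  then show ?thesis
    unfolding digit_def if_not_P[OF False] le_floor_iff using N_div_ge[OF assms] by auto
qed

lemma dig_le:
  assumes "x \<in> I"
  shows "dig x \<le> \<lfloor>real N / \<alpha>\<rfloor>"
proof -
  have "dig x \<le> \<lfloor>real N / x - \<alpha>\<rfloor>" by (auto simp: digit_def)
  also have "\<dots> \<le> \<lfloor>real N / \<alpha>\<rfloor>"
  proof (rule floor_mono)
    have "real N / x \<le> real N / \<alpha>"
      using assms alpha_pos by (intro divide_left_mono) (auto simp: I_iff)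
    then show "real N / x - \<alpha> \<le> real N / \<alpha>" using alpha_pos by simp
  qed
  finally show ?thesis .
qed

lemma finite_digits: "finite (dig ` I)"
  by (rule finite_subset[of _ "{1..\<lfloor>real N / \<alpha>\<rfloor>}"]) (auto intro: dig_ge_1 dig_le)

lemma T_eq: "T x = real N / x - of_int (dig x)"
  by (simp add: T_alpha_def)

lemma mult_T:
  assumes "x \<in> I"
  shows "x * T x = real N - of_int (dig x) * x"
  using I_pos[OF assms] by (simp add: T_eq algebra_simps)

lemma mult_T_le:
  assumes "x \<in> I"
  shows "x * T x \<le> \<theta> * real N"
proof -
  have "1 * x \<le> of_int (dig x) * x"
    using dig_ge_1[OF assms] I_pos[OF assms] by (intro mult_right_mono) auto
  then have "x * T x \<le> real N - \<alpha>" using mult_T[OF assms] assms by (simp add: I_iff)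
  then show ?thesis using N_gt alpha_pos by (simp add: \<theta>_def)
qed

text \<open>On one cylinder the difference quotient of \<open>T\<close> is exactly \<open>- N / (x y)\<close>, so expansion can be
  iterated without a mean value theorem.\<close>

lemma T_diff:
  assumes "x \<in> I" "y \<in> I" "dig x = dig y"
  shows "T x - T y = real N * (y - x) / (x * y)"
  using I_pos[OF assms(1)] I_pos[OF assms(2)] assms(3) by (simp add: T_eq field_simps)

lemma dist_T:
  assumes "x \<in> I" "y \<in> I" "dig x = dig y"
  shows "\<bar>x - y\<bar> = \<bar>T x - T y\<bar> * (x * y / real N)" "\<bar>T x - T y\<bar> = \<bar>x - y\<bar> * (real N / (x * y))"
  unfolding T_diff[OF assms]
  using I_pos[OF assms(1)] I_pos[OF assms(2)] N_gt by (auto simp: abs_divide abs_mult)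

lemma dist_le_T:
  assumes "x \<in> I" "y \<in> I" "dig x = dig y"
  shows "\<bar>x - y\<bar> \<le> \<bar>T x - T y\<bar>"
proof -
  have "x * y / real N \<le> 1" using mult_le_N[OF assms(1,2)] N_gt by simp
  then show ?thesis
    unfolding dist_T(1)[OF assms] by (metis abs_ge_zero mult.right_neutral mult_left_mono)
qed

lemma I_dist_le: "x \<in> I \<Longrightarrow> y \<in> I \<Longrightarrow> \<bar>x - y\<bar> \<le> 1"
  by (auto simp: I_iff)

text \<open>Two consecutive steps gain a factor \<open>\<theta>\<^sup>2\<close>.  The exponent \<open>n - 1\<close> accounts for an odd step
  that gains nothing; for \<open>n = 0\<close> the truncated subtraction makes the factor \<open>1\<close>.\<close>

lemma cylinder_contract:
  assumes "x \<in> I" "y \<in> I" "itinerary T dig n x = itinerary T dig n y"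
  shows "\<bar>x - y\<bar> \<le> \<theta> ^ (n - 1) * \<bar>(T ^^ n) x - (T ^^ n) y\<bar>"
  using assms
proof (induction n arbitrary: x y rule: less_induct)
  case (less n)
  show ?case
  proof (cases n)
    case 0 then show ?thesis by simp
  next
    case (Suc m)
    have d0: "dig x = dig y" using less.prems Suc by simp
    show ?thesis
    proof (cases m)
      case 0
      then show ?thesis using dist_le_T[OF less.prems(1,2) d0] Suc by simp
    next
      case (Suc l)
      have n: "n = Suc (Suc l)" using \<open>n = Suc m\<close> Suc by simp
      have d1: "dig (T x) = dig (T y)" using less.prems n by simp
      note TI = T_in_I[OF less.prems(1)] T_in_I[OF less.prems(2)]
      have N0: "real N > 0" using N_gt by simp
      have "\<bar>x - y\<bar> = \<bar>T (T x) - T (T y)\<bar> * ((x * T x / real N) * (y * T y / real N))"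
        unfolding dist_T(1)[OF less.prems(1,2) d0] dist_T(1)[OF TI d1] by (simp add: field_simps)
      also have "\<dots> \<le> \<bar>T (T x) - T (T y)\<bar> * (\<theta> * \<theta>)"
        using mult_T_le[OF less.prems(1)] mult_T_le[OF less.prems(2)] theta I_pos less.prems TI N0
        by (intro mult_left_mono mult_mono) (auto simp: field_simps less_imp_le)
      also have "\<dots> \<le> (\<theta> ^ (l - 1) * \<bar>(T ^^ l) (T (T x)) - (T ^^ l) (T (T y))\<bar>) * (\<theta> * \<theta>)"
        using less.prems n theta
        by (intro mult_right_mono less.IH) (auto intro: T_in_I)
      also have "\<dots> = (\<theta> ^ (l - 1) * (\<theta> * \<theta>)) * \<bar>(T ^^ n) x - (T ^^ n) y\<bar>"
        unfolding n by (simp add: funpow_swap1)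
      also have "\<theta> ^ (l - 1) * (\<theta> * \<theta>) \<le> \<theta> ^ (n - 1)"
        unfolding n using theta by (cases l) (auto simp: mult_le_one)
      finally show ?thesis by (simp add: mult_right_mono)
    qed
  qed
qed

lemma cylinder_diam:
  assumes "x \<in> I" "y \<in> I" "itinerary T dig n x = itinerary T dig n y"
  shows "\<bar>x - y\<bar> \<le> \<theta> ^ (n - 1)"
proof -
  have "\<bar>x - y\<bar> \<le> \<theta> ^ (n - 1) * \<bar>(T ^^ n) x - (T ^^ n) y\<bar>" by (rule cylinder_contract[OF assms])
  also have "\<dots> \<le> \<theta> ^ (n - 1) * 1"
    using theta assms by (intro mult_left_mono I_dist_le funpow_T_in_I) auto
  finally show ?thesis by simp
qed

primrec deriv_T :: "nat \<Rightarrow> real \<Rightarrow> real" where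
  "deriv_T 0 x = 1"
| "deriv_T (Suc n) x = real N / x\<^sup>2 * deriv_T n (T x)"

lemma deriv_T_pos: "x \<in> I \<Longrightarrow> 0 < deriv_T n x"
  by (induction n arbitrary: x) (use N_gt in \<open>auto intro!: mult_pos_pos divide_pos_pos dest: I_pos intro: T_in_I\<close>)

text \<open>The sum of the geometric series \<open>(2 / \<alpha>) \<Sum>\<theta>\<^sup>j\<close> of the logarithmic errors along an orbit, exponentiated.\<close>

definition "distortion = exp (2 / (\<alpha> * (1 - \<theta>)))"

lemma distortion_ge_1: "distortion \<ge> 1"
  unfolding distortion_def using alpha_pos theta by simp

lemma ratio_le_exp:
  assumes "x \<in> I" "y \<in> I" "\<bar>x - y\<bar> \<le> \<delta>"
  shows "x \<le> y * exp (\<delta> / \<alpha>)"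
proof -
  have y: "y > 0" "\<alpha> \<le> y" using I_pos[OF assms(2)] assms(2) by (auto simp: I_iff)
  have "x / y = 1 + (x - y) / y" using y by (simp add: field_simps)
  also have "(x - y) / y \<le> \<bar>x - y\<bar> / \<alpha>"
    using y alpha_pos by (intro frac_le) auto
  also have "\<dots> \<le> \<delta> / \<alpha>" using assms(3) alpha_pos by (simp add: divide_right_mono)
  also have "1 + \<delta> / \<alpha> \<le> exp (\<delta> / \<alpha>)" by (rule exp_ge_add_one_self)
  finally show ?thesis using y by (simp add: field_simps)
qed

text \<open>Points with a common itinerary of length \<open>n\<close> are, \<open>j\<close> steps before its end, at distance at most
  \<open>\<theta>\<^sup>j\<^sup>-\<^sup>1\<close>; each step therefore changes the quotient of the derivatives by a factor \<open>exp (2 \<theta>\<^sup>j\<^sup>-\<^sup>1 / \<alpha>)\<close> at most.\<close>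

lemma deriv_distortion:
  assumes "x \<in> I" "y \<in> I" "itinerary T dig n x = itinerary T dig n y"
  shows "deriv_T n y \<le> distortion * deriv_T n x"
proof -
  define c where "c n = 2 / \<alpha> * (\<Sum>j<n. \<theta> ^ j)" for n :: nat
  have "deriv_T n y \<le> exp (c n) * deriv_T n x"
    using assms
  proof (induction n arbitrary: x y)
    case 0
    then show ?case by (simp add: c_def)
  next
    case (Suc n)
    let ?e = "exp (\<theta> ^ n / \<alpha>)"
    note I = Suc.prems(1,2)
    note pos = I_pos[OF I(1)] I_pos[OF I(2)]
    have N0: "real N > 0" using N_gt by simp
    have close: "\<bar>x - y\<bar> \<le> \<theta> ^ n"
      using cylinder_diam[of x y "Suc n"] Suc.prems by auto
    have c: "exp (c (Suc n)) = exp (c n) * (?e * ?e)"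
      by (simp add: c_def exp_add[symmetric] algebra_simps add_divide_distrib)
    have "x * x \<le> (y * ?e) * (y * ?e)"
      using ratio_le_exp[OF I close] pos by (intro mult_mono) auto
    then have "real N / y\<^sup>2 \<le> real N / x\<^sup>2 * (?e * ?e)"
      using pos N0 by (simp add: field_simps power2_eq_square)
    moreover have "deriv_T n (T y) \<le> exp (c n) * deriv_T n (T x)"
      using Suc.IH[of "T x" "T y"] Suc.prems T_in_I by auto
    ultimately have "real N / y\<^sup>2 * deriv_T n (T y) \<le> (real N / x\<^sup>2 * (?e * ?e)) * (exp (c n) * deriv_T n (T x))"
      using deriv_T_pos[OF T_in_I[OF I(2)], of n] N0 pos by (intro mult_mono) auto
    then show ?case unfolding c by (simp add: mult_ac)
  qed
  also have "exp (c n) \<le> distortion"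
  proof -
    have "(\<Sum>j<n. \<theta> ^ j) \<le> 1 / (1 - \<theta>)"
      using theta by (simp add: sum_gp_strict divide_right_mono)
    then have "c n \<le> 2 / \<alpha> * (1 / (1 - \<theta>))"
      unfolding c_def using alpha_pos by (intro mult_left_mono) auto
    then show ?thesis by (simp add: distortion_def)
  qed
  finally show ?thesis
    using deriv_T_pos[OF assms(1), of n] by (simp add: mult_right_mono)
qed

text \<open>The point with \<open>N / x - \<alpha> = k\<close>, the right endpoint of the cylinder of digit \<open>k\<close>; \<open>T\<close> maps it to \<open>\<alpha>\<close>, and
  points slightly to the right of it close to \<open>\<alpha> + 1\<close>.\<close>

definition cut :: "int \<Rightarrow> real" where
  "cut k = real N / (of_int k + \<alpha>)"

definition "cuts = {\<alpha>, \<alpha> + 1} \<union> cut ` {1..\<lfloor>real N / \<alpha>\<rfloor>}"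

lemma finite_cuts: "finite cuts"
  by (simp add: cuts_def)

lemma cut_between_regular:
  assumes "\<alpha> < x" "x < y" "y \<le> \<alpha> + 1" "dig x \<noteq> dig y"
  obtains k where "1 \<le> k" "k \<le> \<lfloor>real N / \<alpha>\<rfloor>" "x \<le> cut k" "cut k < y"
proof -
  have xI: "x \<in> I" "y \<in> I" using assms by (auto simp: I_iff)
  note pos = I_pos[OF xI(1)] I_pos[OF xI(2)]
  have d: "dig x = \<lfloor>real N / x - \<alpha>\<rfloor>" "dig y = \<lfloor>real N / y - \<alpha>\<rfloor>"
    using assms dig_regular by auto
  have "real N / y < real N / x" using assms pos N_gt by (intro divide_strict_left_mono) auto
  then have "dig y \<le> dig x" unfolding d by (intro floor_mono) simp
  then have lt: "dig y < dig x" using assms(4) by simp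
  let ?k = "dig x"
  have k1: "?k \<ge> 1" by (rule dig_ge_1[OF xI(1)])
  then have kp: "0 < of_int ?k + \<alpha>" using alpha_pos by (smt (verit) of_int_pos)
  have "of_int ?k \<le> real N / x - \<alpha>" unfolding d by (rule of_int_floor_le)
  then have "(of_int ?k + \<alpha>) * x \<le> real N" using pos by (simp add: field_simps)
  then have "x \<le> cut ?k" using kp by (simp add: cut_def field_simps)
  moreover have "real N / y - \<alpha> < of_int ?k"
    using lt unfolding d(2) by (simp add: floor_less_iff)
  then have "real N < (of_int ?k + \<alpha>) * y" using pos by (simp add: field_simps)
  then have "cut ?k < y" using kp by (simp add: cut_def field_simps)
  ultimately show ?thesis using that[of ?k] k1 dig_le[OF xI(1)] by auto
qed

lemma cut_between:
  assumes "x \<in> I" "\<bar>z - x\<bar> \<le> r" "z \<notin> I \<or> dig z \<noteq> dig x"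
  shows "\<exists>c\<in>cuts. \<bar>x - c\<bar> \<le> r"
proof (cases "z \<in> I \<and> x \<noteq> \<alpha> \<and> z \<noteq> \<alpha>")
  case False
  then consider "z < \<alpha>" | "z > \<alpha> + 1" | "x = \<alpha>" | "z = \<alpha>" by (auto simp: I_iff)
  then show ?thesis
    by cases (use assms in \<open>auto simp: cuts_def I_iff\<close>)
next
  case True
  then have d: "dig z \<noteq> dig x" and ord: "\<alpha> < x" "\<alpha> < z" "x \<le> \<alpha> + 1" "z \<le> \<alpha> + 1"
    using assms by (auto simp: I_iff)
  show ?thesis
  proof (cases "x < z")
    case True
    then obtain k where "1 \<le> k" "k \<le> \<lfloor>real N / \<alpha>\<rfloor>" "x \<le> cut k" "cut k < z"
      using cut_between_regular[of x z] ord d by metis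
    then show ?thesis using assms(2) by (intro bexI[of _ "cut k"]) (auto simp: cuts_def)
  next
    case False
    then have "z < x" using d by (metis linorder_less_linear)
    then obtain k where "1 \<le> k" "k \<le> \<lfloor>real N / \<alpha>\<rfloor>" "z \<le> cut k" "cut k < x"
      using cut_between_regular[of z x] ord d by metis
    then show ?thesis using assms(2) by (intro bexI[of _ "cut k"]) (auto simp: cuts_def)
  qed
qed

text \<open>If the orbit of \<open>x\<close> keeps a distance from the discontinuities which may shrink geometrically when
  counted backwards from time \<open>n\<close>, then the branch of \<open>T\<^sup>n\<close> at \<open>x\<close> covers a ball of fixed radius: pulling
  the ball back step by step, it shrinks at least as fast as the allowed distance and never meets a
  discontinuity.\<close>

lemma pullback_ball:
  assumes "x \<in> I" "y \<in> I" "\<kappa> > 0"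
    "\<And>j. j < n \<Longrightarrow> \<forall>c\<in>cuts. \<bar>(T ^^ j) x - c\<bar> > \<kappa> * \<theta> ^ (n - j)"
    "\<bar>y - (T ^^ n) x\<bar> \<le> \<kappa> * \<theta>\<^sup>2"
  shows "\<exists>z\<in>I. itinerary T dig n z = itinerary T dig n x \<and> (T ^^ n) z = y"
  using assms
proof (induction n arbitrary: x)
  case 0
  then show ?case by auto
next
  case (Suc n)
  have "\<exists>z\<in>I. itinerary T dig n z = itinerary T dig n (T x) \<and> (T ^^ n) z = y"
  proof (rule Suc.IH)
    show "T x \<in> I" by (rule T_in_I[OF Suc.prems(1)])
    show "\<forall>c\<in>cuts. \<bar>(T ^^ j) (T x) - c\<bar> > \<kappa> * \<theta> ^ (n - j)" if "j < n" for j
      using Suc.prems(4)[of "Suc j"] that by (simp add: funpow_swap1)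
    show "\<bar>y - (T ^^ n) (T x)\<bar> \<le> \<kappa> * \<theta>\<^sup>2" using Suc.prems(5) by (simp add: funpow_swap1)
  qed (use Suc.prems in auto)
  then obtain z1 where z1: "z1 \<in> I" "itinerary T dig n z1 = itinerary T dig n (T x)" "(T ^^ n) z1 = y"
    by auto
  define k where "k = real_of_int (dig x)"
  have k1: "k \<ge> 1" using dig_ge_1[OF Suc.prems(1)] by (simp add: k_def)
  define z where "z = real N / (k + z1)"
  have pos: "x > 0" "z1 > 0" "k + z1 > 0" "z > 0"
    using I_pos Suc.prems z1 k1 N_gt by (auto simp: z_def add_pos_pos)
  have x: "x = real N / (k + T x)" using T_eq[of x] pos N_gt by (simp add: k_def)
  have kT: "k + T x > 0" using k1 I_pos[OF T_in_I[OF Suc.prems(1)]] by simp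
  have "z - x = real N / (k + z1) - real N / (k + T x)" using x by (simp add: z_def)
  also have "\<dots> = (T x - z1) * (real N / (k + T x)) / (k + z1)"
    using pos kT by (simp add: field_simps)
  also have "\<dots> = (T x - z1) * (x / (k + z1))" using x by simp
  finally have "\<bar>z - x\<bar> = \<bar>z1 - T x\<bar> * (x / (k + z1))"
    using pos by (simp add: abs_mult)
  \<comment> \<open>a single backward step does not expand, because \<open>x \<le> \<alpha> + 1 \<le> k + z1\<close>\<close>
  also have "\<dots> \<le> \<bar>z1 - T x\<bar> * 1"
    using pos k1 z1 Suc.prems(1) by (intro mult_left_mono) (auto simp: I_iff)
  also have "\<dots> \<le> \<theta> ^ (n - 1) * \<bar>(T ^^ n) z1 - (T ^^ n) (T x)\<bar>"
    using cylinder_contract[OF z1(1) T_in_I[OF Suc.prems(1)] z1(2)] by simp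
  also have "\<dots> \<le> \<theta> ^ (n - 1) * (\<kappa> * \<theta>\<^sup>2)"
    using Suc.prems(5) theta z1(3) by (intro mult_left_mono) (auto simp: funpow_swap1)
  also have "\<dots> \<le> \<kappa> * \<theta> ^ Suc n"
    using theta Suc.prems(3) by (cases n) (auto simp: power2_eq_square)
  finally have near: "\<bar>z - x\<bar> \<le> \<kappa> * \<theta> ^ Suc n" .
  have zI: "z \<in> I \<and> dig z = dig x"
    using cut_between[OF Suc.prems(1) near] Suc.prems(4)[of 0] by fastforce
  then have "T z = z1" using pos N_gt by (simp add: T_eq z_def k_def)
  then show ?case using zI z1 by (intro bexI[of _ z]) (auto simp: funpow_swap1)
qed

section \<open>Invariant measures given by a density\<close>

lemma dig_measurable [measurable]: "dig \<in> measurable borel (count_space UNIV)"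
  unfolding digit_def[abs_def] by measurable

lemma T_borel [measurable]: "T \<in> borel_measurable borel"
  unfolding T_alpha_def[abs_def] by measurable

lemma I_borel [measurable]: "I \<in> sets borel"
  by (simp add: I_alpha_def)

definition branch :: "int \<Rightarrow> real \<Rightarrow> real" where
  "branch k y = real N / (of_int k + y)"

lemma branch_measurable [measurable]: "branch k \<in> borel_measurable borel"
  unfolding branch_def[abs_def] by measurable

lemma branch_T: "x \<in> I \<Longrightarrow> dig x = k \<Longrightarrow> branch k (T x) = x"
  using I_pos[of x] N_gt by (simp add: branch_def T_eq)

lemma T_branch: "branch k y \<in> I \<Longrightarrow> dig (branch k y) = k \<Longrightarrow> T (branch k y) = y"
  using I_pos[of "branch k y"] N_gt by (simp add: T_eq) (simp add: branch_def)

text \<open>Change of variables \<open>x = N / (k + y)\<close>, \<open>|dx / dy| = x\<^sup>2 / N\<close>, for a set inside one cylinder.  The branch is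
  decreasing, so the substitution rule is applied to \<open>u = - y\<close>.\<close>

lemma nn_integral_branch:
  fixes h :: "real \<Rightarrow> ennreal"
  assumes h [measurable]: "h \<in> borel_measurable borel" and R [measurable]: "R \<in> sets borel"
    and R': "\<And>x. x \<in> R \<Longrightarrow> x \<in> I \<and> dig x = k" and k: "k \<ge> 1"
  shows "(\<integral>\<^sup>+x. h x * indicator R x \<partial>lborel) =
    (\<integral>\<^sup>+y. (h (branch k y) * indicator R (branch k y) * ennreal ((branch k y)\<^sup>2 / real N)) * indicator I y \<partial>lborel)"
proof -
  let ?g = "\<lambda>u. real N / (of_int k - u)" and ?g' = "\<lambda>u. real N / (of_int k - u)\<^sup>2"
  let ?F = "\<lambda>x. h x * indicator R x"
  have k1: "real_of_int k \<ge> 1" using k by simp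
  have "(\<integral>\<^sup>+x. ?F x * indicator {?g (- \<alpha> - 1)..?g (- \<alpha>)} x \<partial>lborel) =
      (\<integral>\<^sup>+u. ?F (?g u) * ?g' u * indicator {- \<alpha> - 1..- \<alpha>} u \<partial>lborel)"
  proof (rule nn_integral_substitution_aux)
    show "(?g has_real_derivative ?g' u) (at u)" if "u \<in> {- \<alpha> - 1..- \<alpha>}" for u
    proof -
      have "of_int k - u > 0" using that alpha_pos k1 by auto
      then show ?thesis
        by (auto intro!: derivative_eq_intros simp: power2_eq_square)
    qed
    show "continuous_on {- \<alpha> - 1..- \<alpha>} ?g'"
      using alpha_pos k1 by (intro continuous_intros) auto
  qed auto
  also have "(\<integral>\<^sup>+x. ?F x * indicator {?g (- \<alpha> - 1)..?g (- \<alpha>)} x \<partial>lborel) = (\<integral>\<^sup>+x. ?F x \<partial>lborel)"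
  proof (rule nn_integral_cong)
    fix x
    have "x \<in> {?g (- \<alpha> - 1)..?g (- \<alpha>)}" if "x \<in> R"
    proof -
      have x: "x \<in> I" "dig x = k" using R'[OF that] by auto
      have Tx: "T x \<in> I" by (rule T_in_I[OF x(1)])
      have "x = real N / (of_int k + T x)" using branch_T[OF x] by (simp add: branch_def)
      moreover have "real N / (of_int k + (\<alpha> + 1)) \<le> real N / (of_int k + T x)"
        using Tx k1 alpha_pos by (intro divide_left_mono mult_pos_pos) (auto simp: I_iff)
      moreover have "real N / (of_int k + T x) \<le> real N / (of_int k + \<alpha>)"
        using Tx k1 alpha_pos by (intro divide_left_mono mult_pos_pos) (auto simp: I_iff)
      ultimately show ?thesis by (auto simp: algebra_simps)
    qed
    then show "?F x * indicator {?g (- \<alpha> - 1)..?g (- \<alpha>)} x = ?F x"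
      by (auto simp: indicator_def)
  qed
  also have "(\<integral>\<^sup>+u. ?F (?g u) * ?g' u * indicator {- \<alpha> - 1..- \<alpha>} u \<partial>lborel) =
      ennreal \<bar>-1\<bar> * (\<integral>\<^sup>+y. ?F (?g (0 + (-1) * y)) * ?g' (0 + (-1) * y) * indicator {- \<alpha> - 1..- \<alpha>} (0 + (-1) * y) \<partial>lborel)"
    by (rule nn_integral_real_affine) auto
  also have "\<dots> = (\<integral>\<^sup>+y. (h (branch k y) * indicator R (branch k y) * ennreal ((branch k y)\<^sup>2 / real N)) * indicator I y \<partial>lborel)"
  proof -
    have "?g' (- y) = (branch k y)\<^sup>2 / real N" for y
      using N_gt by (simp add: branch_def power2_eq_square)
    then show ?thesis
      by (auto intro!: nn_integral_cong simp: branch_def indicator_def I_iff)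
  qed
  finally show ?thesis .
qed

end

text \<open>The last assumption says that \<open>f\<close> is a fixed point of the transfer operator.  Two-sided bounds on
  \<open>f\<close> make \<open>\<mu>\<close> and Lebesgue measure on \<open>I\<close> comparable.\<close>

locale nexp_density = nexp +
  fixes f :: "real \<Rightarrow> real" and lo hi :: real
  assumes f_measurable [measurable]: "f \<in> borel_measurable borel"
    and lo_pos: "0 < lo" and f_lo: "\<And>x. x \<in> I \<Longrightarrow> lo \<le> f x" and f_hi: "\<And>x. x \<in> I \<Longrightarrow> f x \<le> hi"
    and f_mass: "(\<integral>\<^sup>+x. ennreal (f x) * indicator I x \<partial>lborel) = 1"
    and f_transfer: "AE y in lborel. y \<in> I \<longrightarrow>
      (\<Sum>k\<in>dig ` I. if branch k y \<in> I \<and> dig (branch k y) = k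
         then f (branch k y) * (branch k y)\<^sup>2 / real N else 0) = f y"
begin

definition "\<mu> = density (restrict_space lborel I) (\<lambda>x. ennreal (f x))"

lemma sets_mu [measurable_cong]: "sets \<mu> = sets (restrict_space borel I)"
  by (simp add: \<mu>_def sets_restrict_space)

lemma space_mu [simp]: "space \<mu> = I"
  by (simp add: \<mu>_def space_restrict_space)

lemma f_pos: "x \<in> I \<Longrightarrow> 0 < f x"
  using f_lo lo_pos by force

lemma measurable_mu: "h \<in> measurable borel K \<Longrightarrow> h \<in> measurable \<mu> K"
  by (simp add: measurable_cong_sets[OF sets_mu refl] measurable_restrict_space1)

lemma sets_mu_iff: "A \<in> sets \<mu> \<longleftrightarrow> A \<in> sets borel \<and> A \<subseteq> I"
  by (auto simp: sets_mu sets_restrict_space_iff)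

lemma nn_integral_mu:
  assumes [measurable]: "h \<in> borel_measurable borel"
  shows "(\<integral>\<^sup>+x. h x \<partial>\<mu>) = (\<integral>\<^sup>+x. ennreal (f x) * h x * indicator I x \<partial>lborel)"
proof -
  have "(\<integral>\<^sup>+x. h x \<partial>\<mu>) = (\<integral>\<^sup>+x. ennreal (f x) * h x \<partial>restrict_space lborel I)"
    unfolding \<mu>_def by (rule nn_integral_density) (auto intro: measurable_restrict_space1)
  also have "\<dots> = (\<integral>\<^sup>+x. ennreal (f x) * h x * indicator I x \<partial>lborel)"
    by (rule nn_integral_restrict_space) simp
  finally show ?thesis .
qed

lemma emeasure_mu:
  assumes "A \<in> sets \<mu>"
  shows "emeasure \<mu> A = (\<integral>\<^sup>+x. ennreal (f x) * indicator A x \<partial>lborel)"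
proof -
  have [measurable]: "A \<in> sets borel" and "A \<subseteq> I" using assms by (auto simp: sets_mu_iff)
  have "emeasure \<mu> A = (\<integral>\<^sup>+x. indicator A x \<partial>\<mu>)" using assms by simp
  also have "\<dots> = (\<integral>\<^sup>+x. ennreal (f x) * indicator A x * indicator I x \<partial>lborel)"
    by (rule nn_integral_mu) simp
  also have "\<dots> = (\<integral>\<^sup>+x. ennreal (f x) * indicator A x \<partial>lborel)"
    using \<open>A \<subseteq> I\<close> by (intro nn_integral_cong) (auto simp: indicator_def)
  finally show ?thesis .
qed

lemma prob_space_mu: "prob_space \<mu>"
proof
  have "emeasure \<mu> (space \<mu>) = 1"
    using f_mass by (subst emeasure_mu) (auto simp: sets_mu_iff)
  then show "emeasure \<mu> (space \<mu>) = 1" .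
qed

sublocale prob_space \<mu>
  by (rule prob_space_mu)

lemma emeasure_mu_le:
  assumes "A \<in> sets \<mu>"
  shows "emeasure \<mu> A \<le> ennreal hi * emeasure lborel A"
proof -
  have A [measurable]: "A \<in> sets borel" and "A \<subseteq> I" using assms by (auto simp: sets_mu_iff)
  have "emeasure \<mu> A \<le> (\<integral>\<^sup>+x. ennreal hi * indicator A x \<partial>lborel)"
    unfolding emeasure_mu[OF assms] using f_hi \<open>A \<subseteq> I\<close>
    by (intro nn_integral_mono) (auto simp: indicator_def intro!: ennreal_leI)
  also have "\<dots> = ennreal hi * emeasure lborel A"
    by (simp add: nn_integral_cmult_indicator)
  finally show ?thesis .
qed

lemma emeasure_mu_ge:
  assumes "A \<in> sets \<mu>"
  shows "ennreal lo * emeasure lborel A \<le> emeasure \<mu> A"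
proof -
  have A [measurable]: "A \<in> sets borel" and "A \<subseteq> I" using assms by (auto simp: sets_mu_iff)
  have "ennreal lo * emeasure lborel A = (\<integral>\<^sup>+x. ennreal lo * indicator A x \<partial>lborel)"
    by (simp add: nn_integral_cmult_indicator)
  also have "\<dots> \<le> emeasure \<mu> A"
    unfolding emeasure_mu[OF assms] using f_lo \<open>A \<subseteq> I\<close>
    by (intro nn_integral_mono) (auto simp: indicator_def intro!: ennreal_leI)
  finally show ?thesis .
qed

lemma hi_pos: "0 < hi"
  using f_lo[of \<alpha>] f_hi[of \<alpha>] lo_pos by (simp add: I_iff)

lemma emeasure_lborel_I_finite:
  assumes "A \<subseteq> I" "A \<in> sets borel"
  shows "emeasure lborel A < \<infinity>"
proof -
  have "emeasure lborel A \<le> emeasure lborel I" using assms by (intro emeasure_mono) auto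
  also have "\<dots> < \<infinity>" by (simp add: I_alpha_def)
  finally show ?thesis .
qed

lemma prob_le:
  assumes "A \<in> sets \<mu>"
  shows "prob A \<le> hi * measure lborel A"
proof -
  have A: "A \<subseteq> I" "A \<in> sets borel" using assms by (auto simp: sets_mu_iff)
  have "ennreal (prob A) \<le> ennreal (hi * measure lborel A)"
    using emeasure_mu_le[OF assms] emeasure_lborel_I_finite[OF A] hi_pos
    by (simp add: emeasure_eq_measure emeasure_eq_ennreal_measure ennreal_mult less_top)
  then show ?thesis using hi_pos by (simp add: ennreal_le_iff)
qed

lemma prob_ge:
  assumes "A \<in> sets \<mu>"
  shows "lo * measure lborel A \<le> prob A"
proof -
  have A: "A \<subseteq> I" "A \<in> sets borel" using assms by (auto simp: sets_mu_iff)
  have "ennreal (lo * measure lborel A) \<le> ennreal (prob A)"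
    using emeasure_mu_ge[OF assms] emeasure_lborel_I_finite[OF A] lo_pos
    by (simp add: emeasure_eq_measure emeasure_eq_ennreal_measure ennreal_mult less_top)
  then show ?thesis by (simp add: ennreal_le_iff)
qed

text \<open>For \<open>R\<close> inside the cylinder of digit \<open>k\<close>: the conditional probability that \<open>x \<in> R\<close> given \<open>T x = y\<close>.\<close>

definition cond_density :: "int \<Rightarrow> real set \<Rightarrow> real \<Rightarrow> real" where
  "cond_density k R y = indicator R (branch k y) * (f (branch k y) * (branch k y)\<^sup>2 / (real N * f y))"

lemma cond_density_measurable [measurable]:
  "R \<in> sets borel \<Longrightarrow> cond_density k R \<in> borel_measurable borel"
proof -
  assume [measurable]: "R \<in> sets borel"
  note [measurable] = branch_measurable[of k] measurable_compose[OF branch_measurable[of k] f_measurable]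
  show ?thesis unfolding cond_density_def[abs_def] by measurable
qed

lemma cond_density_nonneg:
  assumes "R \<subseteq> I" "y \<in> I"
  shows "0 \<le> cond_density k R y"
proof (cases "branch k y \<in> R")
  case True
  then show ?thesis using f_pos[of "branch k y"] f_pos[OF assms(2)] N_gt assms(1)
    by (auto simp: cond_density_def intro!: divide_nonneg_pos mult_nonneg_nonneg)
qed (simp add: cond_density_def)

lemma nn_integral_cond_density:
  fixes \<phi> :: "real \<Rightarrow> ennreal"
  assumes [measurable]: "\<phi> \<in> borel_measurable borel" and R [measurable]: "R \<in> sets borel"
    and R': "\<And>x. x \<in> R \<Longrightarrow> x \<in> I \<and> dig x = k" and k: "k \<in> dig ` I"
  shows "(\<integral>\<^sup>+x. indicator R x * \<phi> (T x) \<partial>\<mu>) = (\<integral>\<^sup>+y. \<phi> y * ennreal (cond_density k R y) \<partial>\<mu>)"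
proof -
  have k1: "k \<ge> 1" using k dig_ge_1 by auto
  have "(\<integral>\<^sup>+x. indicator R x * \<phi> (T x) \<partial>\<mu>)
      = (\<integral>\<^sup>+x. ennreal (f x) * (indicator R x * \<phi> (T x)) * indicator I x \<partial>lborel)"
    by (rule nn_integral_mu) measurable
  also have "\<dots> = (\<integral>\<^sup>+x. (ennreal (f x) * \<phi> (T x)) * indicator R x \<partial>lborel)"
    using R' by (intro nn_integral_cong) (auto simp: indicator_def)
  also have "\<dots> = (\<integral>\<^sup>+y. (ennreal (f (branch k y)) * \<phi> (T (branch k y))) * indicator R (branch k y)
      * ennreal ((branch k y)\<^sup>2 / real N) * indicator I y \<partial>lborel)"
    by (rule nn_integral_branch[OF _ R R' k1]) measurable
  also have "\<dots> = (\<integral>\<^sup>+y. ennreal (f y) * (\<phi> y * ennreal (cond_density k R y)) * indicator I y \<partial>lborel)"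
  proof (rule nn_integral_cong)
    fix y
    show "(ennreal (f (branch k y)) * \<phi> (T (branch k y))) * indicator R (branch k y)
        * ennreal ((branch k y)\<^sup>2 / real N) * indicator I y
      = ennreal (f y) * (\<phi> y * ennreal (cond_density k R y)) * indicator I y"
    proof (cases "branch k y \<in> R \<and> y \<in> I")
      case True
      then have b: "branch k y \<in> I" "dig (branch k y) = k" "y \<in> I" using R' by auto
      have Tb: "T (branch k y) = y" by (rule T_branch[OF b(1,2)])
      have p: "f y > 0" "f (branch k y) > 0" using f_pos b by auto
      have "ennreal (f y) * ennreal (cond_density k R y) = ennreal (f y * cond_density k R y)"
        using p cond_density_nonneg[of R y k] R' b by (subst ennreal_mult) auto
      also have "f y * cond_density k R y = f (branch k y) * ((branch k y)\<^sup>2 / real N)"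
        using True p N_gt by (simp add: cond_density_def)
      also have "ennreal \<dots> = ennreal (f (branch k y)) * ennreal ((branch k y)\<^sup>2 / real N)"
        using p by (subst ennreal_mult) auto
      finally have e: "ennreal (f y) * ennreal (cond_density k R y)
          = ennreal (f (branch k y)) * ennreal ((branch k y)\<^sup>2 / real N)" .
      have "ennreal (f y) * (\<phi> y * ennreal (cond_density k R y))
          = \<phi> y * (ennreal (f y) * ennreal (cond_density k R y))" by (simp add: mult_ac)
      then show ?thesis using True unfolding e Tb by (simp add: mult_ac)
    next
      case False
      then show ?thesis by (auto simp: cond_density_def)
    qed
  qed
  also have "\<dots> = (\<integral>\<^sup>+y. \<phi> y * ennreal (cond_density k R y) \<partial>\<mu>)"
    by (rule nn_integral_mu[symmetric]) measurable
  finally show ?thesis .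
qed

abbreviation "cyl \<equiv> cylinder N \<alpha>"

lemma cyl_borel [measurable]: "cyl k \<in> sets borel"
  unfolding cylinder_def by measurable

lemma AE_mu: "AE y in lborel. y \<in> I \<longrightarrow> P y \<Longrightarrow> AE y in \<mu>. P y"
  unfolding \<mu>_def
  by (subst AE_density) (auto simp: AE_restrict_space_iff intro: measurable_restrict_space1)

lemma AE_sum_cond_density: "AE y in \<mu>. (\<Sum>k\<in>dig ` I. cond_density k (cyl k) y) = 1"
proof (rule AE_mu)
  show "AE y in lborel. y \<in> I \<longrightarrow> (\<Sum>k\<in>dig ` I. cond_density k (cyl k) y) = 1"
    using f_transfer
  proof eventually_elim
    case (elim y)
    show ?case
    proof
      assume y: "y \<in> I"
      have "(\<Sum>k\<in>dig ` I. cond_density k (cyl k) y) = (\<Sum>k\<in>dig ` I. (if branch k y \<in> I \<and> dig (branch k y) = k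
         then f (branch k y) * (branch k y)\<^sup>2 / real N else 0) / f y)"
        by (intro sum.cong) (auto simp: cond_density_def cylinder_def)
      also have "\<dots> = f y / f y" using elim y by (simp add: sum_divide_distrib[symmetric])
      finally show "(\<Sum>k\<in>dig ` I. cond_density k (cyl k) y) = 1" using f_pos[OF y] by simp
    qed
  qed
qed

lemma T_mu [measurable]: "T \<in> measurable \<mu> \<mu>"
  unfolding measurable_cong_sets[OF sets_mu sets_mu]
  by (rule measurable_restrict_space3) (auto intro: T_in_I)

text \<open>Given \<open>T x = y\<close>, the digit of \<open>x\<close> takes some value: by the fixed point equation the conditional
  probabilities of all digits add up to one, which is invariance.\<close>

lemma emeasure_vimage_T:
  assumes "B \<in> sets \<mu>"
  shows "emeasure \<mu> (T -` B \<inter> I) = emeasure \<mu> B"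
proof -
  have B [measurable]: "B \<in> sets borel" and "B \<subseteq> I" using assms by (auto simp: sets_mu_iff)
  have nn: "cond_density k (cyl k) y \<ge> 0" if "y \<in> I" for k y
    using that by (intro cond_density_nonneg) (auto simp: cylinder_def)
  have "emeasure \<mu> (T -` B \<inter> I) = (\<integral>\<^sup>+x. indicator (T -` B \<inter> I) x \<partial>\<mu>)"
    using measurable_sets[OF T_mu assms] by simp
  also have "\<dots> = (\<integral>\<^sup>+x. (\<Sum>k\<in>dig ` I. indicator (cyl k) x * indicator B (T x)) \<partial>\<mu>)"
  proof (rule nn_integral_cong)
    fix x assume "x \<in> space \<mu>"
    then have x: "x \<in> I" by simp
    have "(\<Sum>k\<in>dig ` I. indicator (cyl k) x * (indicator B (T x) :: ennreal))
        = (\<Sum>k\<in>dig ` I. if k = dig x then indicator B (T x) else 0)"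
      using x by (intro sum.cong) (auto simp: cylinder_def indicator_def)
    also have "\<dots> = indicator B (T x)" using x finite_digits by simp
    finally show "indicator (T -` B \<inter> I) x = (\<Sum>k\<in>dig ` I. indicator (cyl k) x * (indicator B (T x) :: ennreal))"
      using x by (simp add: indicator_def)
  qed
  also have "\<dots> = (\<Sum>k\<in>dig ` I. \<integral>\<^sup>+x. indicator (cyl k) x * indicator B (T x) \<partial>\<mu>)"
    by (rule nn_integral_sum) (auto intro!: measurable_mu)
  also have "\<dots> = (\<Sum>k\<in>dig ` I. \<integral>\<^sup>+y. indicator B y * ennreal (cond_density k (cyl k) y) \<partial>\<mu>)"
    by (intro sum.cong refl nn_integral_cond_density) (auto simp: cylinder_def)
  also have "\<dots> = (\<integral>\<^sup>+y. (\<Sum>k\<in>dig ` I. indicator B y * ennreal (cond_density k (cyl k) y)) \<partial>\<mu>)"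
    by (rule nn_integral_sum[symmetric]) (auto intro!: measurable_mu)
  also have "\<dots> = (\<integral>\<^sup>+y. indicator B y \<partial>\<mu>)"
  proof (rule nn_integral_cong_AE)
    show "AE y in \<mu>. (\<Sum>k\<in>dig ` I. indicator B y * ennreal (cond_density k (cyl k) y)) = indicator B y"
      using AE_sum_cond_density AE_space
    proof eventually_elim
      case (elim y)
      have "(\<Sum>k\<in>dig ` I. ennreal (cond_density k (cyl k) y)) = ennreal (\<Sum>k\<in>dig ` I. cond_density k (cyl k) y)"
        using elim nn by (intro sum_ennreal) auto
      then show ?case using elim by (simp add: sum_distrib_left[symmetric])
    qed
  qed
  also have "\<dots> = emeasure \<mu> B" using assms by simp
  finally show ?thesis .
qed

sublocale measure_preserving_map \<mu> T
proof
  show "distr \<mu> \<mu> T = \<mu>"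
    by (rule measure_eqI) (auto simp: emeasure_distr emeasure_vimage_T)
qed simp

lemma is_acip_mu: "is_acip N \<alpha> \<mu>"
  unfolding is_acip_def
proof (intro conjI)
  show "absolutely_continuous (restrict_space lborel I) \<mu>"
    unfolding \<mu>_def
    by (rule absolutely_continuousI_density) (auto intro: measurable_restrict_space1)
qed (auto simp: sets_mu T_preserves prob_space_mu)

section \<open>Rokhlin's formula\<close>

lemma itinerary_refine:
  assumes X: "\<And>x y. x \<in> I \<Longrightarrow> y \<in> I \<Longrightarrow> X x = X y \<Longrightarrow> dig x = dig y"
    and "x \<in> I" "y \<in> I" "itinerary T X n x = itinerary T X n y"
  shows "itinerary T dig n x = itinerary T dig n y"
  using assms(2-) by (induction n arbitrary: x y) (auto intro: X T_in_I)

text \<open>The sets that can be approximated by unions of cells form a \<sigma>-algebra.  A half-line belongs to it,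
  because the cells meeting it leave it by at most the diameter of a cell.\<close>

lemma generates_approx:
  assumes X: "simple_function \<mu> X"
    and ref: "\<And>x y. x \<in> I \<Longrightarrow> y \<in> I \<Longrightarrow> X x = X y \<Longrightarrow> dig x = dig y"
    and A: "A \<in> sigma_sets UNIV (range (atMost :: real \<Rightarrow> real set))" and "\<epsilon> > 0"
  shows "\<exists>n0. \<forall>n\<ge>n0. \<exists>W. prob (sym_diff (A \<inter> I) (itinerary T X n -` W \<inter> I)) < \<epsilon>"
  using A \<open>\<epsilon> > 0\<close>
proof (induction A arbitrary: \<epsilon> rule: sigma_sets.induct)
  case (Basic a)
  then obtain t where a: "a = {..t}" by auto
  have "(\<lambda>n. hi * \<theta> ^ n) \<longlonglongrightarrow> hi * 0"
    using theta by (intro tendsto_intros LIMSEQ_realpow_zero) auto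
  then have "(\<lambda>n. hi * \<theta> ^ n) \<longlonglongrightarrow> 0" by simp
  then have "eventually (\<lambda>n. hi * \<theta> ^ n < \<epsilon>) sequentially"
    by (rule order_tendstoD(2)) (use Basic in simp)
  then obtain n0 where n0: "\<And>n. n \<ge> n0 \<Longrightarrow> hi * \<theta> ^ n < \<epsilon>"
    by (auto simp: eventually_sequentially)
  show ?case
  proof (rule exI, intro allI impI)
    fix n assume n: "n \<ge> Suc n0"
    let ?W = "itinerary T X n ` (a \<inter> I)"
    let ?S = "{t..t + \<theta> ^ (n - 1)} \<inter> I"
    have sub: "sym_diff (a \<inter> I) (itinerary T X n -` ?W \<inter> I) \<subseteq> ?S"
    proof
      fix x assume "x \<in> sym_diff (a \<inter> I) (itinerary T X n -` ?W \<inter> I)"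
      then obtain y where xy: "x \<in> I" "x > t" "y \<in> I" "y \<le> t" "itinerary T X n x = itinerary T X n y"
        by (auto simp: a)
      have "\<bar>x - y\<bar> \<le> \<theta> ^ (n - 1)"
        using itinerary_refine[OF ref] xy by (intro cylinder_diam) auto
      then show "x \<in> ?S" using xy by auto
    qed
    have S: "?S \<in> sets \<mu>" by (auto simp: sets_mu_iff)
    have "prob (sym_diff (a \<inter> I) (itinerary T X n -` ?W \<inter> I)) \<le> prob ?S"
      using S by (intro finite_measure_mono[OF sub]) auto
    also have "\<dots> \<le> hi * measure lborel ?S" by (rule prob_le[OF S])
    also have "\<dots> \<le> hi * measure lborel {t..t + \<theta> ^ (n - 1)}"
      using hi_pos theta by (intro mult_left_mono measure_mono_fmeasurable)
        (auto simp: fmeasurable_def)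
    also have "\<dots> = hi * \<theta> ^ (n - 1)" using theta by simp
    also have "\<dots> < \<epsilon>" using n by (intro n0) auto
    finally have "prob (sym_diff (a \<inter> I) (itinerary T X n -` ?W \<inter> I)) < \<epsilon>" .
    then show "\<exists>W. prob (sym_diff (a \<inter> I) (itinerary T X n -` W \<inter> I)) < \<epsilon>" ..
  qed
next
  case Empty
  show ?case
    using Empty by (intro exI[of _ 0] allI impI exI[of _ "{}"]) simp
next
  case (Compl a)
  obtain n0 where n0: "\<And>n. n \<ge> n0 \<Longrightarrow>
      \<exists>W. prob (sym_diff (a \<inter> I) (itinerary T X n -` W \<inter> I)) < \<epsilon>"
    using Compl.IH Compl.prems by blast
  show ?case
  proof (rule exI, intro allI impI)
    fix n assume "n \<ge> n0"
    then obtain W where W: "prob (sym_diff (a \<inter> I) (itinerary T X n -` W \<inter> I)) < \<epsilon>"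
      using n0 by blast
    have "sym_diff ((UNIV - a) \<inter> I) (itinerary T X n -` (- W) \<inter> I) = sym_diff (a \<inter> I) (itinerary T X n -` W \<inter> I)"
      by auto
    then show "\<exists>W. prob (sym_diff ((UNIV - a) \<inter> I) (itinerary T X n -` W \<inter> I)) < \<epsilon>"
      using W by metis
  qed
next
  case (Union a)
  have a_borel: "a i \<in> sets borel" for i
    using Union.hyps[of i] by (simp add: borel_eq_atMost)
  define B where "B k = (\<Union>i. a i) \<inter> I - (\<Union>i<k. a i)" for k :: nat
  have Bs: "B k \<in> sets \<mu>" for k using a_borel by (auto simp: B_def sets_mu_iff)
  have "(\<lambda>k. prob (B k)) \<longlonglongrightarrow> prob (\<Inter>k. B k)"
    using Bs by (intro finite_Lim_measure_decseq) (auto simp: decseq_def B_def)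
  also have "(\<Inter>k. B k) = {}" by (auto simp: B_def)
  finally have "(\<lambda>k. prob (B k)) \<longlonglongrightarrow> 0" by simp
  then have "eventually (\<lambda>k. prob (B k) < \<epsilon> / 2) sequentially"
    by (rule order_tendstoD(2)) (use Union.prems in simp)
  then obtain k where k: "prob (B k) < \<epsilon> / 2" by (auto simp: eventually_sequentially)
  have "\<forall>i. \<exists>n0. \<forall>n\<ge>n0. \<exists>W. prob (sym_diff (a i \<inter> I) (itinerary T X n -` W \<inter> I)) < \<epsilon> / (2 * (real k + 1))"
    using Union.IH Union.prems by simp
  then obtain m where m: "\<And>i n. n \<ge> m i \<Longrightarrow>
      \<exists>W. prob (sym_diff (a i \<inter> I) (itinerary T X n -` W \<inter> I)) < \<epsilon> / (2 * (real k + 1))"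
    by metis
  show ?case
  proof (rule exI, intro allI impI)
    fix n assume n: "n \<ge> Max (m ` {..k})"
    have "\<forall>i. \<exists>W. i < k \<longrightarrow> prob (sym_diff (a i \<inter> I) (itinerary T X n -` W \<inter> I)) < \<epsilon> / (2 * (real k + 1))"
    proof
      fix i
      show "\<exists>W. i < k \<longrightarrow> prob (sym_diff (a i \<inter> I) (itinerary T X n -` W \<inter> I)) < \<epsilon> / (2 * (real k + 1))"
      proof (cases "i < k")
        case True
        then have "m i \<le> n" using n by (intro order_trans[OF Max_ge n]) auto
        then show ?thesis using m by blast
      qed simp
    qed
    then obtain W where W: "\<And>i. i < k \<Longrightarrow>
        prob (sym_diff (a i \<inter> I) (itinerary T X n -` W i \<inter> I)) < \<epsilon> / (2 * (real k + 1))"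
      by metis
    let ?D = "\<lambda>i. sym_diff (a i \<inter> I) (itinerary T X n -` W i \<inter> I)"
    let ?W = "\<Union>i<k. W i"
    have "itinerary T X n -` V \<inter> I \<in> sets \<mu>" for V
      using simple_levels_sets[OF simple_itinerary[OF X], of n V] by simp
    then have Ds: "?D i \<in> sets \<mu>" for i using a_borel by (auto simp: sets_mu_iff)
    have "sym_diff ((\<Union>i. a i) \<inter> I) (itinerary T X n -` ?W \<inter> I) \<subseteq> B k \<union> (\<Union>i<k. ?D i)"
      unfolding B_def by blast
    moreover have "B k \<union> (\<Union>i<k. ?D i) \<in> sets \<mu>"
      by (rule sets.Un[OF Bs sets.finite_UN[OF finite_lessThan Ds]])
    ultimately have "prob (sym_diff ((\<Union>i. a i) \<inter> I) (itinerary T X n -` ?W \<inter> I)) \<le> prob (B k \<union> (\<Union>i<k. ?D i))"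
      by (rule finite_measure_mono)
    also have "\<dots> \<le> prob (B k) + prob (\<Union>i<k. ?D i)"
      by (rule measure_Un_le[OF Bs sets.finite_UN[OF finite_lessThan Ds]])
    also have "prob (\<Union>i<k. ?D i) \<le> (\<Sum>i<k. prob (?D i))"
      by (rule measure_UNION_le[OF finite_lessThan Ds])
    also have "\<dots> \<le> (\<Sum>i<k. \<epsilon> / (2 * (real k + 1)))"
      using W by (intro sum_mono less_imp_le) auto
    also have "\<dots> = real k * (\<epsilon> / (2 * (real k + 1)))" by simp
    also have "\<dots> \<le> \<epsilon> / 2" using Union.prems by (simp add: field_simps)
    finally have "prob (sym_diff ((\<Union>i. a i) \<inter> I) (itinerary T X n -` ?W \<inter> I)) < \<epsilon>"
      using k by linarith
    then show "\<exists>W. prob (sym_diff (\<Union> (range a) \<inter> I) (itinerary T X n -` W \<inter> I)) < \<epsilon>" ..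
  qed
qed

lemma generator_refinement:
  assumes X: "simple_function \<mu> X"
    and ref: "\<And>x y. x \<in> I \<Longrightarrow> y \<in> I \<Longrightarrow> X x = X y \<Longrightarrow> dig x = dig y"
  shows "generator \<mu> T X"
proof
  fix A and \<epsilon> :: real assume A: "A \<in> sets \<mu>" and \<epsilon>: "\<epsilon> > 0"
  then have AI: "A \<inter> I = A" and "A \<in> sets borel" by (auto simp: sets_mu_iff)
  then have "A \<in> sigma_sets UNIV (range (atMost :: real \<Rightarrow> real set))"
    by (simp add: borel_eq_atMost)
  from generates_approx[OF X ref this \<epsilon>]
  show "\<exists>n0. \<forall>n\<ge>n0. \<exists>W. prob (sym_diff A (itinerary T X n -` W \<inter> space \<mu>)) < \<epsilon>"
    by (simp only: AI space_mu)
qed fact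

lemma cond_density_le_1:
  assumes "k \<in> dig ` I" "R \<subseteq> cyl k"
  shows "AE y in \<mu>. cond_density k R y \<le> 1"
  using AE_sum_cond_density AE_space
proof eventually_elim
  case (elim y)
  have nn: "0 \<le> cond_density j (cyl j) y" for j
    using elim by (intro cond_density_nonneg) (auto simp: cylinder_def)
  have "cond_density k R y \<le> cond_density k (cyl k) y"
    using nn[of k] assms(2) by (auto simp: cond_density_def indicator_def)
  also have "\<dots> \<le> (\<Sum>j\<in>dig ` I. cond_density j (cyl j) y)"
    using assms(1) finite_digits nn by (intro member_le_sum) auto
  finally show ?case using elim by simp
qed

definition "rokhlin_integral = (LINT x|\<mu>. ln (real N / x\<^sup>2))"

lemma integrable_bounded_mu:
  assumes "g \<in> borel_measurable borel" "\<And>x. x \<in> I \<Longrightarrow> \<bar>g x\<bar> \<le> (B::real)"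
  shows "integrable \<mu> g"
  using assms by (intro integrable_const_bound[where B = B] measurable_mu) (auto intro!: AE_I2)

lemma ln_f_bound: "x \<in> I \<Longrightarrow> \<bar>ln (f x)\<bar> \<le> \<bar>ln lo\<bar> + \<bar>ln hi\<bar>"
proof -
  assume x: "x \<in> I"
  have "ln lo \<le> ln (f x)" "ln (f x) \<le> ln hi"
    using f_lo[OF x] f_hi[OF x] f_pos[OF x] lo_pos hi_pos by auto
  then show ?thesis by linarith
qed

lemma integrable_log_derivative: "integrable \<mu> (\<lambda>x. ln (real N / x\<^sup>2))"
proof (rule integrable_bounded_mu)
  fix x assume x: "x \<in> I"
  have "1 \<le> real N / x\<^sup>2" using mult_le_N[OF x x] I_pos[OF x] by (simp add: power2_eq_square field_simps)
  moreover have "real N / x\<^sup>2 \<le> real N / \<alpha>\<^sup>2"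
    using x alpha_pos by (intro divide_left_mono power_mono mult_pos_pos) (auto simp: I_iff)
  ultimately have "0 \<le> ln (real N / x\<^sup>2)" "ln (real N / x\<^sup>2) \<le> ln (real N / \<alpha>\<^sup>2)"
    by auto
  then show "\<bar>ln (real N / x\<^sup>2)\<bar> \<le> ln (real N / \<alpha>\<^sup>2)" by simp
qed measurable

text \<open>Rokhlin's formula for every labelling \<open>X\<close> that determines the digit, not just for the digit
  itself.  The inverse branches make \<open>x\<close> a function of \<open>T x\<close> and the digit, so the information of \<open>X\<close> given
  the future is the same for all such \<open>X\<close>, namely \<open>w = ln (N / x\<^sup>2) + ln f(T x) - ln f(x)\<close>.\<close>

lemma entropy_rate_refinement:
  assumes X: "simple_function \<mu> X"
    and ref: "\<And>x y. x \<in> I \<Longrightarrow> y \<in> I \<Longrightarrow> X x = X y \<Longrightarrow> dig x = dig y"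
  shows "(\<lambda>n. level_entropy \<mu> (itinerary T X n) / real n) \<longlonglongrightarrow> rokhlin_integral"
proof -
  interpret generator \<mu> T X by (rule generator_refinement[OF X ref])
  define R where "R r = X -` {r} \<inter> I" for r
  define k where "k r = dig (SOME x. x \<in> R r)" for r
  have kR: "k r \<in> dig ` I" "R r \<subseteq> cyl (k r)" if "r \<in> X ` I" for r
  proof -
    have "(SOME x. x \<in> R r) \<in> R r" using that by (intro someI_ex[of "\<lambda>x. x \<in> R r"]) (auto simp: R_def)
    then obtain s where s: "s \<in> R r" "k r = dig s" unfolding k_def by blast
    then have sI: "s \<in> I" "X s = r" by (simp_all add: R_def)
    show "k r \<in> dig ` I" using s sI by simp
    show "R r \<subseteq> cyl (k r)"
    proof
      fix x assume "x \<in> R r"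
      then have "x \<in> I" "X x = X s" using sI by (simp_all add: R_def)
      then show "x \<in> cyl (k r)" using ref[of x s] s sI by (simp add: cylinder_def)
    qed
  qed
  have Rs: "R r \<in> sets \<mu>" for r using simple_levels_sets[OF X, of "{r}"] by (simp add: R_def)
  then have Rb [measurable]: "R r \<in> sets borel" for r by (auto simp: sets_mu_iff)
  have RI: "R r \<subseteq> I" for r by (auto simp: R_def)
  have Rk: "x \<in> I \<and> dig x = k r" if "r \<in> X ` I" "x \<in> R r" for r x
    using kR[OF that(1)] that(2) by (auto simp: cylinder_def)
  \<comment> \<open>the truncation by 1 only changes null sets, but makes the bound hold everywhere\<close>
  define g where "g r y = min 1 (cond_density (k r) (R r) y)" for r y
  have gb [measurable]: "g r \<in> borel_measurable borel" for r
  proof -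
    have [measurable]: "cond_density (k r) (R r) \<in> borel_measurable borel"
      by (rule cond_density_measurable) simp
    show ?thesis unfolding g_def[abs_def] by measurable
  qed
  have g0: "0 \<le> g r y" if "y \<in> I" for r y
    using cond_density_nonneg[OF RI that] by (simp add: g_def)
  have g1: "g r y \<le> 1" for r y by (simp add: g_def)
  have g_eq: "AE y in \<mu>. g r y = cond_density (k r) (R r) y" if "r \<in> X ` I" for r
    using cond_density_le_1[OF kR[OF that]] by eventually_elim (simp add: g_def)
  have int_g: "integrable \<mu> (g r)" for r
    using g0 g1 by (intro integrable_bounded_mu[where B = 1]) auto
  have cond: "prob (X -` {r} \<inter> (T -` B \<inter> space \<mu>)) = (LINT y|\<mu>. indicator B y * g r y)"
    if r: "r \<in> X ` I" and B: "B \<in> sets \<mu>" for r B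
  proof -
    have [measurable]: "B \<in> sets borel" using B by (auto simp: sets_mu_iff)
    have S: "X -` {r} \<inter> (T -` B \<inter> space \<mu>) = R r \<inter> (T -` B \<inter> space \<mu>)" by (auto simp: R_def)
    have Ss: "R r \<inter> (T -` B \<inter> space \<mu>) \<in> sets \<mu>"
      using Rs measurable_sets[OF T_mu B] by auto
    have "emeasure \<mu> (R r \<inter> (T -` B \<inter> space \<mu>)) = (\<integral>\<^sup>+x. indicator (R r \<inter> (T -` B \<inter> space \<mu>)) x \<partial>\<mu>)"
      by (rule nn_integral_indicator[symmetric, OF Ss])
    also have "\<dots> = (\<integral>\<^sup>+x. indicator (R r) x * indicator B (T x) \<partial>\<mu>)"
      by (intro nn_integral_cong) (simp add: indicator_def)
    also have "\<dots> = (\<integral>\<^sup>+y. indicator B y * ennreal (cond_density (k r) (R r) y) \<partial>\<mu>)"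
      using Rk[OF r] kR(1)[OF r] by (intro nn_integral_cond_density) auto
    also have "\<dots> = (\<integral>\<^sup>+y. ennreal (indicator B y * g r y) \<partial>\<mu>)"
      using g_eq[OF r] by (intro nn_integral_cong_AE) (auto simp: indicator_def elim!: eventually_mono)
    also have "\<dots> = ennreal (LINT y|\<mu>. indicator B y * g r y)"
      using g0 B int_g by (intro nn_integral_eq_integral integrable_indicator_mult) (auto simp: indicator_def)
    finally have "ennreal (prob (R r \<inter> (T -` B \<inter> space \<mu>))) = ennreal (LINT y|\<mu>. indicator B y * g r y)"
      by (simp add: emeasure_eq_measure)
    moreover have "0 \<le> (LINT y|\<mu>. indicator B y * g r y)"
      using g0 by (intro Bochner_Integration.integral_nonneg) auto
    ultimately show ?thesis unfolding S by simp
  qed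
  have rate: "(\<lambda>n. level_entropy \<mu> (itinerary T X n) / real n) \<longlonglongrightarrow> (\<Sum>r\<in>X ` space \<mu>. LINT y|\<mu>. eta (g r y))"
    using g0 g1 cond by (intro entropy_rate) (auto intro!: measurable_mu)
  define w where "w x = ln (real N / x\<^sup>2) + ln (f (T x)) - ln (f x)" for x
  have fT [measurable]: "(\<lambda>x. f (T x)) \<in> borel_measurable borel"
    by (rule measurable_compose[OF T_borel f_measurable])
  have w_borel [measurable]: "w \<in> borel_measurable borel" unfolding w_def[abs_def] by measurable
  have int_f: "integrable \<mu> (\<lambda>x. ln (f x))"
    using ln_f_bound by (intro integrable_bounded_mu) auto
  have int_fT: "integrable \<mu> (\<lambda>x. ln (f (T x)))"
    using ln_f_bound T_in_I by (intro integrable_bounded_mu) auto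
  have int_w: "integrable \<mu> w"
    unfolding w_def[abs_def] using int_f int_fT integrable_log_derivative by auto
  have "(LINT x|\<mu>. ln (f (T x))) = (LINT x|distr \<mu> \<mu> T. ln (f x))"
    by (rule integral_distr[symmetric]) (auto intro!: measurable_mu)
  then have wh: "(LINT x|\<mu>. w x) = rokhlin_integral"
    unfolding w_def[abs_def] rokhlin_integral_def using int_f int_fT integrable_log_derivative
    by (simp add: T_preserves)
  have lng: "AE x in \<mu>. x \<in> R r \<longrightarrow> - ln (g r (T x)) = w x" if r: "r \<in> X ` I" for r
  proof -
    have "AE y in distr \<mu> \<mu> T. g r y = cond_density (k r) (R r) y"
      using g_eq[OF r] by (simp only: T_preserves)
    then have "AE x in \<mu>. g r (T x) = cond_density (k r) (R r) (T x)"
      by (rule AE_distrD[OF T_mu])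
    then show ?thesis
    proof eventually_elim
      case (elim x)
      show ?case
      proof
        assume xR: "x \<in> R r"
        have x: "x \<in> I" "dig x = k r" using Rk[OF r xR] by auto
        have b: "branch (k r) (T x) = x" by (rule branch_T[OF x])
        have p: "f x > 0" "f (T x) > 0" "x > 0" "real N > 0"
          using f_pos T_in_I I_pos x N_gt by auto
        have "g r (T x) = f x * x\<^sup>2 / (real N * f (T x))"
          unfolding elim by (simp add: cond_density_def b xR)
        then show "- ln (g r (T x)) = w x"
          using p by (simp add: w_def ln_div ln_mult)
      qed
    qed
  qed
  have eta_int: "ennreal (LINT y|\<mu>. eta (g r y)) = (\<integral>\<^sup>+x. indicator (R r) x * ennreal (w x) \<partial>\<mu>)"
    if r: "r \<in> X ` I" for r
  proof -
    have "integrable \<mu> (\<lambda>y. eta (g r y))"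
      using g0 g1 eta_nonneg eta_le_1 by (intro integrable_bounded_mu[where B = 1]) (auto simp: abs_of_nonneg)
    then have "ennreal (LINT y|\<mu>. eta (g r y)) = (\<integral>\<^sup>+y. ennreal (eta (g r y)) \<partial>\<mu>)"
      using g0 g1 by (intro nn_integral_eq_integral[symmetric]) (auto intro!: AE_I2 eta_nonneg)
    also have "\<dots> = (\<integral>\<^sup>+y. ennreal (- ln (g r y)) * ennreal (cond_density (k r) (R r) y) \<partial>\<mu>)"
    proof (rule nn_integral_cong_AE)
      show "AE y in \<mu>. ennreal (eta (g r y)) = ennreal (- ln (g r y)) * ennreal (cond_density (k r) (R r) y)"
        using g_eq[OF r] AE_space
      proof eventually_elim
        case (elim y)
        have "0 \<le> g r y" using elim(2) by (simp add: g0)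
        moreover have "g r y \<le> 1" by (rule g1)
        ultimately have "0 \<le> - ln (g r y)" by (cases "g r y = 0") auto
        then have "ennreal (- ln (g r y)) * ennreal (g r y) = ennreal (- ln (g r y) * g r y)"
          using \<open>0 \<le> g r y\<close> by (subst ennreal_mult) auto
        then show ?case unfolding elim(1)[symmetric] by (simp add: eta_def mult.commute)
      qed
    qed
    also have "\<dots> = (\<integral>\<^sup>+x. indicator (R r) x * ennreal (- ln (g r (T x))) \<partial>\<mu>)"
      using Rk[OF r] kR(1)[OF r]
      by (intro nn_integral_cond_density[symmetric, where \<phi> = "\<lambda>y. ennreal (- ln (g r y))"]) auto
    also have "\<dots> = (\<integral>\<^sup>+x. indicator (R r) x * ennreal (w x) \<partial>\<mu>)"
      using lng[OF r] by (intro nn_integral_cong_AE) (auto simp: indicator_def elim!: eventually_mono)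
    finally show ?thesis .
  qed
  have fin: "finite (X ` I)" using simple_functionD(1)[OF X] by simp
  have AEr: "AE x in \<mu>. \<forall>r\<in>X ` I. x \<in> R r \<longrightarrow> - ln (g r (T x)) = w x"
    using fin lng by (intro AE_finite_allI) auto
  have w0: "AE x in \<mu>. 0 \<le> w x"
    using AEr AE_space
  proof eventually_elim
    case (elim x)
    then have "- ln (g (X x) (T x)) = w x" by (auto simp: R_def)
    moreover have "0 \<le> g (X x) (T x)" "g (X x) (T x) \<le> 1" using g0 g1 elim T_in_I by auto
    then have "0 \<le> - ln (g (X x) (T x))" by (cases "g (X x) (T x) = 0") auto
    ultimately show ?case by simp
  qed
  have nn: "0 \<le> (LINT y|\<mu>. eta (g r y))" for r
    using g0 g1 by (intro Bochner_Integration.integral_nonneg eta_nonneg) auto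
  have "ennreal (\<Sum>r\<in>X ` space \<mu>. LINT y|\<mu>. eta (g r y)) = (\<Sum>r\<in>X ` I. ennreal (LINT y|\<mu>. eta (g r y)))"
    using nn by (subst sum_ennreal) auto
  also have "\<dots> = (\<Sum>r\<in>X ` I. \<integral>\<^sup>+x. indicator (R r) x * ennreal (w x) \<partial>\<mu>)"
    by (intro sum.cong eta_int refl)
  also have "\<dots> = (\<integral>\<^sup>+x. (\<Sum>r\<in>X ` I. indicator (R r) x * ennreal (w x)) \<partial>\<mu>)"
    by (rule nn_integral_sum[symmetric]) (auto intro!: measurable_mu)
  also have "\<dots> = (\<integral>\<^sup>+x. ennreal (w x) \<partial>\<mu>)"
  proof (rule nn_integral_cong)
    fix x assume x: "x \<in> space \<mu>"
    have "(\<Sum>r\<in>X ` I. indicator (R r) x * ennreal (w x)) = (\<Sum>r\<in>X ` I. if r = X x then ennreal (w x) else 0)"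
      using x by (intro sum.cong) (auto simp: R_def indicator_def)
    also have "\<dots> = ennreal (w x)" using fin x by simp
    finally show "(\<Sum>r\<in>X ` I. indicator (R r) x * ennreal (w x)) = ennreal (w x)" .
  qed
  also have "\<dots> = ennreal rokhlin_integral"
    using nn_integral_eq_integral[OF int_w w0] wh by simp
  finally have "(\<Sum>r\<in>X ` space \<mu>. LINT y|\<mu>. eta (g r y)) = rokhlin_integral"
  proof -
    assume e: "ennreal (\<Sum>r\<in>X ` space \<mu>. LINT y|\<mu>. eta (g r y)) = ennreal rokhlin_integral"
    have "0 \<le> rokhlin_integral" unfolding wh[symmetric] using w0 by (rule integral_nonneg_AE)
    moreover have "0 \<le> (\<Sum>r\<in>X ` space \<mu>. LINT y|\<mu>. eta (g r y))" by (intro sum_nonneg nn)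
    ultimately show ?thesis using e by simp
  qed
  then show ?thesis using rate by simp
qed

lemma simple_dig: "simple_function \<mu> dig"
proof -
  have "dig -` {k} \<inter> space \<mu> = cyl k" for k by (auto simp: cylinder_def)
  moreover have "cyl k \<in> sets \<mu>" for k
    unfolding sets_mu_iff using cyl_borel by (simp add: cylinder_def subset_eq)
  ultimately show ?thesis using finite_digits by (simp add: simple_function_def)
qed

text \<open>An arbitrary partition is joined with the digits, which can only increase its entropy rate; the value is
  attained by the digit partition.\<close>

theorem ks_entropy_mu: "ks_entropy \<mu> T = ereal rokhlin_integral"
proof (rule antisym)
  show "ks_entropy \<mu> T \<le> ereal rokhlin_integral"
    unfolding ks_entropy_def
  proof (rule SUP_least)
    fix P assume "P \<in> Collect (finite_meas_partition \<mu>)"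
    then have P: "finite_meas_partition \<mu> P" by simp
    have X: "simple_function \<mu> (\<lambda>x. (dig x, cell_of P x))"
      by (intro simple_function_Pair simple_dig simple_cell_of P)
    have "lim (\<lambda>n. level_entropy \<mu> (itinerary T (cell_of P) n) / real n) \<le> rokhlin_integral"
      by (rule level_entropy_rate_mono[OF X _ simple_cell_of[OF P] entropy_rate_refinement[OF X], where f = snd])
        auto
    then show "ereal (entropy_wrt \<mu> T P) \<le> ereal rokhlin_integral"
      using entropy_wrt_eq_rate[OF P] by simp
  qed
  let ?P = "cyl ` dig ` I"
  have P: "finite_meas_partition \<mu> ?P"
    unfolding finite_meas_partition_def
  proof (intro conjI)
    show "finite ?P" using finite_digits by simp
    show "?P \<subseteq> sets \<mu>" by (auto simp: sets_mu_iff) (auto simp: cylinder_def)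
    show "partition_on (space \<mu>) ?P"
      by (rule partition_onI) (auto simp: cylinder_def disjnt_def)
  qed
  have "entropy_wrt \<mu> T ?P = rokhlin_integral"
    unfolding entropy_wrt_eq_rate[OF P]
  proof (rule limI, rule entropy_rate_refinement[OF simple_cell_of[OF P]])
    fix x y assume xy: "x \<in> I" "y \<in> I" "cell_of ?P x = cell_of ?P y"
    have cell: "cell_of ?P z = cyl (dig z)" if "z \<in> I" for z
    proof (rule cell_of_eq[OF finite_meas_partitionD(3)[OF P]])
      show "cyl (dig z) \<in> ?P" using that by (intro imageI)
      show "z \<in> cyl (dig z)" using that by (simp add: cylinder_def)
    qed
    have "x \<in> cyl (dig x)" using xy(1) by (simp add: cylinder_def)
    then have "x \<in> cyl (dig y)" using xy by (simp only: cell)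
    then show "dig x = dig y" by (simp add: cylinder_def)
  qed
  then have "ereal rokhlin_integral \<le> ereal (entropy_wrt \<mu> T ?P)" by simp
  also have "\<dots> \<le> ks_entropy \<mu> T" unfolding ks_entropy_def using P by (intro SUP_upper) simp
  finally show "ereal rokhlin_integral \<le> ks_entropy \<mu> T" .
qed

end

context nexp
begin

section \<open>Ergodicity and uniqueness of the invariant measure\<close>

primrec branches :: "int list \<Rightarrow> real \<Rightarrow> real" where
  "branches [] y = y"
| "branches (k # w) y = branch k (branches w y)"

lemma branches_measurable [measurable]: "branches w \<in> borel_measurable borel"
proof (induction w)
  case (Cons k w)
  then have "(\<lambda>y. branch k (branches w y)) \<in> borel_measurable borel"
    by (rule measurable_compose[OF _ branch_measurable])
  then show ?case by simp
qed simp

lemma branches_itinerary: "x \<in> I \<Longrightarrow> branches (itinerary T dig n x) ((T ^^ n) x) = x"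
proof (induction n arbitrary: x)
  case (Suc n)
  have "branches (itinerary T dig n (T x)) ((T ^^ n) (T x)) = T x"
    using Suc T_in_I by blast
  then show ?case using Suc.prems branch_T by (simp add: funpow_swap1)
qed simp

lemma deriv_T_measurable [measurable]: "deriv_T n \<in> borel_measurable borel"
proof (induction n)
  case (Suc n)
  note [measurable] = measurable_compose[OF T_borel Suc]
  show ?case by simp
qed simp

text \<open>Change of variables for \<open>T\<^sup>n\<close> on a set inside one cylinder of rank \<open>n\<close>, by iterating the one-step rule.\<close>

lemma nn_integral_branches:
  fixes h :: "real \<Rightarrow> ennreal"
  assumes "h \<in> borel_measurable borel" "R \<in> sets borel"
    "\<And>x. x \<in> R \<Longrightarrow> x \<in> I \<and> itinerary T dig n x = w"
  shows "(\<integral>\<^sup>+x. ennreal (deriv_T n x) * h x * indicator R x \<partial>lborel) =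
    (\<integral>\<^sup>+y. h (branches w y) * indicator R (branches w y) * indicator I y \<partial>lborel)"
  using assms
proof (induction n arbitrary: w h R)
  case 0
  show ?case
  proof (cases "R = {}")
    case False
    then have w: "w = []" using 0(3) by fastforce
    have "R \<subseteq> I" using 0(3) by auto
    then show ?thesis unfolding w by (intro nn_integral_cong) (auto simp: indicator_def)
  qed simp
next
  case (Suc n)
  note [measurable] = Suc.prems(1,2)
  show ?case
  proof (cases "R = {}")
    case True
    then show ?thesis by simp
  next
    case False
    then obtain x0 where "x0 \<in> R" by auto
    then obtain k w' where w: "w = k # w'" and k: "k \<in> dig ` I"
      using Suc.prems(3)[of x0] by auto
    have k1: "k \<ge> 1" using k dig_ge_1 by auto
    have RI: "x \<in> I \<and> dig x = k \<and> itinerary T dig n (T x) = w'" if "x \<in> R" for x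
      using Suc.prems(3)[OF that] w by simp
    have [measurable]: "(\<lambda>x. deriv_T n (T x)) \<in> borel_measurable borel"
      by (rule measurable_compose[OF T_borel deriv_T_measurable])
    have [measurable]: "(\<lambda>y. h (branch k y)) \<in> borel_measurable borel"
      by (rule measurable_compose[OF branch_measurable Suc.prems(1)])
    define R' where "R' = {y \<in> I. branch k y \<in> R}"
    have R'm: "R' \<in> sets borel"
    proof -
      have "R' = I \<inter> (branch k -` R \<inter> space borel)" by (auto simp: R'_def)
      then show ?thesis using measurable_sets[OF branch_measurable Suc.prems(2)] by simp
    qed
    have N0: "real N > 0" using N_gt by simp
    have "(\<integral>\<^sup>+x. ennreal (deriv_T (Suc n) x) * h x * indicator R x \<partial>lborel)
        = (\<integral>\<^sup>+y. (ennreal (deriv_T (Suc n) (branch k y)) * h (branch k y)) * indicator R (branch k y)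
            * ennreal ((branch k y)\<^sup>2 / real N) * indicator I y \<partial>lborel)"
      using RI k1 by (intro nn_integral_branch) (auto simp del: deriv_T.simps)
    also have "\<dots> = (\<integral>\<^sup>+y. ennreal (deriv_T n y) * h (branch k y) * indicator R' y \<partial>lborel)"
    proof (rule nn_integral_cong)
      fix y
      show "(ennreal (deriv_T (Suc n) (branch k y)) * h (branch k y)) * indicator R (branch k y)
            * ennreal ((branch k y)\<^sup>2 / real N) * indicator I y
          = ennreal (deriv_T n y) * h (branch k y) * indicator R' y"
      proof (cases "y \<in> R'")
        case True
        then have y: "y \<in> I" "branch k y \<in> R" by (auto simp: R'_def)
        then have b: "branch k y \<in> I" "dig (branch k y) = k" using RI by auto
        have bp: "branch k y > 0" by (rule I_pos[OF b(1)])
        have "ennreal (deriv_T (Suc n) (branch k y)) * ennreal ((branch k y)\<^sup>2 / real N)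
            = ennreal (deriv_T (Suc n) (branch k y) * ((branch k y)\<^sup>2 / real N))"
          using deriv_T_pos[OF b(1), of "Suc n"] by (subst ennreal_mult) auto
        also have "deriv_T (Suc n) (branch k y) * ((branch k y)\<^sup>2 / real N) = deriv_T n y"
          using bp N0 by (simp add: T_branch[OF b])
        finally have "ennreal (deriv_T (Suc n) (branch k y)) * ennreal ((branch k y)\<^sup>2 / real N) = ennreal (deriv_T n y)" .
        then show ?thesis using True y by (simp add: mult_ac del: deriv_T.simps)
      next
        case False
        then show ?thesis by (auto simp: R'_def indicator_def)
      qed
    qed
    also have "\<dots> = (\<integral>\<^sup>+y. h (branch k (branches w' y)) * indicator R' (branches w' y) * indicator I y \<partial>lborel)"
    proof (rule Suc.IH[where h = "\<lambda>y. h (branch k y)"])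
      show "x \<in> I \<and> itinerary T dig n x = w'" if "x \<in> R'" for x
      proof -
        have x: "x \<in> I" "branch k x \<in> R" using that by (auto simp: R'_def)
        then have "T (branch k x) = x" using RI T_branch by blast
        then show ?thesis using x RI by metis
      qed
    qed (use R'm in measurable)
    also have "\<dots> = (\<integral>\<^sup>+y. h (branches w y) * indicator R (branches w y) * indicator I y \<partial>lborel)"
    proof (rule nn_integral_cong)
      fix y
      have "branches w' y \<in> R' \<longleftrightarrow> branches w y \<in> R"
      proof
        assume "branches w y \<in> R"
        then have b: "branch k (branches w' y) \<in> R" by (simp add: w)
        then have "T (branch k (branches w' y)) = branches w' y" using RI T_branch by blast
        then show "branches w' y \<in> R'" using b RI T_in_I unfolding R'_def by (metis (mono_tags, lifting) mem_Collect_eq)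
      qed (simp add: R'_def w)
      then show "h (branch k (branches w' y)) * indicator R' (branches w' y) * indicator I y
          = h (branches w y) * indicator R (branches w y) * indicator I y"
        by (simp add: w indicator_def)
    qed
    finally show ?thesis .
  qed
qed

lemma emeasure_lborel_I: "emeasure lborel I = 1"
  by (simp add: I_alpha_def)

end

context nexp_density
begin

text \<open>Invariance up to null sets, the form in which it arises for sets defined by Radon-Nikodym derivatives.\<close>

definition "quasi_invariant B \<longleftrightarrow> B \<in> sets \<mu> \<and> prob (sym_diff B (T -` B \<inter> I)) = 0"

lemma lborel_null_iff:
  assumes "A \<in> sets \<mu>"
  shows "prob A = 0 \<longleftrightarrow> emeasure lborel A = 0"
proof -
  have A: "A \<subseteq> I" "A \<in> sets borel" using assms by (auto simp: sets_mu_iff)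
  have e: "emeasure lborel A = ennreal (measure lborel A)"
    using emeasure_lborel_I_finite[OF A] by (simp add: emeasure_eq_ennreal_measure less_top)
  show ?thesis
    using prob_le[OF assms] prob_ge[OF assms] lo_pos hi_pos unfolding e
    by (auto simp: measure_nonneg antisym mult_le_0_iff intro!: antisym[of "prob A" 0])
qed

lemma quasi_invariant_funpow:
  assumes B: "quasi_invariant B"
  shows "prob (sym_diff B ((T ^^ n) -` B \<inter> I)) = 0"
proof (induction n)
  case 0
  have "B \<subseteq> I" using B by (auto simp: quasi_invariant_def sets_mu_iff)
  then have "sym_diff B ((T ^^ 0) -` B \<inter> I) = {}" by auto
  then show ?case by (simp only: measure_empty)
next
  case (Suc n)
  have Bs: "B \<in> sets \<mu>" using B by (simp add: quasi_invariant_def)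
  have s: "(T ^^ m) -` B \<inter> I \<in> sets \<mu>" for m
    using measurable_sets[OF funpow_measurable[of m] Bs] by simp
  have s1: "T -` B \<inter> I \<in> sets \<mu>" using s[of 1] by simp
  let ?S = "sym_diff B ((T ^^ n) -` B \<inter> I)"
  have S: "?S \<in> sets \<mu>" using Bs s by auto
  have TS: "T -` ?S \<inter> I \<in> sets \<mu>" using measurable_sets[OF T_mu S] by simp
  have "sym_diff B ((T ^^ Suc n) -` B \<inter> I) \<subseteq> sym_diff B (T -` B \<inter> I) \<union> (T -` ?S \<inter> I)"
    using T_in_I by (auto simp: funpow_swap1)
  moreover have m: "sym_diff B (T -` B \<inter> I) \<in> sets \<mu>" using Bs s1 by (intro sets.Un sets.Diff)
  ultimately have "prob (sym_diff B ((T ^^ Suc n) -` B \<inter> I)) \<le> prob (sym_diff B (T -` B \<inter> I) \<union> (T -` ?S \<inter> I))"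
    by (intro finite_measure_mono sets.Un[OF m TS])
  also have "\<dots> \<le> prob (sym_diff B (T -` B \<inter> I)) + prob (T -` ?S \<inter> I)"
    by (rule measure_Un_le[OF m TS])
  also have "\<dots> = 0" using B prob_vimage[OF S] Suc by (simp add: quasi_invariant_def)
  finally show ?case using measure_nonneg[of \<mu> "sym_diff B ((T ^^ Suc n) -` B \<inter> I)"] by linarith
qed

definition "near_cut r = {x \<in> I. \<exists>c\<in>cuts. \<bar>x - c\<bar> \<le> r}"

lemma near_cut_sets: "near_cut r \<in> sets \<mu>"
proof -
  have "near_cut r = I \<inter> (\<Union>c\<in>cuts. {c - r..c + r})"
    by (auto simp: near_cut_def abs_le_iff algebra_simps)
  then show ?thesis using finite_cuts by (auto simp: sets_mu_iff intro!: sets.finite_UN)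
qed

lemma prob_near_cut:
  assumes "0 \<le> r"
  shows "prob (near_cut r) \<le> 2 * hi * real (card cuts) * r"
proof -
  have sub: "near_cut r \<subseteq> (\<Union>c\<in>cuts. {c - r..c + r} \<inter> I)"
    by (auto simp: near_cut_def abs_le_iff algebra_simps)
  have s: "{c - r..c + r} \<inter> I \<in> sets \<mu>" for c by (auto simp: sets_mu_iff)
  have "prob (near_cut r) \<le> prob (\<Union>c\<in>cuts. {c - r..c + r} \<inter> I)"
    by (rule finite_measure_mono[OF sub sets.finite_UN[OF finite_cuts s]])
  also have "\<dots> \<le> (\<Sum>c\<in>cuts. prob ({c - r..c + r} \<inter> I))"
    by (rule measure_UNION_le[OF finite_cuts s])
  also have "\<dots> \<le> (\<Sum>c\<in>cuts. hi * (2 * r))"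
  proof (rule sum_mono)
    fix c
    have "prob ({c - r..c + r} \<inter> I) \<le> hi * measure lborel ({c - r..c + r} \<inter> I)"
      by (rule prob_le[OF s])
    also have "measure lborel ({c - r..c + r} \<inter> I) \<le> measure lborel {c - r..c + r}"
      using assms by (intro measure_mono_fmeasurable) (auto simp: fmeasurable_def)
    also have "measure lborel {c - r..c + r} = 2 * r" using assms by simp
    finally show "prob ({c - r..c + r} \<inter> I) \<le> hi * (2 * r)"
      using hi_pos by simp
  qed
  finally show ?thesis by (simp add: mult_ac)
qed

text \<open>By invariance the time at which the orbit is observed does not matter, and the shrinking radii give a
  geometric series: the bound does not depend on \<open>n\<close>.\<close>

lemma prob_orbit_near_cut:
  assumes "0 \<le> \<kappa>"
  shows "prob (\<Union>j<n. (T ^^ j) -` near_cut (\<kappa> * \<theta> ^ (n - j)) \<inter> I) \<le> 2 * hi * real (card cuts) * (\<kappa> / (1 - \<theta>))"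
proof -
  have s: "(T ^^ j) -` near_cut r \<inter> I \<in> sets \<mu>" for j r
    using measurable_sets[OF funpow_measurable[of j] near_cut_sets[of r]] by simp
  have "prob (\<Union>j<n. (T ^^ j) -` near_cut (\<kappa> * \<theta> ^ (n - j)) \<inter> I)
      \<le> (\<Sum>j<n. prob ((T ^^ j) -` near_cut (\<kappa> * \<theta> ^ (n - j)) \<inter> I))"
    by (rule measure_UNION_le[OF finite_lessThan s])
  also have "\<dots> = (\<Sum>j<n. prob (near_cut (\<kappa> * \<theta> ^ (n - j))))"
  proof (rule sum.cong[OF refl])
    fix j
    interpret Tj: measure_preserving_map \<mu> "T ^^ j" by (rule measure_preserving_funpow)
    show "prob ((T ^^ j) -` near_cut (\<kappa> * \<theta> ^ (n - j)) \<inter> I) = prob (near_cut (\<kappa> * \<theta> ^ (n - j)))"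
      using Tj.prob_vimage[OF near_cut_sets] by simp
  qed
  also have "\<dots> \<le> (\<Sum>j<n. 2 * hi * real (card cuts) * (\<kappa> * \<theta> ^ (n - j)))"
    using assms theta by (intro sum_mono prob_near_cut) auto
  also have "\<dots> = 2 * hi * real (card cuts) * (\<kappa> * (\<Sum>j<n. \<theta> ^ (n - j)))"
    by (simp add: sum_distrib_left)
  also have "(\<Sum>j<n. \<theta> ^ (n - j)) \<le> 1 / (1 - \<theta>)"
  proof -
    have "(\<Sum>j<n. \<theta> ^ (n - j)) = (\<Sum>j<n. \<theta> ^ Suc j)"
      by (rule sum.reindex_bij_witness[of _ "\<lambda>j. n - Suc j" "\<lambda>j. n - Suc j"])
        (auto simp: Suc_diff_Suc simp flip: power_Suc)
    also have "\<dots> \<le> (\<Sum>j<n. \<theta> ^ j)"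
      using theta by (intro sum_mono) (auto simp: mult_le_cancel_right1)
    also have "\<dots> \<le> 1 / (1 - \<theta>)"
      using theta by (simp add: sum_gp_strict divide_right_mono)
    finally show ?thesis .
  qed
  finally show ?thesis using assms hi_pos by (simp add: mult_left_mono)
qed

lemma generator_dig: "generator \<mu> T dig"
  by (rule generator_refinement[OF simple_dig])

lemma measure_lborel_null:
  assumes "A \<in> sets \<mu>" "prob A = 0" "C \<in> sets \<mu>" "D \<in> sets \<mu>" "C \<subseteq> D \<union> A"
  shows "emeasure lborel C \<le> emeasure lborel D"
proof -
  have b: "A \<in> sets borel" "C \<in> sets borel" "D \<in> sets borel"
    using assms by (auto simp: sets_mu_iff)
  have "emeasure lborel C \<le> emeasure lborel (D \<union> A)"
    using b assms(5) by (intro emeasure_mono) auto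
  also have "\<dots> \<le> emeasure lborel D + emeasure lborel A"
    using b by (intro emeasure_subadditive) auto
  also have "\<dots> = emeasure lborel D"
    using assms(2) lborel_null_iff[OF assms(1)] by simp
  finally show ?thesis .
qed

text \<open>If the invariant set \<open>B\<close> fills a cylinder of rank \<open>n\<close> up to a proportion \<open>\<eta>\<close>, then it fills the ball covered by
  the image of that cylinder under \<open>T\<^sup>n\<close> up to a comparable proportion, by bounded distortion.\<close>

lemma invariant_dense_ball:
  assumes B: "quasi_invariant B" and x: "x \<in> I" and \<kappa>: "\<kappa> > 0"
    and far: "\<And>j. j < n \<Longrightarrow> (T ^^ j) x \<notin> near_cut (\<kappa> * \<theta> ^ (n - j))"
    and dense: "prob ({z \<in> I. itinerary T dig n z = itinerary T dig n x} - B)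
      \<le> \<eta> * prob {z \<in> I. itinerary T dig n z = itinerary T dig n x}" and "\<eta> \<ge> 0"
  shows "emeasure lborel ((I \<inter> cball ((T ^^ n) x) (\<kappa> * \<theta>\<^sup>2)) - B) \<le> ennreal (distortion\<^sup>2 * (hi / lo) * \<eta>)"
proof -
  define C where "C = {z \<in> I. itinerary T dig n z = itinerary T dig n x}"
  define w where "w = itinerary T dig n x"
  have Bs: "B \<in> sets \<mu>" and BI: "B \<subseteq> I" using B by (auto simp: quasi_invariant_def sets_mu_iff)
  have C: "C \<in> sets \<mu>"
  proof -
    have "C = itinerary T dig n -` {w} \<inter> space \<mu>" by (auto simp: C_def w_def)
    then show ?thesis using simple_levels_sets[OF simple_itinerary[OF simple_dig]] by simp
  qed
  have TB: "(T ^^ n) -` (I - B) \<inter> I \<in> sets \<mu>"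
    using measurable_sets[OF funpow_measurable[of n], of "I - B"] sets.compl_sets[OF Bs] by simp
  define R where "R = C \<inter> ((T ^^ n) -` (I - B) \<inter> I)"
  have R: "R \<in> sets \<mu>" using C TB by (auto simp: R_def)
  have bor: "C \<in> sets borel" "R \<in> sets borel" "B \<in> sets borel" using C R Bs by (auto simp: sets_mu_iff)
  have D: "deriv_T n x > 0" by (rule deriv_T_pos[OF x])
  have K: "distortion > 0" using distortion_ge_1 by linarith
  have lenC: "emeasure lborel C * ennreal (deriv_T n x) \<le> ennreal distortion"
  proof -
    have "emeasure lborel C * ennreal (deriv_T n x) = (\<integral>\<^sup>+z. ennreal (deriv_T n x) * indicator C z \<partial>lborel)"
      using bor by (simp add: nn_integral_cmult_indicator) (simp add: mult.commute)
    also have "\<dots> \<le> (\<integral>\<^sup>+z. ennreal distortion * (ennreal (deriv_T n z) * 1 * indicator C z) \<partial>lborel)"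
    proof (rule nn_integral_mono)
      fix z
      show "ennreal (deriv_T n x) * indicator C z \<le> ennreal distortion * (ennreal (deriv_T n z) * 1 * indicator C z)"
      proof (cases "z \<in> C")
        case True
        then have "deriv_T n x \<le> distortion * deriv_T n z" "z \<in> I"
          using deriv_distortion[of z x n] x by (auto simp: C_def)
        then have "ennreal (deriv_T n x) \<le> ennreal distortion * ennreal (deriv_T n z)"
          using K deriv_T_pos[of z n] by (subst ennreal_mult[symmetric]) (auto intro!: ennreal_leI)
        then show ?thesis using True by simp
      qed simp
    qed
    also have "\<dots> = ennreal distortion * (\<integral>\<^sup>+z. ennreal (deriv_T n z) * 1 * indicator C z \<partial>lborel)"
    proof -
      note [measurable] = bor
      show ?thesis by (intro nn_integral_cmult) measurable
    qed
    also have "(\<integral>\<^sup>+z. ennreal (deriv_T n z) * 1 * indicator C z \<partial>lborel)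
        = (\<integral>\<^sup>+y. 1 * indicator C (branches w y) * indicator I y \<partial>lborel)"
      using bor by (intro nn_integral_branches) (auto simp: C_def w_def)
    also have "\<dots> \<le> (\<integral>\<^sup>+y. indicator I y \<partial>lborel)"
      by (intro nn_integral_mono) (auto simp: indicator_def)
    also have "\<dots> = 1" using emeasure_lborel_I by simp
    finally show ?thesis by (simp add: mult_left_mono)
  qed
  have lenR: "emeasure lborel R \<le> ennreal (\<eta> * (hi / lo)) * emeasure lborel C"
  proof -
    have "emeasure lborel R \<le> emeasure lborel (C - B)"
    proof (rule measure_lborel_null[OF _ quasi_invariant_funpow[OF B, of n] R])
      show "sym_diff B ((T ^^ n) -` B \<inter> I) \<in> sets \<mu>"
        using Bs measurable_sets[OF funpow_measurable[of n] Bs] by (intro sets.Un sets.Diff) auto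
      show "C - B \<in> sets \<mu>" using C Bs by auto
      show "R \<subseteq> (C - B) \<union> sym_diff B ((T ^^ n) -` B \<inter> I)" by (auto simp: R_def)
    qed
    also have "\<dots> \<le> ennreal (\<eta> * (hi / lo)) * emeasure lborel C"
    proof -
      have CB: "C - B \<in> sets \<mu>" using C Bs by auto
      have "lo * measure lborel (C - B) \<le> prob (C - B)" by (rule prob_ge[OF CB])
      also have "\<dots> \<le> \<eta> * prob C" using dense by (simp add: C_def)
      also have "\<dots> \<le> \<eta> * (hi * measure lborel C)"
        using \<open>\<eta> \<ge> 0\<close> by (intro mult_left_mono prob_le C)
      finally have le: "measure lborel (C - B) \<le> \<eta> * (hi / lo) * measure lborel C"
        using lo_pos by (simp add: field_simps)
      have fin: "emeasure lborel (C - B) = ennreal (measure lborel (C - B))"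
        "emeasure lborel C = ennreal (measure lborel C)"
        using emeasure_lborel_I_finite[of "C - B"] emeasure_lborel_I_finite[of C] C CB
        by (auto simp: emeasure_eq_ennreal_measure less_top sets_mu_iff)
      show ?thesis unfolding fin
        using le \<open>\<eta> \<ge> 0\<close> hi_pos lo_pos by (subst ennreal_mult[symmetric]) (auto intro!: ennreal_leI)
    qed
    finally show ?thesis .
  qed
  have "emeasure lborel ((I \<inter> cball ((T ^^ n) x) (\<kappa> * \<theta>\<^sup>2)) - B)
      = (\<integral>\<^sup>+y. indicator ((I \<inter> cball ((T ^^ n) x) (\<kappa> * \<theta>\<^sup>2)) - B) y \<partial>lborel)"
    using bor by (subst nn_integral_indicator) auto
  also have "\<dots> \<le> (\<integral>\<^sup>+y. 1 * indicator R (branches w y) * indicator I y \<partial>lborel)"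
  proof (rule nn_integral_mono)
    fix y
    have "branches w y \<in> R \<and> y \<in> I" if y: "y \<in> (I \<inter> cball ((T ^^ n) x) (\<kappa> * \<theta>\<^sup>2)) - B"
    proof -
      have yI: "y \<in> I" "y \<notin> B" "\<bar>y - (T ^^ n) x\<bar> \<le> \<kappa> * \<theta>\<^sup>2"
        using y by (auto simp: dist_real_def)
      have "\<forall>c\<in>cuts. \<bar>(T ^^ j) x - c\<bar> > \<kappa> * \<theta> ^ (n - j)" if "j < n" for j
        using far[OF that] funpow_T_in_I[OF x, of j] by (auto simp: near_cut_def not_le)
      then obtain z where z: "z \<in> I" "itinerary T dig n z = w" "(T ^^ n) z = y"
        using pullback_ball[OF x yI(1) \<kappa> _ yI(3)] unfolding w_def by blast
      have "branches w y = z" using branches_itinerary[OF z(1), of n] z by simp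
      moreover have "z \<in> R" using z yI by (auto simp: R_def C_def w_def)
      ultimately show ?thesis using yI by simp
    qed
    then show "indicator ((I \<inter> cball ((T ^^ n) x) (\<kappa> * \<theta>\<^sup>2)) - B) y \<le> 1 * indicator R (branches w y) * (indicator I y :: ennreal)"
      by (auto simp: indicator_def)
  qed
  also have "\<dots> = (\<integral>\<^sup>+z. ennreal (deriv_T n z) * 1 * indicator R z \<partial>lborel)"
    using bor by (intro nn_integral_branches[symmetric]) (auto simp: R_def C_def w_def)
  also have "\<dots> \<le> (\<integral>\<^sup>+z. ennreal (distortion * deriv_T n x) * indicator R z \<partial>lborel)"
  proof (rule nn_integral_mono)
    fix z
    show "ennreal (deriv_T n z) * 1 * indicator R z \<le> ennreal (distortion * deriv_T n x) * indicator R z"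
      using deriv_distortion[of x z n] x by (auto simp: R_def C_def indicator_def intro!: ennreal_leI)
  qed
  also have "\<dots> = ennreal (distortion * deriv_T n x) * emeasure lborel R"
    using bor by (simp add: nn_integral_cmult_indicator)
  also have "\<dots> \<le> ennreal (distortion * deriv_T n x) * (ennreal (\<eta> * (hi / lo)) * emeasure lborel C)"
    by (intro mult_left_mono lenR) auto
  also have "\<dots> = ennreal distortion * ennreal (\<eta> * (hi / lo)) * (emeasure lborel C * ennreal (deriv_T n x))"
    using K D by (simp add: ennreal_mult mult_ac)
  also have "\<dots> \<le> ennreal distortion * ennreal (\<eta> * (hi / lo)) * ennreal distortion"
    by (intro mult_left_mono lenC) auto
  also have "\<dots> = ennreal (distortion\<^sup>2 * (hi / lo) * \<eta>)"
    using K \<open>\<eta> \<ge> 0\<close> hi_pos lo_pos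
    by (simp add: ennreal_mult[symmetric] power2_eq_square mult_ac)
  finally show ?thesis .
qed

text \<open>Most points of \<open>B\<close> lie in cylinders almost filled by \<open>B\<close>, because cell averages of the indicator
  function converge; most points have orbits avoiding the discontinuities.  Since the two exceptional sets together
  have smaller measure than \<open>B\<close>, some point of \<open>B\<close> is good in both respects.\<close>

lemma exists_dense_cylinder:
  assumes B: "quasi_invariant B" and Bpos: "prob B > 0" and \<kappa>: "\<kappa> > 0"
    and small: "2 * hi * real (card cuts) * (\<kappa> / (1 - \<theta>)) \<le> prob B / 2" and \<eta>: "\<eta> > 0"
  shows "\<exists>x n. x \<in> I \<and> (\<forall>j<n. (T ^^ j) x \<notin> near_cut (\<kappa> * \<theta> ^ (n - j))) \<and>
    prob ({z \<in> I. itinerary T dig n z = itinerary T dig n x} - B)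
      \<le> \<eta> * prob {z \<in> I. itinerary T dig n z = itinerary T dig n x}"
proof -
  interpret generator \<mu> T dig by (rule generator_dig)
  have Bs: "B \<in> sets \<mu>" and BI: "B \<subseteq> I" using B by (auto simp: quasi_invariant_def sets_mu_iff)
  let ?g = "indicator (I - B) :: real \<Rightarrow> real"
  have IBs: "I - B \<in> sets \<mu>" using sets.compl_sets[OF Bs] by simp
  have g_int: "integrable \<mu> ?g" using IBs by (simp add: emeasure_eq_measure)
  let ?E = "\<lambda>n. cell_avg \<mu> (itinerary T dig n) ?g"
  have "\<eta> * (prob B / 4) > 0" using \<eta> Bpos by simp
  then obtain n where n: "(LINT x|\<mu>. \<bar>?E n x - ?g x\<bar>) < \<eta> * (prob B / 4)"
    using LIMSEQ_D[OF cell_avg_converges[OF g_int], of "\<eta> * (prob B / 4)"] by auto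
  have Y: "simple_function \<mu> (itinerary T dig n)" by (rule simple_itinerary[OF simple_dig])
  have E_int: "integrable \<mu> (?E n)" by (rule cell_avg_integrable[OF Y])
  have diff_int: "integrable \<mu> (\<lambda>x. \<bar>?E n x - ?g x\<bar>)" using E_int g_int by auto
  define F where "F = {x \<in> space \<mu>. \<eta> \<le> \<bar>?E n x - ?g x\<bar>}"
  have Fs: "F \<in> sets \<mu>" unfolding F_def using diff_int by (intro borel_measurable_le) auto
  have "prob F \<le> (LINT x|\<mu>. \<bar>?E n x - ?g x\<bar>) / \<eta>"
    unfolding F_def using \<eta> diff_int by (intro integral_Markov_inequality_measure[where A = "{}"]) auto
  also have "\<dots> < prob B / 4" using n \<eta> by (simp add: field_simps)
  finally have F: "prob F < prob B / 4" .
  define G where "G = (\<Union>j<n. (T ^^ j) -` near_cut (\<kappa> * \<theta> ^ (n - j)) \<inter> I)"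
  have s: "(T ^^ j) -` near_cut r \<inter> I \<in> sets \<mu>" for j r
    using measurable_sets[OF funpow_measurable[of j] near_cut_sets[of r]] by simp
  have Gs: "G \<in> sets \<mu>" unfolding G_def by (rule sets.finite_UN[OF finite_lessThan s])
  have G: "prob G \<le> prob B / 2"
    unfolding G_def using prob_orbit_near_cut[of \<kappa> n] \<kappa> small by linarith
  have "\<exists>x. x \<in> B - (F \<union> G)"
  proof (rule ccontr)
    assume "\<not> ?thesis"
    then have "B \<subseteq> F \<union> G" by auto
    then have "prob B \<le> prob (F \<union> G)" by (rule finite_measure_mono[OF _ sets.Un[OF Fs Gs]])
    also have "\<dots> \<le> prob F + prob G" by (rule measure_Un_le[OF Fs Gs])
    finally show False using F G Bpos by linarith
  qed
  then obtain x where x: "x \<in> B" "x \<notin> F" "x \<notin> G" by auto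
  then have xI: "x \<in> I" using BI by auto
  let ?C = "itinerary T dig n -` {itinerary T dig n x} \<inter> space \<mu>"
  have Ceq: "{z \<in> I. itinerary T dig n z = itinerary T dig n x} = ?C" by auto
  have Cs: "?C \<in> sets \<mu>" by (rule simple_levels_sets[OF Y])
  have "?g x = 0" using x by simp
  then have "?E n x \<le> \<eta>" using x xI by (auto simp: F_def not_le)
  moreover have "(LINT y|\<mu>. indicator ?C y * ?g y) = prob (?C - B)"
  proof -
    have "(LINT y|\<mu>. indicator ?C y * ?g y) = (LINT y|\<mu>. indicator (?C - B) y)"
      by (intro Bochner_Integration.integral_cong) (auto simp: indicator_def)
    also have "\<dots> = prob ((?C - B) \<inter> space \<mu>)" by simp
    also have "(?C - B) \<inter> space \<mu> = ?C - B" by auto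
    finally show ?thesis .
  qed
  ultimately have le: "prob (?C - B) / prob ?C \<le> \<eta>" by (simp add: cell_avg_def)
  have "prob (?C - B) \<le> \<eta> * prob ?C"
  proof (cases "prob ?C = 0")
    case True
    have "prob (?C - B) \<le> prob ?C" using Cs by (intro finite_measure_mono) auto
    then show ?thesis using True by simp
  next
    case False
    then have "prob ?C > 0" by (simp add: zero_less_measure_iff)
    then show ?thesis using le by (simp add: divide_le_eq)
  qed
  moreover have "\<forall>j<n. (T ^^ j) x \<notin> near_cut (\<kappa> * \<theta> ^ (n - j))"
    using x xI by (auto simp: G_def)
  ultimately show ?thesis using xI unfolding Ceq[symmetric] by blast
qed

text \<open>The proportions \<open>\<eta>\<close> tend to zero while the radius of the balls stays fixed; an accumulation point of
  their centres is the middle of an interval that \<open>B\<close> fills up to a null set.\<close>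

lemma quasi_invariant_contains_interval:
  assumes B: "quasi_invariant B" and Bpos: "prob B > 0"
  shows "\<exists>a b. \<alpha> \<le> a \<and> a < b \<and> b \<le> \<alpha> + 1 \<and> emeasure lborel ({a<..<b} - B) = 0"
proof -
  define \<kappa> where "\<kappa> = prob B * (1 - \<theta>) / (4 * hi * (real (card cuts) + 1))"
  have \<kappa>: "\<kappa> > 0" unfolding \<kappa>_def using Bpos theta hi_pos by (intro divide_pos_pos mult_pos_pos) auto
  have "\<kappa> / (1 - \<theta>) = prob B / (4 * hi * (real (card cuts) + 1))"
    unfolding \<kappa>_def using theta by simp
  moreover have "2 * hi * c * (p / (4 * hi * c')) = (p / 2) * (c / c')" if "c' > 0" for c c' p
    using hi_pos that by (simp add: field_simps)
  ultimately have "2 * hi * real (card cuts) * (\<kappa> / (1 - \<theta>)) = (prob B / 2) * (real (card cuts) / (real (card cuts) + 1))"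
    by simp
  also have "\<dots> \<le> prob B / 2 * 1"
    using Bpos by (intro mult_left_mono) auto
  finally have small: "2 * hi * real (card cuts) * (\<kappa> / (1 - \<theta>)) \<le> prob B / 2" by simp
  define \<rho> where "\<rho> = \<kappa> * \<theta>\<^sup>2"
  have \<rho>: "\<rho> > 0" using \<kappa> theta by (simp add: \<rho>_def)
  define K where "K = distortion\<^sup>2 * (hi / lo)"
  have K: "K > 0" using distortion_ge_1 hi_pos lo_pos by (simp add: K_def)
  have Bb: "B \<in> sets borel" using B by (auto simp: quasi_invariant_def sets_mu_iff)
  have "\<exists>y. y \<in> I \<and> emeasure lborel ((I \<inter> cball y \<rho>) - B) \<le> ennreal (1 / (real m + 1))" for m
  proof -
    let ?\<eta> = "1 / (K * (real m + 1))"
    have \<eta>: "?\<eta> > 0" using K by simp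
    obtain x n where x: "x \<in> I" "\<And>j. j < n \<Longrightarrow> (T ^^ j) x \<notin> near_cut (\<kappa> * \<theta> ^ (n - j))"
      "prob ({z \<in> I. itinerary T dig n z = itinerary T dig n x} - B)
      \<le> ?\<eta> * prob {z \<in> I. itinerary T dig n z = itinerary T dig n x}"
      using exists_dense_cylinder[OF B Bpos \<kappa> small \<eta>] by blast
    have "emeasure lborel ((I \<inter> cball ((T ^^ n) x) (\<kappa> * \<theta>\<^sup>2)) - B) \<le> ennreal (distortion\<^sup>2 * (hi / lo) * ?\<eta>)"
      by (rule invariant_dense_ball[OF B x(1) \<kappa> x(2,3)]) (use \<eta> in auto)
    also have "distortion\<^sup>2 * (hi / lo) * ?\<eta> = 1 / (real m + 1)"
      unfolding K_def[symmetric] using K by simp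
    finally show ?thesis using funpow_T_in_I[OF x(1)] by (auto simp: \<rho>_def)
  qed
  then obtain y where y: "\<And>m. y m \<in> I"
    "\<And>m. emeasure lborel ((I \<inter> cball (y m) \<rho>) - B) \<le> ennreal (1 / (real m + 1))"
    by metis
  have "compact I" by (simp add: I_alpha_def)
  then obtain l r where l: "l \<in> I" "strict_mono r" "(y \<circ> r) \<longlonglongrightarrow> l"
    using y(1) unfolding compact_def by metis
  define a where "a = max \<alpha> (l - \<rho> / 2)"
  define b where "b = min (\<alpha> + 1) (l + \<rho> / 2)"
  have ab: "\<alpha> \<le> a" "a < b" "b \<le> \<alpha> + 1" using l(1) \<rho> by (auto simp: a_def b_def I_iff)
  obtain m0 where m0: "\<And>m. m \<ge> m0 \<Longrightarrow> \<bar>y (r m) - l\<bar> < \<rho> / 2"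
    using LIMSEQ_D[OF l(3), of "\<rho> / 2"] \<rho> by auto
  have bound: "emeasure lborel ({a<..<b} - B) \<le> ennreal (1 / (real m + 1))" if m: "m \<ge> m0" for m
  proof -
    have "{a<..<b} \<subseteq> I \<inter> cball (y (r m)) \<rho>"
    proof
      fix z assume z: "z \<in> {a<..<b}"
      then have "l - \<rho> / 2 < z" "z < l + \<rho> / 2" by (simp_all add: a_def b_def)
      then have "\<bar>z - l\<bar> < \<rho> / 2" by linarith
      then have "\<bar>y (r m) - z\<bar> \<le> \<rho>" using m0[OF m] by linarith
      then show "z \<in> I \<inter> cball (y (r m)) \<rho>" using z by (auto simp: a_def b_def I_iff dist_real_def)
    qed
    then have "emeasure lborel ({a<..<b} - B) \<le> emeasure lborel ((I \<inter> cball (y (r m)) \<rho>) - B)"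
      using Bb by (intro emeasure_mono) auto
    also have "\<dots> \<le> ennreal (1 / (real (r m) + 1))" by (rule y(2))
    also have "\<dots> \<le> ennreal (1 / (real m + 1))"
      using seq_suble[OF l(2), of m] by (intro ennreal_leI divide_left_mono) auto
    finally show ?thesis .
  qed
  have "emeasure lborel ({a<..<b} - B) \<le> 0"
  proof (rule LIMSEQ_le_const)
    have "(\<lambda>m. 1 / (real m + 1)) \<longlonglongrightarrow> 0"
      using LIMSEQ_inverse_real_of_nat by (simp add: inverse_eq_divide add.commute)
    then show "(\<lambda>m. ennreal (1 / (real m + 1))) \<longlonglongrightarrow> 0"
      using tendsto_ennrealI by fastforce
    show "\<exists>m0. \<forall>m\<ge>m0. emeasure lborel ({a<..<b} - B) \<le> ennreal (1 / (real m + 1))"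
      using bound by blast
  qed
  then show ?thesis using ab by auto
qed

text \<open>\<open>T\<close> maps intervals inside a cylinder that \<open>B\<close> fills to such intervals.\<close>

lemma quasi_invariant_image_interval:
  assumes B: "quasi_invariant B" and uv: "\<alpha> \<le> u" "u < v" "v \<le> \<alpha> + 1"
    and d: "\<And>x. u < x \<Longrightarrow> x < v \<Longrightarrow> dig x = k"
    and full: "emeasure lborel ({u<..<v} - B) = 0"
  shows "emeasure lborel ({real N / v - of_int k<..<real N / u - of_int k} - B) = 0"
    and "\<alpha> \<le> real N / v - of_int k" "real N / u - of_int k \<le> \<alpha> + 1"
    and "real N / v - of_int k < real N / u - of_int k"
proof -
  have Bs: "B \<in> sets \<mu>" and BI: "B \<subseteq> I" using B by (auto simp: quasi_invariant_def sets_mu_iff)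
  have Bb [measurable]: "B \<in> sets borel" using Bs by (auto simp: sets_mu_iff)
  have pos: "u > 0" "v > 0" "real N > 0" using uv alpha_pos N_gt by auto
  have sub: "{u<..<v} \<subseteq> I" using uv by (auto simp: I_iff)
  have "(u + v) / 2 \<in> I" using uv by (simp add: I_iff)
  then have k: "k \<ge> 1" using dig_ge_1[of "(u + v) / 2"] d[of "(u + v) / 2"] uv by auto
  let ?J = "{real N / v - of_int k<..<real N / u - of_int k}"
  show lt: "real N / v - of_int k < real N / u - of_int k"
    using pos uv by (simp add: divide_strict_left_mono)
  have pre: "branch k y \<in> {u<..<v} \<and> T (branch k y) = y" if y: "y \<in> ?J" for y
  proof -
    have ky: "of_int k + y > real N / v" "of_int k + y < real N / u" using y by auto
    then have kp: "of_int k + y > 0" using pos by (smt (verit) divide_pos_pos)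
    have b: "branch k y \<in> {u<..<v}" using ky kp pos by (auto simp: branch_def field_simps)
    then have "dig (branch k y) = k" using d by auto
    then show ?thesis using b sub T_branch by blast
  qed
  have JI: "?J \<subseteq> I"
  proof
    fix y assume y: "y \<in> ?J"
    have "branch k y \<in> I" using pre[OF y] sub by blast
    then have "T (branch k y) \<in> I" by (rule T_in_I)
    then show "y \<in> I" using pre[OF y] by simp
  qed
  have "closure ?J \<subseteq> I" using JI by (intro closure_minimal) (auto simp: I_alpha_def)
  then have "{real N / v - of_int k..real N / u - of_int k} \<subseteq> I" using lt by simp
  then show "\<alpha> \<le> real N / v - of_int k" "real N / u - of_int k \<le> \<alpha> + 1"
    using lt by (auto simp: I_iff subset_iff)
  let ?R = "{u<..<v} \<inter> (T -` (I - B) \<inter> I)"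
  have TB: "T -` (I - B) \<inter> I \<in> sets \<mu>"
    using measurable_sets[OF T_mu, of "I - B"] sets.compl_sets[OF Bs] by simp
  have R: "?R \<in> sets \<mu>" using TB by (auto simp: sets_mu_iff)
  then have Rb [measurable]: "?R \<in> sets borel" by (auto simp: sets_mu_iff)
  have "emeasure lborel ?R \<le> emeasure lborel ({u<..<v} - B)"
  proof (rule measure_lborel_null[OF _ _ R])
    show "sym_diff B (T -` B \<inter> I) \<in> sets \<mu>"
      using Bs measurable_sets[OF T_mu Bs] by (intro sets.Un sets.Diff) auto
    show "prob (sym_diff B (T -` B \<inter> I)) = 0" using B by (simp add: quasi_invariant_def)
    show "{u<..<v} - B \<in> sets \<mu>" using sub by (auto simp: sets_mu_iff)
  qed auto
  then have R0: "emeasure lborel ?R = 0" using full by simp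
  have "emeasure lborel (?J - B) = (\<integral>\<^sup>+y. indicator (?J - B) y \<partial>lborel)"
    by (subst nn_integral_indicator) auto
  also have "\<dots> \<le> (\<integral>\<^sup>+y. ennreal (real N / (branch k y)\<^sup>2) * indicator ?R (branch k y)
      * ennreal ((branch k y)\<^sup>2 / real N) * indicator I y \<partial>lborel)"
  proof (rule nn_integral_mono)
    fix y
    show "indicator (?J - B) y \<le> ennreal (real N / (branch k y)\<^sup>2) * indicator ?R (branch k y)
      * ennreal ((branch k y)\<^sup>2 / real N) * indicator I y"
    proof (cases "y \<in> ?J - B")
      case True
      then have b: "branch k y \<in> {u<..<v}" "T (branch k y) = y" "y \<in> I" using pre JI by auto
      have "branch k y > 0" using b pos by auto
      then have "ennreal (real N / (branch k y)\<^sup>2) * ennreal ((branch k y)\<^sup>2 / real N) = 1"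
        using pos by (subst ennreal_mult[symmetric]) auto
      moreover have "branch k y \<in> ?R" using b True sub by auto
      ultimately show ?thesis using True b(3) by (simp add: mult_ac)
    qed simp
  qed
  also have "\<dots> = (\<integral>\<^sup>+x. ennreal (real N / x\<^sup>2) * indicator ?R x \<partial>lborel)"
    using d sub k by (intro nn_integral_branch[symmetric]) auto
  also have "\<dots> = (\<integral>\<^sup>+(x::real). 0 \<partial>lborel)"
  proof (rule nn_integral_cong_AE)
    have "?R \<in> null_sets lborel" using R0 by (simp add: null_sets_def)
    then have "AE x in lborel. x \<notin> ?R" by (rule AE_not_in)
    then show "AE x in lborel. ennreal (real N / x\<^sup>2) * indicator ?R x = 0"
      by eventually_elim simp
  qed
  finally show "emeasure lborel (?J - B) = 0" by simp
qed

text \<open>Take a longest interval filled by \<open>B\<close>, which exists by compactness.  If the digit were constant on it, its image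
  would be filled by \<open>B\<close> and longer.  So it contains a discontinuity, and the image of a left
  neighbourhood of a discontinuity is a right neighbourhood of \<open>\<alpha>\<close>.\<close>

lemma quasi_invariant_full_near_alpha:
  assumes B: "quasi_invariant B" and Bpos: "prob B > 0"
  shows "\<exists>\<delta>>0. \<delta> \<le> 1 \<and> emeasure lborel ({\<alpha><..<\<alpha> + \<delta>} - B) = 0"
proof -
  have Bb [measurable]: "B \<in> sets borel" using B by (auto simp: quasi_invariant_def sets_mu_iff)
  define S where "S = {(a, b). \<alpha> \<le> a \<and> a \<le> b \<and> b \<le> \<alpha> + 1 \<and> emeasure lborel ({a<..<b} - B) = 0}"
  have "closed S"
    unfolding closed_sequential_limits
  proof (intro allI impI, elim conjE)
    fix x l assume x: "\<forall>n. x n \<in> S" and l: "x \<longlonglongrightarrow> l"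
    define a where "a n = fst (x n)" for n
    define b where "b n = snd (x n)" for n
    have ab: "\<alpha> \<le> a n" "a n \<le> b n" "b n \<le> \<alpha> + 1" "emeasure lborel ({a n<..<b n} - B) = 0" for n
      using x[rule_format, of n] by (auto simp: S_def a_def b_def split: prod.splits)
    have la: "a \<longlonglongrightarrow> fst l" unfolding a_def[abs_def] by (rule tendsto_fst[OF l])
    have lb: "b \<longlonglongrightarrow> snd l" unfolding b_def[abs_def] by (rule tendsto_snd[OF l])
    have 1: "\<alpha> \<le> fst l" using la ab(1) by (intro LIMSEQ_le_const[OF la]) auto
    have 2: "snd l \<le> \<alpha> + 1" using lb ab(3) by (intro LIMSEQ_le_const2[OF lb]) auto
    have 3: "fst l \<le> snd l" using la lb ab(2) by (intro LIMSEQ_le[OF la lb]) auto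
    have "emeasure lborel ({fst l<..<snd l} - B) \<le> ennreal (\<bar>a n - fst l\<bar> + \<bar>b n - snd l\<bar>)" for n
    proof -
      have "{fst l<..<snd l} - B \<subseteq> ({a n<..<b n} - B) \<union> ({fst l..max (fst l) (a n)} \<union> {min (snd l) (b n)..snd l})"
        by auto
      then have "emeasure lborel ({fst l<..<snd l} - B)
          \<le> emeasure lborel (({a n<..<b n} - B) \<union> ({fst l..max (fst l) (a n)} \<union> {min (snd l) (b n)..snd l}))"
        by (intro emeasure_mono) auto
      also have "\<dots> \<le> emeasure lborel ({a n<..<b n} - B) + emeasure lborel ({fst l..max (fst l) (a n)} \<union> {min (snd l) (b n)..snd l})"
        by (intro emeasure_subadditive) auto
      also have "\<dots> \<le> 0 + (emeasure lborel {fst l..max (fst l) (a n)} + emeasure lborel {min (snd l) (b n)..snd l})"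
        unfolding ab(4) by (intro add_left_mono emeasure_subadditive) auto
      also have "\<dots> = ennreal (max (fst l) (a n) - fst l + (snd l - min (snd l) (b n)))"
        by (simp add: ennreal_plus[symmetric] del: ennreal_plus)
      also have "\<dots> \<le> ennreal (\<bar>a n - fst l\<bar> + \<bar>b n - snd l\<bar>)"
        by (intro ennreal_leI) (auto simp: max_def min_def)
      finally show ?thesis .
    qed
    moreover have "(\<lambda>n. ennreal (\<bar>a n - fst l\<bar> + \<bar>b n - snd l\<bar>)) \<longlonglongrightarrow> ennreal (\<bar>fst l - fst l\<bar> + \<bar>snd l - snd l\<bar>)"
      by (intro tendsto_ennrealI tendsto_intros la lb)
    ultimately have "emeasure lborel ({fst l<..<snd l} - B) \<le> ennreal (\<bar>fst l - fst l\<bar> + \<bar>snd l - snd l\<bar>)"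
      by (intro LIMSEQ_le_const) auto
    then have "emeasure lborel ({fst l<..<snd l} - B) = 0" by simp
    then show "l \<in> S" using 1 2 3 by (auto simp: S_def split: prod.splits)
  qed
  moreover have "bounded S"
  proof (rule bounded_subset)
    show "bounded ({\<alpha>..\<alpha> + 1} \<times> {\<alpha>..\<alpha> + 1})" by (intro bounded_Times) auto
    show "S \<subseteq> {\<alpha>..\<alpha> + 1} \<times> {\<alpha>..\<alpha> + 1}" by (auto simp: S_def)
  qed
  ultimately have "compact S" by (simp add: compact_eq_bounded_closed)
  obtain a0 b0 where ab0: "\<alpha> \<le> a0" "a0 < b0" "b0 \<le> \<alpha> + 1" "emeasure lborel ({a0<..<b0} - B) = 0"
    using quasi_invariant_contains_interval[OF B Bpos] by blast
  then have "(a0, b0) \<in> S" by (simp add: S_def)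
  then have "\<exists>x\<in>S. \<forall>y\<in>S. snd y - fst y \<le> snd x - fst x"
    using \<open>compact S\<close> by (intro continuous_attains_sup continuous_intros) auto
  then obtain a b where ab: "\<alpha> \<le> a" "b \<le> \<alpha> + 1" "emeasure lborel ({a<..<b} - B) = 0"
    and max: "\<And>u v. (u, v) \<in> S \<Longrightarrow> v - u \<le> b - a"
    unfolding S_def by fastforce
  have "a < b" using max[OF \<open>(a0, b0) \<in> S\<close>] ab0 by simp
  have "\<exists>x y. a < x \<and> x < y \<and> y < b \<and> dig x \<noteq> dig y"
  proof (rule ccontr)
    assume no: "\<not> ?thesis"
    define k where "k = dig ((a + b) / 2)"
    have d: "dig x = k" if "a < x" "x < b" for x
    proof (cases x "(a + b) / 2" rule: linorder_cases)
      case less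
      then show ?thesis using no that \<open>a < b\<close> by (auto simp: k_def)
    next
      case greater
      then show ?thesis using no that \<open>a < b\<close> by (auto simp: k_def)
    qed (simp only: k_def)
    note im = quasi_invariant_image_interval[OF B ab(1) \<open>a < b\<close> ab(2) d ab(3)]
    have "(real N / b - of_int k, real N / a - of_int k) \<in> S"
      using im by (simp add: S_def less_imp_le)
    then have "real N / a - real N / b \<le> b - a" using max by fastforce
    moreover have "b - a < real N / a - real N / b"
    proof -
      have pos: "a > 0" "b > 0" using ab \<open>a < b\<close> alpha_pos by auto
      have "a * b < b * b" using \<open>a < b\<close> pos by simp
      also have "\<dots> \<le> real N" using ab \<open>a < b\<close> by (intro mult_le_N) (auto simp: I_iff)
      finally have "(b - a) * (a * b) < (b - a) * real N" using \<open>a < b\<close> by simp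
      then show ?thesis using pos by (simp add: field_simps)
    qed
    ultimately show False by simp
  qed
  then obtain x y where xy: "a < x" "x < y" "y < b" "dig x \<noteq> dig y" by blast
  then obtain k where k: "1 \<le> k" "x \<le> cut k" "cut k < y"
    using cut_between_regular[of x y] ab by (metis less_imp_le less_le_trans order_le_less_trans)
  define c where "c = cut k"
  have c: "a < c" "c < b" using k xy by (auto simp: c_def)
  have k0: "real_of_int k > 0" using k by simp
  have pos: "c > 0" "real N > 0" using c ab alpha_pos N_gt by auto
  have Nc: "real N / c = of_int k + \<alpha>" using k0 alpha_pos pos by (simp add: c_def cut_def)
  define u where "u = max a (cut (k + 1))"
  have cutlt: "cut (k + 1) < c"
    unfolding c_def cut_def using k0 alpha_pos pos by (intro divide_strict_left_mono) auto
  have u: "\<alpha> \<le> u" "u < c" "a \<le> u" "cut (k + 1) \<le> u" using ab c cutlt by (auto simp: u_def)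
  have d: "dig z = k" if z: "u < z" "z < c" for z
  proof -
    have zp: "z > 0" "z > \<alpha>" using z u alpha_pos by auto
    have "real N / c < real N / z" using z zp pos by (intro divide_strict_left_mono) auto
    then have 1: "of_int k < real N / z - \<alpha>" using Nc by simp
    have kp: "of_int (k + 1) + \<alpha> > 0" using k0 alpha_pos by simp
    have "cut (k + 1) < z" using z u by simp
    then have "real N / z < of_int (k + 1) + \<alpha>" using zp kp by (simp add: cut_def field_simps)
    then have "real N / z - \<alpha> < of_int k + 1" by simp
    then show ?thesis using 1 dig_regular[OF zp(2)] by (simp add: floor_eq_iff)
  qed
  have "emeasure lborel ({u<..<c} - B) \<le> emeasure lborel ({a<..<b} - B)"
    using u c by (intro emeasure_mono) auto
  then have full: "emeasure lborel ({u<..<c} - B) = 0" using ab(3) by simp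
  note im = quasi_invariant_image_interval[OF B u(1,2) _ d full]
  have cI: "c \<le> \<alpha> + 1" using c ab by simp
  have "emeasure lborel ({\<alpha><..<\<alpha> + (real N / u - of_int k - \<alpha>)} - B) = 0"
    using im(1)[OF cI] Nc by simp
  moreover have "0 < real N / u - of_int k - \<alpha>" using im(4)[OF cI] Nc by simp
  moreover have "real N / u - of_int k - \<alpha> \<le> 1" using im(3)[OF cI] by simp
  ultimately show ?thesis by blast
qed

text \<open>A set and its complement cannot both fill a neighbourhood of \<open>\<alpha>\<close>.\<close>

theorem ergodic:
  assumes B: "quasi_invariant B"
  shows "prob B = 0 \<or> prob (I - B) = 0"
proof (rule ccontr)
  assume "\<not> ?thesis"
  then have pos: "prob B > 0" "prob (I - B) > 0" by (auto simp: zero_less_measure_iff)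
  have Bs: "B \<in> sets \<mu>" and BI: "B \<subseteq> I" using B by (auto simp: quasi_invariant_def sets_mu_iff)
  have Bb: "B \<in> sets borel" using Bs by (auto simp: sets_mu_iff)
  have "sym_diff (I - B) (T -` (I - B) \<inter> I) = sym_diff B (T -` B \<inter> I)"
    using BI T_in_I by auto
  then have B': "quasi_invariant (I - B)"
    using B sets.compl_sets[OF Bs] by (simp add: quasi_invariant_def)
  obtain \<delta>1 where d1: "\<delta>1 > 0" "\<delta>1 \<le> 1" "emeasure lborel ({\<alpha><..<\<alpha> + \<delta>1} - B) = 0"
    using quasi_invariant_full_near_alpha[OF B pos(1)] by blast
  obtain \<delta>2 where d2: "\<delta>2 > 0" "emeasure lborel ({\<alpha><..<\<alpha> + \<delta>2} - (I - B)) = 0"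
    using quasi_invariant_full_near_alpha[OF B' pos(2)] by blast
  let ?J = "{\<alpha><..<\<alpha> + min \<delta>1 \<delta>2}"
  have "emeasure lborel ?J \<le> emeasure lborel (({\<alpha><..<\<alpha> + \<delta>1} - B) \<union> ({\<alpha><..<\<alpha> + \<delta>2} - (I - B)))"
    using Bb by (intro emeasure_mono) auto
  also have "\<dots> \<le> emeasure lborel ({\<alpha><..<\<alpha> + \<delta>1} - B) + emeasure lborel ({\<alpha><..<\<alpha> + \<delta>2} - (I - B))"
    using Bb by (intro emeasure_subadditive) auto
  also have "\<dots> = 0" using d1 d2 by simp
  finally show False using d1(1) d2(1) by simp
qed

text \<open>Let \<open>g\<close> be the density of \<open>\<nu>\<close> with respect to \<open>\<mu>\<close>.  By invariance the points of \<open>E = {g < 1}\<close> with image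
  outside \<open>E\<close> and the points outside \<open>E\<close> with image in \<open>E\<close> have the same \<open>\<mu>\<close>-measure, and the same \<open>\<nu>\<close>-measure;
  as \<open>g < 1\<close> on the former and \<open>g \<ge> 1\<close> on the latter, both are null.  By ergodicity \<open>E\<close> is null or full, and the latter contradicts \<open>\<integral> g d\<mu> = 1\<close>.\<close>

lemma acip_unique:
  assumes \<nu>: "is_acip N \<alpha> \<nu>"
  shows "\<nu> = \<mu>"
proof -
  have sets_eq: "sets \<nu> = sets \<mu>" using \<nu> by (simp add: is_acip_def sets_mu)
  then have space_eq: "space \<nu> = I" using sets_eq_imp_space_eq[OF sets_eq] by simp
  interpret \<nu>: prob_space \<nu> using \<nu> by (simp add: is_acip_def)
  have inv: "emeasure \<nu> (T -` A \<inter> I) = emeasure \<nu> A" if "A \<in> sets \<mu>" for A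
  proof -
    have "T \<in> measurable \<nu> \<nu>" "distr \<nu> \<nu> T = \<nu>" using \<nu> by (auto simp: is_acip_def)
    then show ?thesis using emeasure_distr[of T \<nu> \<nu> A] that sets_eq space_eq by simp
  qed
  have "absolutely_continuous \<mu> \<nu>"
    unfolding absolutely_continuous_def
  proof
    fix A assume A: "A \<in> null_sets \<mu>"
    then have As: "A \<in> sets \<mu>" "prob A = 0" by (auto simp: measure_def)
    then have "emeasure lborel A = 0" using lborel_null_iff by simp
    moreover have "A \<in> sets borel" "A \<subseteq> I" using As by (auto simp: sets_mu_iff)
    ultimately have "A \<in> null_sets (restrict_space lborel I)"
      by (auto simp: null_sets_def sets_restrict_space_iff emeasure_restrict_space)
    then show "A \<in> null_sets \<nu>"
      using \<nu> by (auto simp: is_acip_def absolutely_continuous_def)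
  qed
  then obtain g where g [measurable]: "g \<in> borel_measurable \<mu>" and dg: "density \<mu> g = \<nu>"
    using Radon_Nikodym[OF _ sets_eq] by blast
  have em: "emeasure \<nu> A = (\<integral>\<^sup>+x. g x * indicator A x \<partial>\<mu>)" if "A \<in> sets \<mu>" for A
    unfolding dg[symmetric] using that by (rule emeasure_density[OF g])
  have gs: "(\<integral>\<^sup>+x. g x \<partial>\<mu>) = 1"
  proof -
    have "(\<integral>\<^sup>+x. g x \<partial>\<mu>) = (\<integral>\<^sup>+x. g x * indicator (space \<mu>) x \<partial>\<mu>)" by (intro nn_integral_cong) auto
    also have "\<dots> = emeasure \<nu> (space \<mu>)" by (rule em[symmetric, OF sets.top])
    also have "\<dots> = 1" using \<nu>.emeasure_space_1 space_eq by simp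
    finally show ?thesis .
  qed
  define E where "E = {x \<in> space \<mu>. g x < 1}"
  have Es: "E \<in> sets \<mu>" unfolding E_def by measurable
  let ?TE = "T -` E \<inter> I"
  have TEs: "?TE \<in> sets \<mu>" using measurable_sets[OF T_mu Es] by simp
  let ?P = "E - ?TE" and ?Q = "?TE - E"
  have Ps: "?P \<in> sets \<mu>" and Qs: "?Q \<in> sets \<mu>" using Es TEs by auto
  have PQ: "measure m ?P = measure m ?Q" if m: "finite_measure m" "sets m = sets \<mu>" "measure m ?TE = measure m E" for m
  proof -
    interpret m: finite_measure m by (rule m(1))
    have "measure m ?P = measure m E - measure m (E \<inter> ?TE)"
      using Es TEs m(2) by (metis m.finite_measure_Diff' )
    moreover have "measure m ?Q = measure m ?TE - measure m (?TE \<inter> E)"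
      using Es TEs m(2) by (metis m.finite_measure_Diff')
    ultimately show ?thesis using m(3) by (simp add: Int_commute)
  qed
  have muPQ: "prob ?P = prob ?Q"
    using prob_vimage[OF Es] by (intro PQ) (auto simp: finite_measure_axioms)
  have nuPQ: "measure \<nu> ?P = measure \<nu> ?Q"
    using inv[OF Es] sets_eq by (intro PQ) (auto simp: \<nu>.finite_measure_axioms measure_def)
  have one: "emeasure \<mu> A = (\<integral>\<^sup>+x. 1 * indicator A x \<partial>\<mu>)" if "A \<in> sets \<mu>" for A
    using that by simp
  have "emeasure \<mu> ?Q \<le> emeasure \<nu> ?Q"
    unfolding em[OF Qs] one[OF Qs]
  proof (rule nn_integral_mono)
    fix x
    show "1 * indicator ?Q x \<le> g x * indicator ?Q x"
      by (cases "x \<in> ?Q") (auto simp: E_def not_less)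
  qed
  then have le: "emeasure \<mu> ?P \<le> emeasure \<nu> ?P"
    using muPQ nuPQ by (simp add: emeasure_eq_measure \<nu>.emeasure_eq_measure)
  have P0: "prob ?P = 0"
  proof (rule ccontr)
    assume P: "prob ?P \<noteq> 0"
    have "(\<integral>\<^sup>+x. g x * indicator ?P x \<partial>\<mu>) < (\<integral>\<^sup>+x. 1 * indicator ?P x \<partial>\<mu>)"
    proof (rule nn_integral_less)
      have "(\<integral>\<^sup>+x. g x * indicator ?P x \<partial>\<mu>) = emeasure \<nu> ?P" using em[OF Ps] by simp
      then show "(\<integral>\<^sup>+x. g x * indicator ?P x \<partial>\<mu>) \<noteq> \<infinity>" by (simp add: \<nu>.emeasure_eq_measure)
      show "AE x in \<mu>. g x * indicator ?P x \<le> 1 * indicator ?P x"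
        by (intro AE_I2) (auto simp: E_def indicator_def)
      show "\<not> (AE x in \<mu>. 1 * indicator ?P x \<le> g x * indicator ?P x)"
      proof
        assume "AE x in \<mu>. 1 * indicator ?P x \<le> g x * indicator ?P x"
        then have "AE x in \<mu>. x \<notin> ?P"
        proof eventually_elim
          case (elim x)
          show ?case
          proof
            assume x: "x \<in> ?P"
            then have "indicator ?P x = (1 :: ennreal)" by (rule indicator_simps)
            then have "1 \<le> g x" using elim by (simp only: mult_1_right)
            moreover have "g x < 1" using x by (simp add: E_def)
            ultimately show False by simp
          qed
        qed
        then show False using P prob_eq_0[OF Ps] by blast
      qed
    qed (use g Ps in measurable)
    then show False using le em[OF Ps] one[OF Ps] by simp
  qed
  have "prob (sym_diff E ?TE) \<le> prob ?P + prob ?Q" by (rule measure_Un_le[OF Ps Qs])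
  then have "prob (sym_diff E ?TE) = 0" using P0 muPQ measure_nonneg[of \<mu> "sym_diff E ?TE"] by linarith
  then have "quasi_invariant E" using Es by (simp add: quasi_invariant_def)
  then consider "prob E = 0" | "prob (I - E) = 0" using ergodic by blast
  then have ge1: "AE x in \<mu>. 1 \<le> g x"
  proof cases
    case 1
    then have "E \<in> null_sets \<mu>" using Es by (auto simp: null_sets_def emeasure_eq_measure)
    then have "AE x in \<mu>. x \<notin> E" by (rule AE_not_in)
    then show ?thesis using AE_space by eventually_elim (auto simp: E_def not_less)
  next
    case 2
    then have "I - E \<in> null_sets \<mu>" using sets.compl_sets[OF Es] by (auto simp: null_sets_def emeasure_eq_measure)
    then have "AE x in \<mu>. x \<notin> I - E" by (rule AE_not_in)
    then have lt: "AE x in \<mu>. g x < 1" using AE_space by eventually_elim (auto simp: E_def)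
    have "(\<integral>\<^sup>+x. g x \<partial>\<mu>) < (\<integral>\<^sup>+x. 1 \<partial>\<mu>)"
    proof (rule nn_integral_less)
      show "(\<integral>\<^sup>+x. g x \<partial>\<mu>) \<noteq> \<infinity>" using gs by simp
      show "AE x in \<mu>. g x \<le> 1" using lt by eventually_elim simp
      show "\<not> (AE x in \<mu>. 1 \<le> g x)"
      proof
        assume "AE x in \<mu>. 1 \<le> g x"
        then have "AE x in \<mu>. False" using lt by eventually_elim auto
        then show False by simp
      qed
    qed auto
    then show ?thesis using gs emeasure_space_1 by simp
  qed
  have le1: "AE x in \<mu>. g x \<le> 1"
  proof (rule ccontr)
    assume n: "\<not> (AE x in \<mu>. g x \<le> 1)"
    have "(\<integral>\<^sup>+x. 1 \<partial>\<mu>) < (\<integral>\<^sup>+x. g x \<partial>\<mu>)"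
      by (rule nn_integral_less) (use n ge1 emeasure_space_1 in auto)
    then show False using gs emeasure_space_1 by simp
  qed
  have "density \<mu> g = density \<mu> (\<lambda>_. 1)"
    using ge1 le1 by (intro density_cong) (auto elim: eventually_elim2 intro: antisym)
  then show ?thesis using dg by (simp add: density_1)
qed

theorem mu_alpha_eq: "mu_alpha N \<alpha> = \<mu>"
  unfolding mu_alpha_def using is_acip_mu acip_unique by (rule the_equality)

theorem entropy_T_eq: "entropy_T N \<alpha> = ereal rokhlin_integral"
  by (simp add: entropy_T_def mu_alpha_eq ks_entropy_mu)

end

section \<open>The heights and the matching of orbits\<close>

locale matching =
  fixes N d i :: nat
  assumes d_ge: "d \<ge> 1" and i_ge: "i \<ge> 2"
    and N_eq: "real N = real d * (real d + real i) / (real i - 1)"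
begin

abbreviation "n \<equiv> real N"
abbreviation "s \<equiv> real d + real i"
abbreviation "A \<equiv> cA N d i"
abbreviation "B \<equiv> cB N d"
abbreviation "C \<equiv> cC N d i"
abbreviation "D \<equiv> cD N d"
abbreviation "E \<equiv> cE N d i"
abbreviation "F \<equiv> cF N d"

lemma d_real: "real d \<ge> 1" and i_real: "real i \<ge> 2"
  using d_ge i_ge by auto

lemma N_rel: "n * (real i - 1) = real d * s"
  using N_eq i_real by (simp add: field_simps)

lemma N_gt_d: "n > real d"
proof -
  have "real d * (real i - 1) < real d * s" using d_real i_real by simp
  then have "real d * (real i - 1) < n * (real i - 1)" by (simp add: N_rel)
  then show ?thesis using i_real by (simp add: mult_less_cancel_right)
qed

lemma N_pos: "n > 0"
  using N_gt_d d_real by linarith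

lemma E_eq: "E = A + 1" and F_eq: "F = B + 1"
  by (simp_all add: cE_def cF_def)

lemma A_root: "A * (A + s + 1) = n" and A_pos: "A > 0"
  and C_sqrt: "C = n * (A + 1) / (s + n)"
proof -
  let ?r = "sqrt ((s + 1)\<^sup>2 + 4 * n)"
  have r2: "?r\<^sup>2 = (s + 1)\<^sup>2 + 4 * n" using N_pos by simp
  have A: "A = (?r - (s + 1)) / 2" by (simp add: cA_def)
  have "A * (A + s + 1) = (?r\<^sup>2 - (s + 1)\<^sup>2) / 4"
    unfolding A by (simp add: field_simps power2_eq_square)
  then show "A * (A + s + 1) = n" using r2 by simp
  have "s + 1 < ?r" using N_pos d_real i_real by (intro real_less_rsqrt) auto
  then show "A > 0" using A by simp
  have "- (s - 1) + ?r = 2 * (A + 1)" using A by simp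
  then have "C = n * (2 * (A + 1)) / (2 * (s + n))"
    unfolding cC_def by simp
  also have "\<dots> = n * (A + 1) / (s + n)" using N_pos d_real i_real by (simp add: field_simps)
  finally show "C = n * (A + 1) / (s + n)" .
qed

lemma B_root: "(B + 1) * (B + real d) = n" and B_pos: "B > 0"
  and D_sqrt: "D = n * B / (n - real d)"
proof -
  let ?r = "sqrt ((real d - 1)\<^sup>2 + 4 * n)"
  have r2: "?r\<^sup>2 = (real d - 1)\<^sup>2 + 4 * n" using N_pos by simp
  have B: "B = (?r - (real d + 1)) / 2" by (simp add: cB_def)
  have "(B + 1) * (B + real d) = (?r\<^sup>2 - (real d - 1)\<^sup>2) / 4"
    unfolding B by (simp add: field_simps power2_eq_square)
  then show "(B + 1) * (B + real d) = n" using r2 by simp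
  have "(real d + 1)\<^sup>2 < (real d - 1)\<^sup>2 + 4 * n"
    using N_gt_d by (simp add: power2_eq_square algebra_simps)
  then have "real d + 1 < ?r" by (intro real_less_rsqrt) auto
  then show "B > 0" using B by simp
  show "D = n * B / (n - real d)"
    unfolding cD_def B using N_gt_d by (simp add: field_simps)
qed

lemma s_pos: "s > 0" "s \<ge> 3"
  using d_real i_real by auto

lemma C_pos: "C > 0" and D_pos: "D > 0" and E_pos: "E > 0" and F_pos: "F > 0"
  using A_pos B_pos N_pos N_gt_d s_pos by (auto simp: C_sqrt D_sqrt E_eq F_eq)

lemma A_prod: "A * (s + E) = n"
  using A_root by (simp add: E_eq algebra_simps)

lemma F_prod: "F * (real d + B) = n"
  using B_root by (simp add: F_eq algebra_simps)

lemma AE_prod: "(A + 1) * (s + A) = s + n"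
  using A_root by (simp add: algebra_simps)

lemma BF_prod: "B * (real d + F) = n - real d"
  using B_root by (simp add: F_eq algebra_simps)

text \<open>The products below are the transition rules of the natural extension: a side of \<open>\<Omega>_\<alpha>\<close> at height
  \<open>y\<close> over the cylinder of digit \<open>k\<close> is moved to height \<open>N / (k + y)\<close>.\<close>

lemma C_prod: "C * (s + A) = n"
proof -
  have "C * (s + A) = n * ((A + 1) * (s + A)) / (s + n)" by (simp add: C_sqrt)
  then show ?thesis using AE_prod N_pos s_pos by simp
qed

lemma D_prod: "D * (real d + F) = n"
proof -
  have "D * (real d + F) = n * (B * (real d + F)) / (n - real d)" by (simp add: D_sqrt)
  then show ?thesis using BF_prod N_gt_d by simp
qed

text \<open>The hypothesis on \<open>N\<close> in the form used to close the cycle of heights.  The products for \<open>E\<close> and \<open>B\<close>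
  rest on it.\<close>

lemma N_s1: "n * (s - 1) = real d * (s + n)"
  using N_rel by (simp add: algebra_simps)

lemma N_d1: "s * (n - real d) = n * (real d + 1)"
  using N_rel by (simp add: algebra_simps)

lemma E_prod: "E * (real d + C) = n"
proof -
  have "E * (real d + C) = (real d * (A + 1) * (s + n) + n * (A + 1) * (A + 1)) / (s + n)"
    using N_pos s_pos by (simp add: C_sqrt E_eq field_simps)
  also have "real d * (A + 1) * (s + n) + n * (A + 1) * (A + 1) = (A + 1) * (real d * (s + n) + n * (A + 1))"
    by (simp add: algebra_simps)
  also have "\<dots> = (A + 1) * (n * (s - 1) + n * (A + 1))" by (simp only: N_s1)
  also have "\<dots> = n * ((A + 1) * (s + A))" by (simp add: algebra_simps)
  also have "\<dots> = n * (s + n)" by (simp only: AE_prod)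
  finally show ?thesis using N_pos s_pos by simp
qed

lemma B_prod: "B * (s + D) = n"
proof -
  have "B * (s + D) = B * (s * (n - real d) + n * B) / (n - real d)"
    using N_gt_d by (simp add: D_sqrt field_simps)
  also have "B * (s * (n - real d) + n * B) = B * (n * (real d + 1) + n * B)" by (simp only: N_d1)
  also have "\<dots> = n * (B * (real d + F))" by (simp add: F_eq algebra_simps)
  also have "\<dots> = n * (n - real d)" by (simp only: BF_prod)
  finally show ?thesis using N_gt_d by simp
qed

lemma N_div:
  "n / A = s + E" "n / B = s + D" "n / C = s + A" "n / D = real d + F" "n / E = real d + C" "n / F = real d + B"
  using A_prod B_prod C_prod D_prod E_prod F_prod A_pos B_pos C_pos D_pos E_pos F_pos
  by (auto simp: field_simps)

lemma A_gt: "real i * A > real d"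
proof (rule ccontr)
  assume "\<not> ?thesis"
  then have iA: "real i * A \<le> real d" by simp
  have "(real i * A) * (real i * A + real i * (s + 1)) \<le> real d * (real d + real i * (s + 1))"
    using iA A_pos i_real s_pos d_real by (intro mult_mono add_mono) auto
  moreover have "(real i * A) * (real i * A + real i * (s + 1)) = (real i)\<^sup>2 * (A * (A + s + 1))"
    by (simp add: algebra_simps power2_eq_square)
  ultimately have "(real i)\<^sup>2 * n \<le> real d * (real d + real i * (s + 1))"
    by (simp only: A_root)
  then have "(real i)\<^sup>2 * n * (real i - 1) \<le> real d * (real d + real i * (s + 1)) * (real i - 1)"
    using i_real by (intro mult_right_mono) auto
  then have "(real i)\<^sup>2 * (real d * s) \<le> real d * (real d + real i * (s + 1)) * (real i - 1)"
    using N_rel by (simp add: mult.assoc)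
  then have "real d * ((real i)\<^sup>2 * s) \<le> real d * ((real d + real i * (s + 1)) * (real i - 1))"
    by (simp add: mult_ac)
  then have "(real i)\<^sup>2 * s \<le> (real d + real i * (s + 1)) * (real i - 1)"
    using d_real by simp
  then show False using d_real i_real by (simp add: power2_eq_square algebra_simps)
qed

lemma E_lt_F: "E < F"
proof -
  have "E * (E + real d - 1) = A * (A + real d + 1) + real d"
    by (simp add: E_eq algebra_simps)
  also have "\<dots> < A * (A + real d + 1) + real i * A" using A_gt by simp
  also have "\<dots> = A * (A + s + 1)" by (simp add: algebra_simps)
  also have "\<dots> = F * (F + real d - 1)" using A_root F_prod by (simp add: F_eq algebra_simps)
  finally have lt: "E * (E + real d - 1) < F * (F + real d - 1)" .
  show ?thesis
  proof (rule ccontr)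
    assume "\<not> ?thesis"
    then have "F * (F + real d - 1) \<le> E * (E + real d - 1)"
      using F_pos d_real by (intro mult_mono) auto
    then show False using lt by simp
  qed
qed

lemma A_lt_B: "A < B"
  using E_lt_F by (simp add: E_eq F_eq)

lemma B_lt_D: "B < D"
proof -
  have "B * (n - real d) < B * n" using B_pos d_real by simp
  then show ?thesis using N_gt_d by (simp add: D_sqrt field_simps)
qed

lemma B_lt_C: "B < C"
proof (rule ccontr)
  assume "\<not> ?thesis"
  then have "C * (s + A) \<le> B * (s + A)" using s_pos A_pos by (intro mult_right_mono) auto
  also have "\<dots> < B * (s + D)" using B_pos A_lt_B B_lt_D by simp
  finally show False using B_prod C_prod by simp
qed

text \<open>Heights differ by less than one digit, \<open>F - E < 1\<close>; with \<open>i \<ge> 2\<close> this puts \<open>C\<close> below \<open>D\<close>, so that the fibres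
  of \<open>\<Omega>_\<alpha>\<close> are non-degenerate.\<close>

lemma F_lt: "F < A + 2"
proof (rule ccontr)
  assume "\<not> ?thesis"
  then have "(A + 2) * (A + 2 + real d - 1) \<le> F * (F + real d - 1)"
    using A_pos d_real by (intro mult_mono) auto
  also have "\<dots> = A * (A + s + 1)" using A_root F_prod by (simp add: F_eq algebra_simps)
  finally have 1: "2 * real d + 2 \<le> (real i - 2) * A" by (simp add: algebra_simps)
  have "A * s < A * (A + s + 1)" using A_pos by simp
  then have "A * s * (real i - 1) < n * (real i - 1)" unfolding A_root using i_real by (intro mult_strict_right_mono) auto
  then have "s * (A * (real i - 1)) < s * real d" by (simp add: N_rel mult_ac)
  then have "A * (real i - 1) < real d" using s_pos by simp
  then show False using 1 A_pos d_real by (simp add: algebra_simps)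
qed

lemma C_lt_D: "C < D"
proof (rule ccontr)
  assume "\<not> ?thesis"
  then have "D * (real d + F) \<le> C * (real d + F)" using F_pos d_real by (intro mult_right_mono) auto
  also have "\<dots> < C * (s + A)"
    using F_lt i_real C_pos by (intro mult_strict_left_mono) auto
  finally show False using D_prod C_prod by simp
qed

lemma C_lt_E: "C < E"
proof -
  have "n * (A + 1) < (s + n) * (A + 1)" using A_pos s_pos by simp
  then show ?thesis using N_pos s_pos by (simp add: C_sqrt E_eq field_simps)
qed

lemma D_lt_E: "D < E"
proof (rule ccontr)
  assume "\<not> ?thesis"
  then have "E * (real d + C) \<le> D * (real d + C)" using C_pos d_real by (intro mult_right_mono) auto
  also have "\<dots> < D * (real d + F)" using C_lt_E E_lt_F D_pos by simp
  finally show False using E_prod D_prod by simp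
qed

text \<open>\<open>1 / H\<close>, the total mass of \<open>N / (N + x y)\<^sup>2\<close> on \<open>\<Omega>_\<alpha>\<close>.\<close>

definition "Z = 2 * ln A + 2 * ln (B + 1) - ln (n - (A + 1) * real d) - ln (n - s * B)"

lemma Z_eq: "Z = 2 * ln A + 2 * ln F - ln B - ln C - ln D - ln E"
proof -
  have "n - (A + 1) * real d = E * C" using E_prod by (simp add: E_eq algebra_simps)
  moreover have "n - s * B = B * D" using B_prod by (simp add: algebra_simps)
  ultimately show ?thesis
    using B_pos C_pos D_pos E_pos by (simp add: Z_def F_eq ln_mult)
qed

end

locale matching_alpha = matching +
  fixes \<alpha> :: real
  assumes alpha_in: "A \<le> \<alpha>" "\<alpha> \<le> B"
begin

text \<open>The orbits of the endpoints are defined by their Moebius formulas, so that they make sense also for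
  \<open>\<alpha> = A\<close> and \<open>\<alpha> = B\<close>, where they run through endpoints of cylinders.\<close>

definition "p = n / \<alpha> - s"
definition "q = n / (\<alpha> + 1) - real d"
definition "p2 = n / p - real d"
definition "q2 = n / q - s"

lemma a_pos: "\<alpha> > 0"
  using alpha_in A_pos by linarith

sublocale nexp N \<alpha>
proof
  show "0 < \<alpha>" by (rule a_pos)
  have "(\<alpha> + 1)\<^sup>2 \<le> F * F"
    unfolding power2_eq_square using alpha_in a_pos by (intro mult_mono) (auto simp: F_eq)
  also have "\<dots> \<le> F * (real d + B)" using F_pos d_real by (intro mult_left_mono) (auto simp: F_eq)
  finally show "(\<alpha> + 1)\<^sup>2 \<le> n" using F_prod by simp
qed

lemma p_le: "p \<le> \<alpha> + 1"
proof -
  have "n \<le> \<alpha> * (\<alpha> + s + 1)"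
    unfolding A_root[symmetric] using alpha_in A_pos s_pos by (intro mult_mono) auto
  then show ?thesis using a_pos by (simp add: p_def field_simps)
qed

text \<open>Equivalent to \<open>\<alpha> \<le> B\<close>, just as the upper bound on \<open>q\<close> below is equivalent to \<open>A \<le> \<alpha>\<close>: it is at this point that
  the interval of the theorem coincides with the parameters for which \<open>p\<close> and \<open>q\<close> have the extreme digits.\<close>

lemma p_ge: "n / (real d + 1 + \<alpha>) \<le> p"
proof -
  have "s * (\<alpha> * (real d + 1 + \<alpha>)) \<le> s * (B * (real d + F))"
    using alpha_in a_pos s_pos d_real B_pos by (intro mult_left_mono mult_mono) (auto simp: F_eq)
  also have "\<dots> = n * (real d + 1)" using BF_prod N_d1 by simp
  finally have "s * (\<alpha> * (real d + 1 + \<alpha>)) \<le> n * (real d + 1)" .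
  then show ?thesis using a_pos d_real by (simp add: p_def field_simps)
qed

lemma p_pos: "p > 0"
  using p_ge a_pos d_real N_pos by (smt (verit) divide_pos_pos)

lemma q_ge: "\<alpha> \<le> q"
proof -
  have "(\<alpha> + 1) * (\<alpha> + real d) \<le> n"
    unfolding B_root[symmetric] using alpha_in a_pos by (intro mult_mono) auto
  then show ?thesis using a_pos by (simp add: q_def field_simps)
qed

lemma q_pos: "q > 0" using q_ge a_pos by linarith

lemma q_le: "q \<le> n / (s + \<alpha>)"
proof -
  have "n * (s - 1) = real d * ((A + 1) * (s + A))" by (simp only: AE_prod N_s1)
  also have "\<dots> \<le> real d * ((\<alpha> + 1) * (s + \<alpha>))"
    using alpha_in a_pos s_pos A_pos by (intro mult_left_mono mult_mono) auto
  finally show ?thesis using a_pos s_pos by (simp add: q_def field_simps)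
qed

lemma div_ineq: "0 < x \<Longrightarrow> 0 < y \<Longrightarrow> n / x \<le> y \<longleftrightarrow> n / y \<le> x"
  "0 < x \<Longrightarrow> 0 < y \<Longrightarrow> x \<le> n / y \<longleftrightarrow> y \<le> n / x"
  "0 < x \<Longrightarrow> 0 < y \<Longrightarrow> n / x < y \<longleftrightarrow> n / y < x"
  "0 < x \<Longrightarrow> 0 < y \<Longrightarrow> x < n / y \<longleftrightarrow> y < n / x"
  by (simp_all add: field_simps)

lemma p2_ge_q: "q \<le> p2"
  using p_le p_pos a_pos N_pos by (simp add: p2_def q_def divide_left_mono)

lemma p2_pos: "p2 > 0" using p2_ge_q q_pos by linarith

lemma q2_le_p: "q2 \<le> p"
  using q_ge q_pos a_pos N_pos by (simp add: p_def q2_def divide_left_mono)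

lemma p2_le: "p2 \<le> \<alpha> + 1"
  using p_ge div_ineq(1)[of "real d + 1 + \<alpha>" p] p_pos a_pos d_real by (simp add: p2_def)

lemma q2_ge: "\<alpha> \<le> q2"
  using q_le div_ineq(2)[of q "s + \<alpha>"] q_pos a_pos s_pos by (simp add: q2_def)

lemma q2_pos: "q2 > 0" using q2_ge a_pos by linarith

lemma p2_formula: "\<alpha> * p * p2 = n * (real i * \<alpha> - real d)"
proof -
  have ap: "\<alpha> * p = n - s * \<alpha>" using a_pos by (simp add: p_def algebra_simps)
  have "p * p2 = n - real d * p" using p_pos by (simp add: p2_def algebra_simps)
  then have "\<alpha> * p * p2 = \<alpha> * (n - real d * p)" by (simp only: mult.assoc)
  then have "\<alpha> * p * p2 = \<alpha> * n - real d * (\<alpha> * p)" by (simp add: algebra_simps)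
  also have "\<dots> = \<alpha> * (n + real d * s) - real d * n" unfolding ap by (simp add: algebra_simps)
  also have "\<dots> = n * (real i * \<alpha> - real d)" unfolding N_rel[symmetric] by (simp add: algebra_simps)
  finally show ?thesis .
qed

lemma q2_formula: "(\<alpha> + 1) * q * q2 = n * (real i * \<alpha> - real d)"
proof -
  have aq: "(\<alpha> + 1) * q = n - real d * (\<alpha> + 1)"
    using a_pos by (simp add: q_def right_diff_distrib mult.commute)
  have "q * q2 = n - s * q" using q_pos by (simp add: q2_def algebra_simps)
  then have "(\<alpha> + 1) * q * q2 = (\<alpha> + 1) * (n - s * q)" by (simp only: mult.assoc)
  then have "(\<alpha> + 1) * q * q2 = (\<alpha> + 1) * n - s * ((\<alpha> + 1) * q)" by (simp add: algebra_simps)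
  also have "\<dots> = (\<alpha> + 1) * (n + real d * s) - s * n" unfolding aq by (simp add: algebra_simps)
  also have "\<dots> = n * (real i * \<alpha> - real d)" unfolding N_rel[symmetric] by (simp add: algebra_simps)
  finally show ?thesis .
qed

lemma orbit_product: "\<alpha> * p * p2 = (\<alpha> + 1) * q * q2"
  by (simp add: p2_formula q2_formula)

text \<open>For \<open>A < \<alpha> < B\<close> the orbits of \<open>\<alpha>\<close> and \<open>\<alpha> + 1\<close> agree from the third step on, with digits differing by one.\<close>

lemma matching: "n / q2 = n / p2 + 1"
proof -
  define m where "m = real i * \<alpha> - real d"
  have m: "m > 0" unfolding m_def using alpha_in A_gt i_real mult_left_mono[of A \<alpha> "real i"] by linarith
  have ap: "\<alpha> * p = n - s * \<alpha>" using a_pos by (simp add: p_def algebra_simps)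
  have aq: "(\<alpha> + 1) * q = n - real d * (\<alpha> + 1)"
    using a_pos by (simp add: q_def right_diff_distrib mult.commute)
  have f: "\<alpha> * p * p2 = n * m" "(\<alpha> + 1) * q * q2 = n * m"
    unfolding m_def by (rule p2_formula, rule q2_formula)
  have "n / p2 = \<alpha> * p / m"
    using f(1) p2_pos m by (subst frac_eq_eq) auto
  moreover have "n / q2 = (\<alpha> + 1) * q / m"
    using f(2) q2_pos m by (subst frac_eq_eq) auto
  moreover have "(\<alpha> + 1) * q = \<alpha> * p + m" unfolding ap aq m_def by (simp add: algebra_simps)
  moreover have "(\<alpha> * p + m) / m = \<alpha> * p / m + 1" using m by (simp add: add_divide_distrib)
  ultimately show ?thesis by (simp only:)
qed

text \<open>Matching transfers the bound \<open>q\<^sub>2 \<ge> \<alpha>\<close> to a bound on \<open>p\<^sub>2\<close>: it lies outside the interior of the cylinder of the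
  largest digit.  Symmetrically, \<open>q\<^sub>2\<close> lies outside the interior of the cylinder of the smallest digit.\<close>

lemma p2_ge: "n / (s + \<alpha>) \<le> p2"
proof -
  have "n / p2 = n / q2 - 1" using matching by simp
  also have "\<dots> \<le> n / \<alpha> - 1" using q2_ge a_pos q2_pos N_pos by (simp add: divide_left_mono)
  also have "\<dots> = p + s - 1" by (simp add: p_def)
  also have "\<dots> \<le> s + \<alpha>" using p_le by simp
  finally show ?thesis using div_ineq(1)[of p2 "s + \<alpha>"] p2_pos a_pos s_pos by simp
qed

lemma q2_le: "q2 \<le> n / (real d + 1 + \<alpha>)"
proof -
  have "real d + 1 + \<alpha> \<le> n / (\<alpha> + 1) + 1" using q_ge by (simp add: q_def)
  also have "\<dots> \<le> n / p2 + 1" using p2_le p2_pos N_pos a_pos by (simp add: divide_left_mono)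
  also have "\<dots> = n / q2" using matching by simp
  finally show ?thesis using div_ineq(2)[of "real d + 1 + \<alpha>" q2] q2_pos a_pos d_real by simp
qed

lemma p_ge_alpha: "\<alpha> \<le> p" using q2_ge q2_le_p by linarith
lemma q_le_alpha: "q \<le> \<alpha> + 1" using p2_ge_q p2_le by linarith
lemma q2_le_alpha: "q2 \<le> \<alpha> + 1" using q2_le_p p_le by linarith
lemma p2_ge_alpha: "\<alpha> \<le> p2" using q_ge p2_ge_q by linarith

lemma dig_range:
  assumes "x \<in> I"
  shows "dig x \<in> {int d..int (d + i)}"
proof (cases "x = \<alpha>")
  case False
  then have x: "\<alpha> < x" "x \<le> \<alpha> + 1" "x > 0" using assms I_pos by (auto simp: I_iff)
  have "n / (\<alpha> + 1) \<le> n / x" using x N_pos by (intro divide_left_mono) auto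
  then have 1: "real d \<le> n / x - \<alpha>" using q_ge by (simp add: q_def)
  have "n / x < n / \<alpha>" using x N_pos a_pos by (intro divide_strict_left_mono) auto
  then have 2: "n / x - \<alpha> < s + 1" using p_le by (simp add: p_def)
  have "int d \<le> \<lfloor>n / x - \<alpha>\<rfloor>" using 1 by (simp add: le_floor_iff)
  moreover have "\<lfloor>n / x - \<alpha>\<rfloor> < int (d + i) + 1" using 2 by (subst floor_less_iff) simp
  ultimately show ?thesis using dig_regular[OF x(1)] by simp
next
  case True
  have up: "n / \<alpha> - \<alpha> \<le> s + 1" using p_le by (simp add: p_def)
  have lo: "s \<le> n / \<alpha> - \<alpha>" using p_ge_alpha by (simp add: p_def)
  show ?thesis
  proof (cases "n / \<alpha> - \<alpha> \<in> \<int>")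
    case True
    then obtain z where z: "n / \<alpha> - \<alpha> = of_int z" by (auto elim: Ints_cases)
    have "dig \<alpha> = z - 1" using True z by (simp add: digit_def)
    moreover have "of_int z \<le> real_of_int (int (d + i) + 1)" "real_of_int (int (d + i)) \<le> of_int z"
      using up lo z by auto
    then have "z \<le> int (d + i) + 1" "int (d + i) \<le> z" by linarith+
    ultimately show ?thesis using \<open>x = \<alpha>\<close> i_ge by auto
  next
    case False
    then have "n / \<alpha> - \<alpha> \<noteq> s + 1" by (metis Ints_add Ints_of_nat Ints_1)
    then have "n / \<alpha> - \<alpha> < s + 1" using up by simp
    then have "\<lfloor>n / \<alpha> - \<alpha>\<rfloor> < int (d + i) + 1" by (subst floor_less_iff) simp
    moreover have "int (d + i) \<le> \<lfloor>n / \<alpha> - \<alpha>\<rfloor>" using lo by (simp add: le_floor_iff)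
    ultimately show ?thesis using False \<open>x = \<alpha>\<close> by (simp add: digit_def)
  qed
qed

end

section \<open>The invariant density\<close>

lemma piecewise_has_integral:
  fixes g1 g2 g3 G1 G2 G3 :: "real \<Rightarrow> real"
  assumes ord: "a \<le> r1" "r1 \<le> r2" "r2 \<le> b"
    and G: "\<And>x. x \<in> {a..b} \<Longrightarrow> (G1 has_real_derivative g1 x) (at x)"
      "\<And>x. x \<in> {a..b} \<Longrightarrow> (G2 has_real_derivative g2 x) (at x)"
      "\<And>x. x \<in> {a..b} \<Longrightarrow> (G3 has_real_derivative g3 x) (at x)"
  shows "((\<lambda>x. if x < r1 then g1 x else if x < r2 then g2 x else g3 x) has_integral
    (G1 r1 - G1 a) + (G2 r2 - G2 r1) + (G3 b - G3 r2)) {a..b}" (is "(?h has_integral _) _")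
proof -
  have ftc: "(g has_integral (G v - G u)) {u..v}"
    if "u \<le> v" "a \<le> u" "v \<le> b" "\<And>x. x \<in> {a..b} \<Longrightarrow> (G has_real_derivative g x) (at x)" for G g :: "real \<Rightarrow> real" and u v
    using that by (intro fundamental_theorem_of_calculus)
      (auto simp: has_real_derivative_iff_has_vector_derivative[symmetric] intro: has_field_derivative_at_within)
  have "(?h has_integral (G1 r1 - G1 a)) {a..r1}"
    using ord by (intro has_integral_spike_finite[OF _ _ ftc[of a r1 G1 g1], of "{r1}"] G) auto
  moreover have "(?h has_integral (G2 r2 - G2 r1)) {r1..r2}"
    using ord by (intro has_integral_spike_finite[OF _ _ ftc[of r1 r2 G2 g2], of "{r1, r2}"] G) auto
  moreover have "(?h has_integral (G3 b - G3 r2)) {r2..b}"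
    using ord by (intro has_integral_spike_finite[OF _ _ ftc[of r2 b G3 g3], of "{r2}"] G) auto
  ultimately show ?thesis
    using ord by (intro has_integral_combine[of a r2 b] has_integral_combine[of a r1 r2]) auto
qed

lemma lborel_integral_eq_of_has_integral:
  fixes h :: "real \<Rightarrow> real"
  assumes "h \<in> borel_measurable borel" "\<And>x. x \<in> {a..b} \<Longrightarrow> \<bar>h x\<bar> \<le> K" "(h has_integral J) {a..b}"
  shows "integrable lborel (\<lambda>x. indicator {a..b} x * h x)" "(LINT x|lborel. indicator {a..b} x * h x) = J"
proof -
  have int: "integrable lborel (\<lambda>x. indicator {a..b} x *\<^sub>R h x)"
    using assms by (intro integrableI_bounded_set_indicator[where B = K]) (auto simp: emeasure_lborel_Icc_eq)
  then show "integrable lborel (\<lambda>x. indicator {a..b} x * h x)" by simp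
  have "(LINT x : {a..b} | lborel. h x) = integral {a..b} h"
    using int by (intro set_borel_integral_eq_integral) (simp add: set_integrable_def)
  then show "(LINT x|lborel. indicator {a..b} x * h x) = J"
    using assms(3) by (simp add: set_lebesgue_integral_def integral_unique)
qed

context matching
begin

text \<open>The mass of \<open>N / (N + x y)\<^sup>2\<close> on the fibre \<open>0 \<le> y \<le> c\<close> over \<open>x\<close>.\<close>

definition psi :: "real \<Rightarrow> real \<Rightarrow> real" where
  "psi c x = c / (n + c * x)"

lemma psi_measurable [measurable]: "psi c \<in> borel_measurable borel"
  unfolding psi_def[abs_def] by measurable

lemma psi_eq: "c > 0 \<Longrightarrow> psi c x = 1 / (x + n / c)"
  by (simp add: psi_def field_simps)

lemma psi_mono: "0 < c \<Longrightarrow> c \<le> c' \<Longrightarrow> 0 < x \<Longrightarrow> psi c x \<le> psi c' x"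
  using N_pos by (simp add: psi_def divide_simps add_pos_pos) (simp add: algebra_simps)

lemma psi_pullback:
  assumes "u > 0" "c > 0"
  shows "psi c (n / u) * (n / u)\<^sup>2 / n = 1 / u - 1 / (u + c)"
proof -
  have "n + c * (n / u) = n * (u + c) / u" using assms by (simp add: field_simps)
  then have "psi c (n / u) = u * c / (n * (u + c))" by (simp add: psi_def)
  then have "psi c (n / u) * (n / u)\<^sup>2 / n = c / (u * (u + c))"
    using assms N_pos by (simp add: power2_eq_square)
  also have "\<dots> = 1 / u - 1 / (u + c)" using assms by (simp add: field_simps)
  finally show ?thesis .
qed

lemma psi_heights:
  "psi A x = 1 / (x + s + E)" "psi B x = 1 / (x + s + D)" "psi C x = 1 / (x + s + A)"
  "psi D x = 1 / (x + real d + F)" "psi E x = 1 / (x + real d + C)" "psi F x = 1 / (x + real d + B)"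
  using A_pos B_pos C_pos D_pos E_pos F_pos by (simp_all add: psi_eq N_div add.assoc)

end

context matching_alpha
begin

text \<open>The upper and lower boundary of \<open>\<Omega>_\<alpha>\<close>, and the mass of the fibre between them.\<close>

definition "upper_height x = (if x < q then D else if x < p2 then E else F)"
definition "lower_height x = (if x < q2 then A else if x < p then B else C)"
definition "fibre_mass x = psi (upper_height x) x - psi (lower_height x) x"

lemma fibre_mass_measurable [measurable]: "fibre_mass \<in> borel_measurable borel"
proof -
  have "fibre_mass = (\<lambda>x. (if x < q then psi D x else if x < p2 then psi E x else psi F x)
      - (if x < q2 then psi A x else if x < p then psi B x else psi C x))"
    by (auto simp: fibre_mass_def upper_height_def lower_height_def)
  also have "\<dots> \<in> borel_measurable borel" by measurable
  finally show ?thesis .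
qed

lemma branch_in_cylinder:
  assumes y: "\<alpha> < y" "y < \<alpha> + 1" "y \<noteq> p" and k: "int d \<le> k" "k \<le> int (d + i)"
  shows "branch k y \<in> I \<and> dig (branch k y) = k \<longleftrightarrow>
    real d + q \<le> of_int k + y \<and> of_int k + y \<le> s + p"
proof -
  let ?u = "of_int k + y"
  have kr: "real d \<le> of_int k" "of_int k \<le> s" using k by linarith+
  have u: "?u > 0" using kr y a_pos d_real by linarith
  have "branch k y \<in> I \<longleftrightarrow> real d + q \<le> ?u \<and> ?u \<le> s + p"
    using div_ineq(2)[of \<alpha> ?u] div_ineq(1)[of ?u "\<alpha> + 1"] u a_pos
    by (auto simp: I_iff branch_def p_def q_def)
  moreover have "dig (branch k y) = k" if b: "branch k y \<in> I"
  proof -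
    have "branch k y \<noteq> \<alpha>"
    proof
      assume "branch k y = \<alpha>"
      then have e: "?u = s + p" using u a_pos N_pos by (simp add: branch_def p_def field_simps)
      show False
      proof (cases "k = int (d + i)")
        case True
        then show False using e y by simp
      next
        case False
        then have "of_int k \<le> s - 1" using k by linarith
        then show False using e y p_ge_alpha by linarith
      qed
    qed
    then have "branch k y > \<alpha>" using b by (auto simp: I_iff)
    then have "dig (branch k y) = \<lfloor>n / branch k y - \<alpha>\<rfloor>" by (rule dig_regular)
    also have "n / branch k y = ?u" using u N_pos by (simp add: branch_def)
    also have "\<lfloor>?u - \<alpha>\<rfloor> = k" using y by (intro floor_unique) auto
    finally show ?thesis .
  qed
  ultimately show ?thesis by blast
qed

text \<open>Every fraction \<open>psi c\<close> is pulled back to \<open>1 / u - 1 / (u + c)\<close>; the terms \<open>1 / u\<close> of the two boundaries cancel.\<close>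

lemma fibre_mass_pullback:
  assumes "u > 0"
  shows "fibre_mass (n / u) * (n / u)\<^sup>2 / n =
    (if n / q2 < u then 1 / (u + A) else if real d + p2 < u then 1 / (u + B) else 1 / (u + C))
    - (if s + q2 < u then 1 / (u + D) else if n / p2 < u then 1 / (u + E) else 1 / (u + F))"
proof -
  have tb: "upper_height (n / u) > 0" "lower_height (n / u) > 0"
    using A_pos B_pos C_pos D_pos E_pos F_pos by (auto simp: upper_height_def lower_height_def)
  have np: "n / p = real d + p2" and nq: "n / q = s + q2" by (simp_all add: p2_def q2_def)
  have "fibre_mass (n / u) * (n / u)\<^sup>2 / n = psi (upper_height (n / u)) (n / u) * (n / u)\<^sup>2 / n - psi (lower_height (n / u)) (n / u) * (n / u)\<^sup>2 / n"
    by (simp add: fibre_mass_def left_diff_distrib diff_divide_distrib)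
  also have "\<dots> = 1 / (u + lower_height (n / u)) - 1 / (u + upper_height (n / u))"
    unfolding psi_pullback[OF assms tb(1)] psi_pullback[OF assms tb(2)] by simp
  finally show ?thesis
    unfolding upper_height_def lower_height_def div_ineq(3)[OF assms q_pos] div_ineq(3)[OF assms p2_pos]
      div_ineq(3)[OF assms q2_pos] div_ineq(3)[OF assms p_pos] np nq
    by simp
qed

text \<open>Let \<open>a u\<close> be the contribution \<open>1 / (u + A)\<close> or \<open>1 / (u + B)\<close> of the lower boundary, according to the side of \<open>q\<^sub>2\<close> on which the
  branch lies.  Since \<open>E = A + 1\<close>, \<open>F = B + 1\<close>, and by matching the branch with \<open>u\<close> lies right of \<open>p\<^sub>2\<close> iff the
  one with \<open>u + 1\<close> lies right of \<open>q\<^sub>2\<close>, the upper boundary contributes \<open>a (u + 1)\<close>.  So the sum over the full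
  cylinders telescopes, and the first and last cylinder supply the jumps at \<open>p, q, p\<^sub>2, q\<^sub>2\<close>.\<close>

lemma fibre_mass_transfer:
  assumes y: "\<alpha> < y" "y < \<alpha> + 1" "y \<notin> {p, q, p2, q2}"
  shows "(\<Sum>k\<in>dig ` I. if branch k y \<in> I \<and> dig (branch k y) = k
      then fibre_mass (branch k y) * (branch k y)\<^sup>2 / n else 0) = fibre_mass y"
proof -
  define t where "t k = (if branch k y \<in> I \<and> dig (branch k y) = k
      then fibre_mass (branch k y) * (branch k y)\<^sup>2 / n else 0)" for k
  define a where "a u = (if u \<le> n / q2 then 1 / (u + B) else 1 / (u + A))" for u
  have r: "n / q2 = n / p2 + 1" by (rule matching)
  have r1: "real d + 1 + \<alpha> \<le> n / q2"
    using q2_le div_ineq(2)[of "real d + 1 + \<alpha>" q2] q2_pos a_pos d_real by simp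
  have r2: "n / q2 \<le> s + p"
    using q2_ge q2_pos a_pos N_pos by (simp add: p_def divide_left_mono)
  have r3: "n / p2 \<le> s + \<alpha>"
    using p2_ge div_ineq(1)[of p2 "s + \<alpha>"] p2_pos a_pos s_pos by simp
  have r4: "real d + q \<le> n / p2"
    using p2_le p2_pos N_pos a_pos by (simp add: q_def divide_left_mono)
  note bounds = p_ge_alpha q_le_alpha q2_le_alpha p2_ge_alpha p_le q_ge p2_le q2_ge q2_le_p p2_ge_q
  have ty: "y \<noteq> p" "y \<noteq> q" "y \<noteq> p2" "y \<noteq> q2" using y by auto
  have bk: "branch k y = n / (of_int k + y)" for k by (simp add: branch_def)
  have "(\<Sum>k\<in>dig ` I. t k) = (\<Sum>k\<in>{int d..int (d + i)}. t k)"
  proof (rule sum.mono_neutral_left)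
    show "dig ` I \<subseteq> {int d..int (d + i)}" using dig_range by auto
    show "\<forall>k\<in>{int d..int (d + i)} - dig ` I. t k = 0"
      unfolding t_def by (metis DiffD2 imageI)
  qed simp
  also have "{int d..int (d + i)} = int ` {d..d + i}"
    by (simp add: image_int_atLeastAtMost)
  also have "(\<Sum>k\<in>int ` {d..d + i}. t k) = (\<Sum>j\<in>{d..d + i}. t (int j))"
    by (subst sum.reindex) auto
  also have "{d..d + i} = insert d (insert (d + i) {Suc d..<d + i})"
    using i_ge by auto
  also have "(\<Sum>j\<in>insert d (insert (d + i) {Suc d..<d + i}). t (int j))
      = t (int d) + (t (int (d + i)) + (\<Sum>j\<in>{Suc d..<d + i}. t (int j)))"
    using i_ge by simp
  also have "(\<Sum>j\<in>{Suc d..<d + i}. t (int j)) = (\<Sum>j\<in>{Suc d..<d + i}. a (real j + y) - a (real (Suc j) + y))"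
  proof (rule sum.cong[OF refl])
    fix j assume j: "j \<in> {Suc d..<d + i}"
    have jr: "real d + 1 \<le> real j" "real j \<le> s - 1"
    proof -
      have "Suc d \<le> j" "j + 1 \<le> d + i" using j by auto
      then have "real (Suc d) \<le> real j" "real (j + 1) \<le> real (d + i)" by (simp_all only: of_nat_le_iff)
      then show "real d + 1 \<le> real j" "real j \<le> s - 1" by simp_all
    qed
    let ?u = "real j + y"
    have u: "?u > 0" using jr y a_pos d_real by linarith
    have "branch (int j) y \<in> I \<and> dig (branch (int j) y) = int j"
      using j jr y bounds by (subst branch_in_cylinder) auto
    then have "t (int j) = fibre_mass (n / ?u) * (n / ?u)\<^sup>2 / n" by (simp add: t_def bk)
    also have "\<dots> = a ?u - a (real (Suc j) + y)"
    proof -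
      have "real d + p2 < ?u" "\<not> s + q2 < ?u" using jr y bounds by linarith+
      moreover have "n / p2 < ?u \<longleftrightarrow> \<not> real (Suc j) + y \<le> n / q2" using r by auto
      ultimately show ?thesis
        unfolding fibre_mass_pullback[OF u] by (auto simp: a_def E_eq F_eq algebra_simps)
    qed
    finally show "t (int j) = a ?u - a (real (Suc j) + y)" .
  qed
  also have "\<dots> = a (real (Suc d) + y) - a (s + y)"
  proof -
    have "(\<Sum>j\<in>{Suc d..<d + i}. a (real (Suc j) + y) - a (real j + y)) = a (real (d + i) + y) - a (real (Suc d) + y)"
      using i_ge by (intro sum_Suc_diff') auto
    then show ?thesis by (simp add: sum_subtractf)
  qed
  finally have total: "(\<Sum>k\<in>dig ` I. t k) = t (int d) + t (int (d + i)) + (a (real d + 1 + y) - a (s + y))"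
    by (simp add: algebra_simps)
  have "t (int d) + a (real d + 1 + y) = psi (upper_height y) y"
  proof (cases "y < q")
    case True
    then have "t (int d) = 0"
      unfolding t_def using branch_in_cylinder[OF y(1,2) ty(1), of "int d"] by auto
    moreover have "a (real d + 1 + y) = 1 / (y + real d + F)"
      using True r r4 by (simp add: a_def F_eq algebra_simps)
    ultimately show ?thesis using True by (simp add: upper_height_def psi_heights)
  next
    case False
    let ?u = "real d + y"
    have u: "?u > 0" using y a_pos d_real by linarith
    have "branch (int d) y \<in> I \<and> dig (branch (int d) y) = int d"
      using False y bounds i_real by (subst branch_in_cylinder) auto
    then have "t (int d) = fibre_mass (n / ?u) * (n / ?u)\<^sup>2 / n" by (simp add: t_def bk)
    also have "\<dots> = (if p2 < y then 1 / (?u + B) else 1 / (?u + C)) - a (real d + 1 + y)"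
    proof -
      have "\<not> n / q2 < ?u" "\<not> s + q2 < ?u" using r1 y bounds i_real by linarith+
      moreover have "n / p2 < ?u \<longleftrightarrow> \<not> real d + 1 + y \<le> n / q2" using r by auto
      ultimately show ?thesis
        unfolding fibre_mass_pullback[OF u] by (auto simp: a_def E_eq F_eq algebra_simps)
    qed
    finally show ?thesis using False ty by (auto simp: upper_height_def psi_heights algebra_simps)
  qed
  moreover have "t (int (d + i)) - a (s + y) = - psi (lower_height y) y"
  proof (cases "p < y")
    case True
    then have "t (int (d + i)) = 0"
      unfolding t_def using branch_in_cylinder[OF y(1,2) ty(1), of "int (d + i)"] by auto
    moreover have "a (s + y) = 1 / (y + s + A)"
      using True r2 by (simp add: a_def algebra_simps)
    ultimately show ?thesis using True bounds by (simp add: lower_height_def psi_heights)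
  next
    case False
    let ?u = "s + y"
    have u: "?u > 0" using y a_pos s_pos by linarith
    have "branch (int (d + i)) y \<in> I \<and> dig (branch (int (d + i)) y) = int (d + i)"
      using False y bounds i_real by (subst branch_in_cylinder) auto
    then have "t (int (d + i)) = fibre_mass (n / ?u) * (n / ?u)\<^sup>2 / n" by (simp add: t_def bk)
    also have "\<dots> = a ?u - (if q2 < y then 1 / (?u + D) else 1 / (?u + E))"
    proof -
      have "real d + p2 < ?u" "n / p2 < ?u" using r3 y bounds i_real by linarith+
      then show ?thesis
        unfolding fibre_mass_pullback[OF u] by (auto simp: a_def)
    qed
    finally show ?thesis using False ty by (auto simp: lower_height_def psi_heights algebra_simps)
  qed
  ultimately have "(\<Sum>k\<in>dig ` I. t k) = fibre_mass y"
    unfolding total fibre_mass_def by linarith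
  then show ?thesis by (simp add: t_def)
qed

definition "fibre_mass_min = n * (D - C) / ((n + D * (\<alpha> + 1)) * (n + C * (\<alpha> + 1)))"

lemma fibre_mass_min_pos: "fibre_mass_min > 0"
  unfolding fibre_mass_min_def using N_pos C_lt_D C_pos D_pos a_pos
  by (intro divide_pos_pos mult_pos_pos) (auto intro!: add_pos_pos)

lemma fibre_mass_bounds:
  assumes x: "x \<in> I"
  shows "fibre_mass_min \<le> fibre_mass x" "fibre_mass x \<le> F / n"
proof -
  have xp: "x > 0" "x \<le> \<alpha> + 1" using x I_pos by (auto simp: I_iff)
  have t: "D \<le> upper_height x" "upper_height x \<le> F" "A \<le> lower_height x" "lower_height x \<le> C"
    using D_lt_E E_lt_F A_lt_B B_lt_C by (auto simp: upper_height_def lower_height_def)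
  have "psi D x \<le> psi (upper_height x) x" "psi (upper_height x) x \<le> psi F x" "psi (lower_height x) x \<le> psi C x"
    using t A_pos D_pos xp by (auto intro!: psi_mono)
  moreover have "psi (lower_height x) x \<ge> 0" using t A_pos xp N_pos by (simp add: psi_def)
  ultimately have 1: "psi D x - psi C x \<le> fibre_mass x" and 2: "fibre_mass x \<le> psi F x"
    unfolding fibre_mass_def by linarith+
  have pos: "n + D * x > 0" "n + C * x > 0" using xp N_pos C_pos D_pos by (auto intro!: add_pos_pos)
  have "fibre_mass_min \<le> n * (D - C) / ((n + D * x) * (n + C * x))"
    unfolding fibre_mass_min_def using pos xp N_pos C_pos D_pos C_lt_D
    by (intro divide_left_mono mult_mono mult_pos_pos mult_nonneg_nonneg) (auto intro!: add_pos_pos add_nonneg_nonneg)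
  also have "\<dots> = psi D x - psi C x"
    using pos by (simp add: psi_def divide_simps) (simp add: algebra_simps)
  finally show "fibre_mass_min \<le> fibre_mass x" using 1 by linarith
  have "psi F x \<le> F / n" unfolding psi_def
    using xp N_pos F_pos by (intro divide_left_mono mult_pos_pos) (auto intro!: add_pos_pos)
  then show "fibre_mass x \<le> F / n" using 2 by linarith
qed

text \<open>Stated for a weight \<open>w\<close>, because both the total mass (\<open>w = 1\<close>) and the integral of the logarithm are needed.\<close>

lemma fibre_mass_piecewise_has_integral:
  assumes G: "\<And>c x. c > 0 \<Longrightarrow> x \<in> {\<alpha>..\<alpha> + 1} \<Longrightarrow> (G c has_real_derivative w x * psi c x) (at x)"
  shows "((\<lambda>x. w x * fibre_mass x) has_integral
    ((G D q - G D \<alpha>) + (G E p2 - G E q) + (G F (\<alpha> + 1) - G F p2))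
    - ((G A q2 - G A \<alpha>) + (G B p - G B q2) + (G C (\<alpha> + 1) - G C p))) {\<alpha>..\<alpha> + 1}"
proof -
  have "((\<lambda>x. (if x < q then w x * psi D x else if x < p2 then w x * psi E x else w x * psi F x)
      - (if x < q2 then w x * psi A x else if x < p then w x * psi B x else w x * psi C x)) has_integral
    ((G D q - G D \<alpha>) + (G E p2 - G E q) + (G F (\<alpha> + 1) - G F p2))
    - ((G A q2 - G A \<alpha>) + (G B p - G B q2) + (G C (\<alpha> + 1) - G C p))) {\<alpha>..\<alpha> + 1}"
    using q_ge p2_ge_q p2_le q2_ge q2_le_p p_le A_pos B_pos C_pos D_pos E_pos F_pos
    by (intro has_integral_diff piecewise_has_integral G)
  also have "(\<lambda>x. (if x < q then w x * psi D x else if x < p2 then w x * psi E x else w x * psi F x)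
      - (if x < q2 then w x * psi A x else if x < p then w x * psi B x else w x * psi C x)) = (\<lambda>x. w x * fibre_mass x)"
    by (auto simp: fun_eq_iff fibre_mass_def upper_height_def lower_height_def right_diff_distrib)
  finally show ?thesis .
qed

text \<open>Moves a logarithm along one step of the orbit and one transition of the heights: the rule by which the
  total mass is computed.\<close>

lemma ln_height:
  assumes "c > 0" "z > 0" "n / z = u" "u + c > 0"
  shows "ln (z + n / c) = ln (u + c) + ln z - ln c"
proof -
  have "z + n / c = (u + c) * z / c" using assms(1,2) by (simp add: assms(3)[symmetric] field_simps)
  then show ?thesis using assms by (simp add: ln_mult ln_div)
qed

text \<open>All logarithms are pushed along the two orbits back to \<open>\<alpha>\<close> and \<open>\<alpha> + 1\<close>, where they cancel and
  leave only the logarithms of the heights.\<close>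

lemma fibre_mass_has_integral: "(fibre_mass has_integral Z) {\<alpha>..\<alpha> + 1}"
proof -
  define L where "L c x = ln (x + n / c)" for c x :: real
  have "((\<lambda>x. 1 * fibre_mass x) has_integral
    ((L D q - L D \<alpha>) + (L E p2 - L E q) + (L F (\<alpha> + 1) - L F p2))
    - ((L A q2 - L A \<alpha>) + (L B p - L B q2) + (L C (\<alpha> + 1) - L C p))) {\<alpha>..\<alpha> + 1}"
  proof (rule fibre_mass_piecewise_has_integral)
    fix c x :: real assume c: "c > 0" and x: "x \<in> {\<alpha>..\<alpha> + 1}"
    have "x + n / c > 0" using c x a_pos N_pos by (intro add_pos_pos divide_pos_pos) auto
    then show "(L c has_real_derivative 1 * psi c x) (at x)"
      unfolding L_def[abs_def] psi_eq[OF c] by (auto intro!: derivative_eq_intros)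
  qed
  also have "((L D q - L D \<alpha>) + (L E p2 - L E q) + (L F (\<alpha> + 1) - L F p2))
    - ((L A q2 - L A \<alpha>) + (L B p - L B q2) + (L C (\<alpha> + 1) - L C p)) = Z"
  proof -
    have a1: "\<alpha> + 1 > 0" using a_pos by simp
    have nz: "n / \<alpha> = s + p" "n / (\<alpha> + 1) = real d + q" "n / p = real d + p2" "n / q = s + q2"
      by (simp_all add: p_def q_def p2_def q2_def)
    note pos = A_pos B_pos C_pos D_pos E_pos F_pos a_pos p_pos q_pos p2_pos q2_pos s_pos(1) d_real
    \<comment> \<open>the reciprocals \<open>n / c\<close> of the heights, expressed by the next height and digit\<close>
    have LA: "L A x = ln (s + x + E)" and LB: "L B x = ln (s + x + D)" and LC: "L C x = ln (s + x + A)"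
      and LD: "L D x = ln (real d + x + F)" and LE: "L E x = ln (real d + x + C)"
      and LF: "L F x = ln (real d + x + B)" for x
      by (simp_all add: L_def N_div algebra_simps)
    have 1: "L F (\<alpha> + 1) = L D \<alpha>" "L C (\<alpha> + 1) = L A \<alpha>"
      unfolding LF LD LC LA by (simp_all add: E_eq F_eq algebra_simps)
    have step: "ln (real d + p2 + c) = L c p - ln p + ln c" "ln (s + q2 + c) = L c q - ln q + ln c"
      "ln (s + p + c) = L c \<alpha> - ln \<alpha> + ln c" "ln (real d + q + c) = L c (\<alpha> + 1) - ln (\<alpha> + 1) + ln c"
      if "c > 0" for c
      using ln_height[OF that p_pos nz(3)] ln_height[OF that q_pos nz(4)] ln_height[OF that a_pos nz(1)]
        ln_height[OF that a1 nz(2)] that pos by (auto simp: L_def)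
    have 2: "L F p2 = L B p - ln p + ln B" "L E p2 = L C p - ln p + ln C"
      "L A q2 = L E q - ln q + ln E" "L B q2 = L D q - ln q + ln D"
      unfolding LF LE[of p2] LA[of q2] LB[of q2] using step(1)[OF B_pos] step(1)[OF C_pos] step(2)[OF E_pos] step(2)[OF D_pos]
      by auto
    have 3: "L B p = L D \<alpha> - ln \<alpha> + ln D" "L C p = L A \<alpha> - ln \<alpha> + ln A"
      unfolding LB[of p] LC[of p] using step(3)[OF D_pos] step(3)[OF A_pos] by auto
    have 4: "L D q = L F (\<alpha> + 1) - ln (\<alpha> + 1) + ln F" "L E q = L C (\<alpha> + 1) - ln (\<alpha> + 1) + ln C"
      unfolding LD[of q] LE[of q] using step(4)[OF F_pos] step(4)[OF C_pos] by auto
    show ?thesis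
      unfolding Z_eq using 1 2 3 4 by linarith
  qed
  finally show ?thesis by simp
qed

lemma Z_pos: "Z > 0"
proof -
  have "((\<lambda>_. fibre_mass_min) has_integral fibre_mass_min * (\<alpha> + 1 - \<alpha>)) {\<alpha>..\<alpha> + 1}"
    using has_integral_const_real[of fibre_mass_min \<alpha> "\<alpha> + 1"] by simp
  then have "fibre_mass_min * (\<alpha> + 1 - \<alpha>) \<le> Z"
    using fibre_mass_bounds(1) by (intro has_integral_le[OF _ fibre_mass_has_integral]) (auto simp: I_iff)
  then show ?thesis using fibre_mass_min_pos by simp
qed

lemma AE_not_finite: "finite S \<Longrightarrow> AE y in lborel. (y::real) \<notin> S"
  by (intro AE_not_in finite_imp_null_set_lborel)

sublocale nexp_density N \<alpha> "\<lambda>x. inverse Z * fibre_mass x" "inverse Z * fibre_mass_min" "inverse Z * (F / n)"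
proof
  show "(\<lambda>x. inverse Z * fibre_mass x) \<in> borel_measurable borel" by measurable
  show "0 < inverse Z * fibre_mass_min" using Z_pos fibre_mass_min_pos by simp
  show "inverse Z * fibre_mass_min \<le> inverse Z * fibre_mass x" if "x \<in> I" for x
    using fibre_mass_bounds(1)[OF that] Z_pos by (intro mult_left_mono) auto
  show "inverse Z * fibre_mass x \<le> inverse Z * (F / n)" if "x \<in> I" for x
    using fibre_mass_bounds(2)[OF that] Z_pos by (intro mult_left_mono) auto
  have bd: "\<bar>fibre_mass x\<bar> \<le> F / n" if "x \<in> {\<alpha>..\<alpha> + 1}" for x
    using fibre_mass_bounds[of x] fibre_mass_min_pos that by (auto simp: I_iff)
  note int = lborel_integral_eq_of_has_integral[OF fibre_mass_measurable bd fibre_mass_has_integral]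
  have "(\<integral>\<^sup>+x. ennreal (inverse Z * fibre_mass x) * indicator I x \<partial>lborel)
      = (\<integral>\<^sup>+x. ennreal (inverse Z * (indicator {\<alpha>..\<alpha> + 1} x * fibre_mass x)) \<partial>lborel)"
    by (intro nn_integral_cong) (auto simp: indicator_def I_alpha_def)
  also have "\<dots> = ennreal (LINT x|lborel. inverse Z * (indicator {\<alpha>..\<alpha> + 1} x * fibre_mass x))"
  proof (rule nn_integral_eq_integral)
    show "AE x in lborel. 0 \<le> inverse Z * (indicator {\<alpha>..\<alpha> + 1} x * fibre_mass x)"
    proof (intro AE_I2)
      fix x
      show "0 \<le> inverse Z * (indicator {\<alpha>..\<alpha> + 1} x * fibre_mass x)"
      proof (cases "x \<in> {\<alpha>..\<alpha> + 1}")
        case True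
        then have "0 \<le> fibre_mass x" using fibre_mass_bounds(1)[of x] fibre_mass_min_pos by (simp add: I_iff)
        then show ?thesis using Z_pos by simp
      qed simp
    qed
  qed (use int(1) in simp)
  also have "\<dots> = 1" using int(2) Z_pos by simp
  finally show "(\<integral>\<^sup>+x. ennreal (inverse Z * fibre_mass x) * indicator I x \<partial>lborel) = 1" .
  have "AE y in lborel. y \<notin> {\<alpha>, \<alpha> + 1, p, q, p2, q2}" by (rule AE_not_finite) simp
  then show "AE y in lborel. y \<in> I \<longrightarrow>
      (\<Sum>k\<in>dig ` I. if branch k y \<in> I \<and> dig (branch k y) = k
         then inverse Z * fibre_mass (branch k y) * (branch k y)\<^sup>2 / real N else 0) = inverse Z * fibre_mass y"
  proof eventually_elim
    case (elim y)
    show ?case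
    proof
      assume "y \<in> I"
      then have y: "\<alpha> < y" "y < \<alpha> + 1" "y \<notin> {p, q, p2, q2}" using elim by (auto simp: I_iff)
      have "(\<Sum>k\<in>dig ` I. if branch k y \<in> I \<and> dig (branch k y) = k
         then inverse Z * fibre_mass (branch k y) * (branch k y)\<^sup>2 / real N else 0)
        = inverse Z * (\<Sum>k\<in>dig ` I. if branch k y \<in> I \<and> dig (branch k y) = k
         then fibre_mass (branch k y) * (branch k y)\<^sup>2 / real N else 0)"
        unfolding sum_distrib_left by (intro sum.cong) auto
      then show "(\<Sum>k\<in>dig ` I. if branch k y \<in> I \<and> dig (branch k y) = k
         then inverse Z * fibre_mass (branch k y) * (branch k y)\<^sup>2 / real N else 0) = inverse Z * fibre_mass y"
        unfolding fibre_mass_transfer[OF y] .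
    qed
  qed
qed

end

section \<open>The integral of the logarithm\<close>

text \<open>The integrand of the dilogarithm has the value \<open>0\<close> at \<open>0\<close>, where division by zero yields zero; the continuous
  extension has the value \<open>- 1\<close>.\<close>

lemma dilog_integrand_continuous:
  fixes h :: "real \<Rightarrow> real"
  defines "h \<equiv> \<lambda>t. if t = 0 then - 1 else ln (1 - t) / t"
  assumes "t < 1"
  shows "isCont h t"
proof (cases "t = 0")
  case True
  have "((\<lambda>t::real. ln (1 - t)) has_real_derivative - 1) (at 0)"
    by (auto intro!: derivative_eq_intros)
  then have "((\<lambda>t::real. ln (1 - t) / t) \<longlongrightarrow> - 1) (at 0)"
    by (simp add: has_field_derivative_iff)
  then have "(h \<longlongrightarrow> - 1) (at 0)"
    by (rule Lim_transform_eventually) (auto simp: h_def eventually_at_filter)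
  then show ?thesis using True by (simp add: isCont_def h_def)
next
  case False
  have "isCont (\<lambda>t::real. ln (1 - t) / t) t" using False assms(2) by (intro continuous_intros) auto
  moreover have "eventually (\<lambda>u. h u = ln (1 - u) / u) (nhds t)"
    using False by (auto simp: h_def intro: eventually_mono[OF t1_space_nhds])
  ultimately show ?thesis using isCont_cong by metis
qed

lemma Li2_has_real_derivative:
  assumes z: "z < 0"
  shows "(Li2 has_real_derivative - ln (1 - z) / z) (at z)"
proof -
  define h :: "real \<Rightarrow> real" where "h = (\<lambda>t. if t = 0 then - 1 else ln (1 - t) / t)"
  have cont: "continuous_on {a..0} h" for a
    unfolding h_def by (intro continuous_at_imp_continuous_on ballI dilog_integrand_continuous) auto
  have Li2_eq: "Li2 y = integral {y..0} h" if y: "y < 0" for y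
  proof -
    have "Li2 y = (LBINT t=ereal y..ereal 0. h t)"
      unfolding Li2_def
      by (intro interval_integral_cong) (use y in \<open>auto simp: h_def einterval_def min_def max_def\<close>)
    also have "\<dots> = integral {y..0} h"
      using y by (intro interval_integral_eq_integral borel_integrable_atLeastAtMost' cont) auto
    finally show ?thesis .
  qed
  have "((\<lambda>x. integral {x..0} h) has_real_derivative - h z) (at z within {z - 1..0})"
    using z by (intro integral_has_real_derivative' cont) auto
  moreover have "at z within {z - 1..0} = at z"
    using z by (intro at_within_interior) (simp add: interior_atLeastAtMost_real)
  ultimately have "((\<lambda>x. integral {x..0} h) has_real_derivative - h z) (at z)"
    by (simp only:)
  then have "(Li2 has_real_derivative - h z) (at z)"
    by (rule has_field_derivative_transform_within_open[where S = "{..<0}"]) (use z Li2_eq in auto)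
  then show ?thesis using z by (simp add: h_def)
qed

context matching
begin

text \<open>The primitive of \<open>ln x * psi c x\<close> that occurs in the entropy formula.\<close>

definition dilog_prim :: "real \<Rightarrow> real \<Rightarrow> real" where
  "dilog_prim c x = Li2 (- (c * x / n)) + ln x * ln (c * x / n + 1)"

lemma dilog_prim_derivative:
  assumes c: "c > 0" and x: "x > 0"
  shows "(dilog_prim c has_real_derivative ln x * psi c x) (at x)"
proof -
  let ?z = "- (c * x / n)"
  have z: "?z < 0" using assms N_pos by simp
  have lin: "((\<lambda>x. - (c * x / n)) has_real_derivative - (c / n)) (at x)"
    using N_pos by (auto intro!: derivative_eq_intros)
  have d1: "((\<lambda>x. Li2 (- (c * x / n))) has_real_derivative (- ln (1 - ?z) / ?z) * - (c / n)) (at x)"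
    by (rule DERIV_chain2[OF Li2_has_real_derivative[OF z] lin])
  have e1: "(- ln (1 - ?z) / ?z) * - (c / n) = - ln (c * x / n + 1) / x"
    using assms N_pos by (simp add: add.commute)
  have d2: "((\<lambda>x. ln x * ln (c * x / n + 1)) has_real_derivative
      ln (c * x / n + 1) / x + ln x * ((c / n) / (c * x / n + 1))) (at x)"
  proof -
    have "c * x / n + 1 > 0" using assms N_pos by (intro add_nonneg_pos) auto
    then show ?thesis using x N_pos by (auto intro!: derivative_eq_intros simp: mult_ac)
  qed
  have e2: "(c / n) / (c * x / n + 1) = psi c x"
  proof -
    have "c * x / n + 1 = (n + c * x) / n" using N_pos by (simp add: field_simps)
    then show ?thesis using N_pos by (simp add: psi_def)
  qed
  have "(dilog_prim c has_real_derivative (- ln (1 - ?z) / ?z) * - (c / n)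
      + (ln (c * x / n + 1) / x + ln x * ((c / n) / (c * x / n + 1)))) (at x)"
    unfolding dilog_prim_def[abs_def] by (rule DERIV_add[OF d1 d2])
  then show ?thesis unfolding e1 e2 by simp
qed

text \<open>The orbits of the endpoints as functions of the parameter.\<close>

definition "p_fun \<alpha> = n / \<alpha> - s"
definition "q_fun \<alpha> = n / (\<alpha> + 1) - real d"
definition "p2_fun \<alpha> = n / p_fun \<alpha> - real d"
definition "q2_fun \<alpha> = n / q_fun \<alpha> - s"

text \<open>\<open>Z \<integral> ln x d\<mu>_\<alpha>\<close>, integrated over the pieces between the jumps of the density.\<close>

definition log_moment :: "real \<Rightarrow> real" where
  "log_moment \<alpha> =
    ((dilog_prim D (q_fun \<alpha>) - dilog_prim D \<alpha>) + (dilog_prim E (p2_fun \<alpha>) - dilog_prim E (q_fun \<alpha>))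
      + (dilog_prim F (\<alpha> + 1) - dilog_prim F (p2_fun \<alpha>)))
    - ((dilog_prim A (q2_fun \<alpha>) - dilog_prim A \<alpha>) + (dilog_prim B (p_fun \<alpha>) - dilog_prim B (q2_fun \<alpha>))
      + (dilog_prim C (\<alpha> + 1) - dilog_prim C (p_fun \<alpha>)))"

text \<open>The weight of a jump of the density, times the speed at which the jump moves with \<open>\<alpha>\<close>, does not change along
  the orbit: for the two heights on both sides of the jump, the terms \<open>1 / z\<close> cancel.\<close>

lemma psi_flow:
  assumes "z > 0" "c > 0"
  shows "1 / (n / z + c) * (n / z\<^sup>2) = 1 / z - psi c z"
proof -
  have "n + c * z > 0" using assms N_pos by (intro add_pos_pos) auto
  moreover have "n / z + c = (n + c * z) / z" using assms by (simp add: field_simps)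
  ultimately show ?thesis using assms
    by (simp add: psi_def power2_eq_square field_simps)
qed

end

context matching_alpha
begin

lemma orbit_funs: "p_fun \<alpha> = p" "q_fun \<alpha> = q" "p2_fun \<alpha> = p2" "q2_fun \<alpha> = q2"
  by (simp_all add: p_fun_def q_fun_def p2_fun_def q2_fun_def p_def q_def p2_def q2_def)

text \<open>Both endpoints send the same weight \<open>m\<close> along their orbits, with opposite signs, so the derivative
  is \<open>m\<close> times the logarithm of the quotient of \<open>(\<alpha> + 1) q q\<^sub>2\<close> and \<open>\<alpha> p p\<^sub>2\<close>.\<close>

lemma log_moment_derivative: "(log_moment has_real_derivative 0) (at \<alpha>)"
proof -
  define q' where "q' = - (n / (\<alpha> + 1)\<^sup>2)"
  define q2' where "q2' = - (n / q\<^sup>2) * q'"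
  define p' where "p' = - (n / \<alpha>\<^sup>2)"
  define p2' where "p2' = - (n / p\<^sup>2) * p'"
  have a1: "\<alpha> + 1 > 0" using a_pos by simp
  note pos = a_pos a1 p_pos q_pos p2_pos q2_pos A_pos B_pos C_pos D_pos E_pos F_pos
  have dq: "(q_fun has_real_derivative q') (at \<alpha>)"
    unfolding q_fun_def[abs_def] q'_def using a1
    by (auto intro!: derivative_eq_intros simp: power2_eq_square)
  have dp: "(p_fun has_real_derivative p') (at \<alpha>)"
    unfolding p_fun_def[abs_def] p'_def using a_pos
    by (auto intro!: derivative_eq_intros simp: power2_eq_square)
  have dq2: "(q2_fun has_real_derivative q2') (at \<alpha>)"
    unfolding q2_fun_def[abs_def] q2'_def using q_pos dq
    by (auto intro!: derivative_eq_intros simp: power2_eq_square orbit_funs)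
  have dp2: "(p2_fun has_real_derivative p2') (at \<alpha>)"
    unfolding p2_fun_def[abs_def] p2'_def using p_pos dp
    by (auto intro!: derivative_eq_intros simp: power2_eq_square orbit_funs)
  have chain: "((\<lambda>x. dilog_prim c (g x)) has_real_derivative (ln (g \<alpha>) * psi c (g \<alpha>)) * g') (at \<alpha>)"
    if "c > 0" "g \<alpha> > 0" "(g has_real_derivative g') (at \<alpha>)" for c g g'
    by (rule DERIV_chain2[OF dilog_prim_derivative[OF that(1,2)] that(3)])
  have d1: "((\<lambda>x. x + 1) has_real_derivative 1) (at \<alpha>)" by (auto intro!: derivative_eq_intros)
  have d0: "((\<lambda>x. x) has_real_derivative 1) (at \<alpha>)" by (auto intro!: derivative_eq_intros)
  have gpos: "p_fun \<alpha> > 0" "q_fun \<alpha> > 0" "p2_fun \<alpha> > 0" "q2_fun \<alpha> > 0"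
    using pos by (simp_all add: orbit_funs)
  let ?W = "(((ln q * psi D q) * q' - (ln \<alpha> * psi D \<alpha>) * 1) + ((ln p2 * psi E p2) * p2' - (ln q * psi E q) * q')
      + ((ln (\<alpha> + 1) * psi F (\<alpha> + 1)) * 1 - (ln p2 * psi F p2) * p2'))
    - (((ln q2 * psi A q2) * q2' - (ln \<alpha> * psi A \<alpha>) * 1) + ((ln p * psi B p) * p' - (ln q2 * psi B q2) * q2')
      + ((ln (\<alpha> + 1) * psi C (\<alpha> + 1)) * 1 - (ln p * psi C p) * p'))"
  have "(log_moment has_real_derivative ?W) (at \<alpha>)"
    unfolding log_moment_def[abs_def]
    by (intro DERIV_diff DERIV_add chain[of _ q_fun, unfolded orbit_funs] chain[of _ p_fun, unfolded orbit_funs]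
        chain[of _ p2_fun, unfolded orbit_funs] chain[of _ q2_fun, unfolded orbit_funs]
        chain[of _ "\<lambda>x. x + 1"] chain[of _ "\<lambda>x. x"] dq dp dq2 dp2 d1 d0 pos)
  moreover have "?W = 0"
  proof -
    define m where "m = psi F (\<alpha> + 1) - psi C (\<alpha> + 1)"
    have n0: "psi D \<alpha> - psi A \<alpha> = m"
      unfolding m_def psi_heights by (simp add: E_eq F_eq algebra_simps)
    have nz: "n / \<alpha> = s + p" "n / (\<alpha> + 1) = real d + q" "n / p = real d + p2" "n / q = s + q2"
      by (simp_all add: p_def q_def p2_def q2_def)
    have mq: "(psi D q - psi E q) * q' = m"
    proof -
      have "psi D q = 1 / (n / (\<alpha> + 1) + F)" "psi E q = 1 / (n / (\<alpha> + 1) + C)"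
        unfolding nz by (simp_all add: psi_heights algebra_simps)
      then have "(psi D q - psi E q) * q' = 1 / (n / (\<alpha> + 1) + C) * (n / (\<alpha> + 1)\<^sup>2) - 1 / (n / (\<alpha> + 1) + F) * (n / (\<alpha> + 1)\<^sup>2)"
        unfolding q'_def by (simp only: left_diff_distrib mult_minus_right)
      then show ?thesis unfolding psi_flow[OF a1 C_pos] psi_flow[OF a1 F_pos] m_def by simp
    qed
    have mq2: "(psi B q2 - psi A q2) * q2' = m"
    proof -
      have "psi B q2 = 1 / (n / q + D)" "psi A q2 = 1 / (n / q + E)"
        unfolding nz by (simp_all add: psi_heights algebra_simps)
      then have "(psi B q2 - psi A q2) * q2' = (1 / (n / q + E) * (n / q\<^sup>2) - 1 / (n / q + D) * (n / q\<^sup>2)) * q'"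
        unfolding q2'_def by (simp only: left_diff_distrib mult_minus_right mult_minus_left mult.assoc)
      then show ?thesis unfolding psi_flow[OF q_pos E_pos] psi_flow[OF q_pos D_pos] using mq by simp
    qed
    have mp: "(psi B p - psi C p) * p' = m"
    proof -
      have "psi B p = 1 / (n / \<alpha> + D)" "psi C p = 1 / (n / \<alpha> + A)"
        unfolding nz by (simp_all add: psi_heights algebra_simps)
      then have "(psi B p - psi C p) * p' = 1 / (n / \<alpha> + A) * (n / \<alpha>\<^sup>2) - 1 / (n / \<alpha> + D) * (n / \<alpha>\<^sup>2)"
        unfolding p'_def by (simp only: left_diff_distrib mult_minus_right)
      then show ?thesis unfolding psi_flow[OF a_pos A_pos] psi_flow[OF a_pos D_pos] using n0 by simp
    qed
    have mp2: "(psi F p2 - psi E p2) * p2' = m"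
    proof -
      have "psi F p2 = 1 / (n / p + B)" "psi E p2 = 1 / (n / p + C)"
        unfolding nz by (simp_all add: psi_heights algebra_simps)
      then have "(psi F p2 - psi E p2) * p2' = (1 / (n / p + C) * (n / p\<^sup>2) - 1 / (n / p + B) * (n / p\<^sup>2)) * p'"
        unfolding p2'_def by (simp only: left_diff_distrib mult_minus_right mult_minus_left mult.assoc)
      then show ?thesis unfolding psi_flow[OF p_pos C_pos] psi_flow[OF p_pos B_pos] using mp by simp
    qed
    have "?W = ln q * ((psi D q - psi E q) * q') + ln q2 * ((psi B q2 - psi A q2) * q2')
        + ln (\<alpha> + 1) * (psi F (\<alpha> + 1) - psi C (\<alpha> + 1))
        - (ln \<alpha> * (psi D \<alpha> - psi A \<alpha>) + ln p * ((psi B p - psi C p) * p') + ln p2 * ((psi F p2 - psi E p2) * p2'))"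
      by (simp add: algebra_simps)
    also have "\<dots> = m * (ln (\<alpha> + 1) + ln q + ln q2 - (ln \<alpha> + ln p + ln p2))"
      unfolding mq mq2 mp mp2 n0 m_def[symmetric] by (simp add: algebra_simps)
    also have "ln (\<alpha> + 1) + ln q + ln q2 = ln ((\<alpha> + 1) * q * q2)"
      using pos by (simp add: ln_mult)
    also have "ln \<alpha> + ln p + ln p2 = ln (\<alpha> * p * p2)"
      using pos by (simp add: ln_mult)
    finally show ?thesis by (simp add: orbit_product)
  qed
  ultimately show ?thesis by simp
qed

lemma log_moment_eq: "(LINT x|\<mu>. ln x) = inverse Z * log_moment \<alpha>"
proof -
  have hi: "((\<lambda>x. ln x * fibre_mass x) has_integral log_moment \<alpha>) {\<alpha>..\<alpha> + 1}"
    unfolding log_moment_def orbit_funs using a_pos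
    by (intro fibre_mass_piecewise_has_integral dilog_prim_derivative) auto
  have bd: "\<bar>ln x * fibre_mass x\<bar> \<le> (\<bar>ln \<alpha>\<bar> + \<bar>ln (\<alpha> + 1)\<bar>) * (F / n)" if "x \<in> {\<alpha>..\<alpha> + 1}" for x
  proof -
    have "ln \<alpha> \<le> ln x" "ln x \<le> ln (\<alpha> + 1)" using that a_pos by auto
    then have "\<bar>ln x\<bar> \<le> \<bar>ln \<alpha>\<bar> + \<bar>ln (\<alpha> + 1)\<bar>" by linarith
    moreover have "\<bar>fibre_mass x\<bar> \<le> F / n"
      using fibre_mass_bounds[of x] fibre_mass_min_pos that by (auto simp: I_iff)
    ultimately show ?thesis unfolding abs_mult by (intro mult_mono) auto
  qed
  have m: "(\<lambda>x. ln x * fibre_mass x) \<in> borel_measurable borel" by measurable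
  have g0: "0 \<le> fibre_mass x" if "x \<in> I" for x
    using fibre_mass_bounds(1)[OF that] fibre_mass_min_pos by simp
  have "(LINT x|\<mu>. ln x) = (LINT x|restrict_space lborel I. (inverse Z * fibre_mass x) *\<^sub>R ln x)"
    unfolding \<mu>_def
  proof (rule integral_density)
    show "AE x in restrict_space lborel I. 0 \<le> inverse Z * fibre_mass x"
      using g0 Z_pos by (intro AE_I2) (simp add: space_restrict_space)
  qed (auto intro!: measurable_restrict_space1)
  also have "\<dots> = (LINT x|lborel. indicator I x *\<^sub>R ((inverse Z * fibre_mass x) *\<^sub>R ln x))"
    by (rule integral_restrict_space) simp
  also have "\<dots> = (LINT x|lborel. inverse Z * (indicator {\<alpha>..\<alpha> + 1} x * (ln x * fibre_mass x)))"
    by (intro Bochner_Integration.integral_cong) (auto simp: I_alpha_def indicator_def)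
  also have "\<dots> = inverse Z * log_moment \<alpha>"
    using lborel_integral_eq_of_has_integral(2)[OF m bd hi] by simp
  finally show ?thesis .
qed

lemma entropy_T_log_moment: "entropy_T N \<alpha> = ereal (ln n - 2 * inverse Z * log_moment \<alpha>)"
proof -
  have int: "integrable \<mu> ln"
  proof (rule integrable_bounded_mu)
    fix x assume "x \<in> I"
    then have "ln \<alpha> \<le> ln x" "ln x \<le> ln (\<alpha> + 1)" using a_pos by (auto simp: I_iff)
    then show "\<bar>ln x\<bar> \<le> \<bar>ln \<alpha>\<bar> + \<bar>ln (\<alpha> + 1)\<bar>" by linarith
  qed measurable
  have "rokhlin_integral = (LINT x|\<mu>. ln n - 2 * ln x)"
    unfolding rokhlin_integral_def
  proof (rule Bochner_Integration.integral_cong[OF refl])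
    fix x assume "x \<in> space \<mu>"
    then have "x > 0" using I_pos by simp
    then show "ln (n / x\<^sup>2) = ln n - 2 * ln x" using N_pos by (simp add: ln_div ln_realpow)
  qed
  also have "\<dots> = ln n - 2 * (LINT x|\<mu>. ln x)"
    using int prob_space by simp
  finally show ?thesis unfolding entropy_T_eq log_moment_eq by simp
qed

end

context matching
begin

lemma log_moment_constant:
  assumes "\<alpha> \<in> {A..B}"
  shows "log_moment \<alpha> = log_moment B"
proof -
  have "(log_moment has_real_derivative 0) (at x within {A..B})" if "x \<in> {A..B}" for x
  proof -
    interpret matching_alpha N d i x using that by unfold_locales auto
    show ?thesis by (rule has_field_derivative_at_within[OF log_moment_derivative])
  qed
  then have "\<exists>c. \<forall>x\<in>{A..B}. log_moment x = c"
    by (intro has_field_derivative_zero_constant) auto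
  then show ?thesis using assms A_lt_B by auto
qed

text \<open>At \<open>\<alpha> = B\<close> the point \<open>\<alpha> + 1\<close> is mapped to \<open>\<alpha>\<close>, and \<open>p = q\<^sub>2 = D\<close>, \<open>p\<^sub>2 = \<alpha> + 1\<close>: three of the six pieces are
  empty.\<close>

lemma log_moment_B:
  "log_moment B = (dilog_prim E (B + 1) - dilog_prim E B) - (dilog_prim A D - dilog_prim A B)
     - (dilog_prim C (B + 1) - dilog_prim C D)"
proof -
  have 1: "p_fun B = D" by (simp add: p_fun_def N_div)
  have 2: "q_fun B = B" using N_div(6) by (simp add: q_fun_def F_eq)
  have "p2_fun B = B + 1" by (simp add: p2_fun_def 1 N_div F_eq)
  moreover have "q2_fun B = D" by (simp add: q2_fun_def 2 N_div)
  ultimately show ?thesis by (simp add: log_moment_def 1 2)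
qed

lemma entropy_T_formula:
  assumes "\<alpha> \<in> {A..B}"
  shows "entropy_T N \<alpha> = ereal (ln n - 2 * inverse Z * log_moment B)"
proof -
  interpret matching_alpha N d i \<alpha> using assms by unfold_locales auto
  show ?thesis using entropy_T_log_moment log_moment_constant[OF assms] by simp
qed

end

context nexp
begin

section \<open>The parameter interval\<close>

lemma dig_le_left:
  assumes "x \<in> I"
  shows "dig x \<le> dig \<alpha>"
proof (cases "x = \<alpha>")
  case False
  then have x: "x > \<alpha>" using assms by (simp add: I_iff)
  have "real N / x < real N / \<alpha>" using x alpha_pos N_gt by (intro divide_strict_left_mono) auto
  then have lt: "real N / x - \<alpha> < real N / \<alpha> - \<alpha>" by simp
  show ?thesis
  proof (cases "real N / \<alpha> - \<alpha> \<in> \<int>")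
    case True
    then obtain z where z: "real N / \<alpha> - \<alpha> = of_int z" by (auto elim: Ints_cases)
    then have "\<lfloor>real N / x - \<alpha>\<rfloor> < z" using lt by (simp add: floor_less_iff)
    then show ?thesis using z by (simp add: dig_regular[OF x]) (simp add: digit_def)
  next
    case False
    then show ?thesis using lt by (simp add: dig_regular[OF x]) (simp add: digit_def floor_mono)
  qed
qed simp

lemma dig_ge_right:
  assumes "x \<in> I"
  shows "dig (\<alpha> + 1) \<le> dig x"
proof -
  have r: "dig (\<alpha> + 1) = \<lfloor>real N / (\<alpha> + 1) - \<alpha>\<rfloor>" by (rule dig_regular) simp
  show ?thesis
  proof (cases "x > \<alpha>")
    case True
    have "real N / (\<alpha> + 1) \<le> real N / x" using assms True alpha_pos by (intro divide_left_mono) (auto simp: I_iff)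
    then show ?thesis unfolding r dig_regular[OF True] by (intro floor_mono) simp
  next
    case False
    then have "dig x = dig \<alpha>" using assms by (simp add: I_iff)
    then show ?thesis using dig_le_left[of "\<alpha> + 1"] by (simp add: I_iff)
  qed
qed

end

context matching_alpha
begin

lemma cut_order: "n / (s + \<alpha>) < n / (real d + 1 + \<alpha>)"
  using N_pos a_pos d_real i_real by (intro divide_strict_left_mono mult_pos_pos) auto

lemma q_lt: "q < \<alpha> + 1" using cut_order q_le p_ge p_le by linarith
lemma p_gt: "\<alpha> < p" using cut_order q_le q_ge p_ge by linarith

lemma digits_eq: "dig ` I = {int d..int (d + i)}"
proof
  show "dig ` I \<subseteq> {int d..int (d + i)}" using dig_range by auto
  show "{int d..int (d + i)} \<subseteq> dig ` I"
  proof
    fix k assume k: "k \<in> {int d..int (d + i)}"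
    \<comment> \<open>a point \<open>y\<close> in the image of the cylinder of digit \<open>k\<close>, other than \<open>p\<close>, which would be the image of \<open>\<alpha>\<close>\<close>
    have ex: "\<exists>y. \<alpha> < y \<and> y < \<alpha> + 1 \<and> y \<noteq> p \<and> real d + q \<le> of_int k + y \<and> of_int k + y \<le> s + p"
    proof (cases "k = int d")
      case True
      obtain y where y: "q < y" "y < \<alpha> + 1" "y \<noteq> p"
      proof (cases "p \<le> q")
        case True
        then show ?thesis using that[of "(q + (\<alpha> + 1)) / 2"] q_lt by auto
      next
        case False
        then show ?thesis using that[of "(q + p) / 2"] p_le by auto
      qed
      then show ?thesis using True q_ge p_gt i_real by (intro exI[of _ y]) auto
    next
      case False
      then have kr: "real d + 1 \<le> of_int k" "of_int k \<le> s"
        using k by (auto simp flip: of_int_le_iff[where 'a = real])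
      define y where "y = (\<alpha> + p) / 2"
      have "\<alpha> < y" "y < p" using p_gt by (auto simp: y_def)
      then show ?thesis using kr p_le q_lt by (intro exI[of _ y]) auto
    qed
    then obtain y where "\<alpha> < y" "y < \<alpha> + 1" "y \<noteq> p" "real d + q \<le> of_int k + y" "of_int k + y \<le> s + p"
      by blast
    then have "branch k y \<in> I \<and> dig (branch k y) = k"
      using branch_in_cylinder[of y k] k by auto
    then show "k \<in> dig ` I" by (metis imageI)
  qed
qed

lemma in_A_set: "\<alpha> \<in> A_set N d i"
  using a_pos digits_eq real_le_rsqrt[OF alpha_le] by (simp add: A_set_def)

end

locale matching_interior = matching +
  fixes \<alpha> :: real
  assumes alpha_interior: "A < \<alpha>" "\<alpha> < B"

sublocale matching_interior \<subseteq> matching_alpha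
  using alpha_interior by unfold_locales auto

context matching_interior
begin

lemma p_lt: "p < \<alpha> + 1"
proof -
  have "A * (A + s + 1) < \<alpha> * (\<alpha> + s + 1)"
    using alpha_interior A_pos s_pos by (intro mult_strict_mono) auto
  then have "n < \<alpha> * (\<alpha> + s + 1)" by (simp only: A_root)
  then show ?thesis using a_pos by (simp add: p_def field_simps)
qed

lemma q_gt: "\<alpha> < q"
proof -
  have "(\<alpha> + 1) * (\<alpha> + real d) < (B + 1) * (B + real d)"
    using alpha_interior a_pos d_real by (intro mult_strict_mono) auto
  then have "(\<alpha> + 1) * (\<alpha> + real d) < n" by (simp only: B_root)
  then show ?thesis using a_pos by (simp add: q_def field_simps)
qed

lemma p_gt_cut: "n / (real d + 1 + \<alpha>) < p"
proof -
  have "\<alpha> * (real d + 1 + \<alpha>) < B * (real d + F)"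
    using alpha_interior a_pos d_real B_pos by (intro mult_strict_mono) (auto simp: F_eq)
  then have "s * (\<alpha> * (real d + 1 + \<alpha>)) < s * (B * (real d + F))" using s_pos by simp
  also have "\<dots> = n * (real d + 1)" using BF_prod N_d1 by simp
  finally show ?thesis using a_pos d_real by (simp add: p_def field_simps)
qed

lemma q_lt_cut: "q < n / (s + \<alpha>)"
proof -
  have "(A + 1) * (s + A) < (\<alpha> + 1) * (s + \<alpha>)"
    using alpha_interior a_pos s_pos A_pos by (intro mult_strict_mono) auto
  then have "real d * ((A + 1) * (s + A)) < real d * ((\<alpha> + 1) * (s + \<alpha>))" using d_real by simp
  then have "n * (s - 1) < real d * ((\<alpha> + 1) * (s + \<alpha>))" by (simp only: AE_prod N_s1)
  then show ?thesis using a_pos s_pos by (simp add: q_def field_simps)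
qed

lemma q2_gt: "\<alpha> < q2"
  using q_lt_cut div_ineq(4)[of q "s + \<alpha>"] q_pos a_pos s_pos by (simp add: q2_def)

lemma p2_lt: "p2 < \<alpha> + 1"
  using p_gt_cut div_ineq(3)[of "real d + 1 + \<alpha>" p] p_pos a_pos d_real by (simp add: p2_def)

lemma dig_first:
  assumes "n / (real d + 1 + \<alpha>) < x" "x \<le> \<alpha> + 1"
  shows "dig x = int d"
proof -
  have x: "x > \<alpha>" using assms cut_order q_le q_ge by linarith
  have xp: "x > 0" using x a_pos by simp
  have "n / x < real d + 1 + \<alpha>" using assms(1) div_ineq(3)[of "real d + 1 + \<alpha>" x] xp a_pos d_real by simp
  moreover have "n / (\<alpha> + 1) \<le> n / x" using assms(2) xp a_pos N_pos by (intro divide_left_mono) auto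
  then have "real d + \<alpha> \<le> n / x" using q_ge by (simp add: q_def)
  ultimately show ?thesis unfolding dig_regular[OF x] by (intro floor_unique) auto
qed

lemma dig_last:
  assumes "\<alpha> < x" "x < n / (s + \<alpha>)"
  shows "dig x = int (d + i)"
proof -
  have xp: "x > 0" using assms a_pos by simp
  have "s + \<alpha> < n / x" using assms(2) div_ineq(4)[of x "s + \<alpha>"] xp a_pos s_pos by simp
  moreover have "n / x < n / \<alpha>" using assms(1) a_pos N_pos by (intro divide_strict_left_mono) auto
  then have "n / x < s + 1 + \<alpha>" using p_le by (simp add: p_def)
  ultimately show ?thesis unfolding dig_regular[OF assms(1)] by (intro floor_unique) auto
qed

lemma T_alpha_left: "T \<alpha> = p"
proof -
  have "n / \<alpha> - \<alpha> = of_int (int (d + i)) + (p - \<alpha>)" by (simp add: p_def)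
  moreover have "0 < p - \<alpha>" "p - \<alpha> < 1" using p_gt p_lt by auto
  ultimately have bd: "of_int (int (d + i)) < n / \<alpha> - \<alpha>" "n / \<alpha> - \<alpha> < of_int (int (d + i)) + 1"
    by linarith+
  then have fl: "\<lfloor>n / \<alpha> - \<alpha>\<rfloor> = int (d + i)" by (intro floor_unique) auto
  have ne: "n / \<alpha> - \<alpha> \<notin> \<int>"
  proof
    assume "n / \<alpha> - \<alpha> \<in> \<int>"
    then have "of_int \<lfloor>n / \<alpha> - \<alpha>\<rfloor> = n / \<alpha> - \<alpha>" by (auto elim: Ints_cases)
    then show False using bd(1) unfolding fl by simp
  qed
  have "dig \<alpha> = int (d + i)" using fl ne by (simp add: digit_def)
  then show ?thesis by (simp add: T_eq p_def)
qed

lemma T_alpha_right: "T (\<alpha> + 1) = q"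
  using dig_first[of "\<alpha> + 1"] p_ge p_lt by (simp add: T_eq q_def)

lemma T_p: "T p = p2"
  using dig_first[OF p_gt_cut p_le] by (simp add: T_eq p2_def)

lemma T_q: "T q = q2"
  using dig_last[OF q_gt q_lt_cut] by (simp add: T_eq q2_def)

lemma in_X_set: "\<alpha> \<in> X_set N d i"
proof -
  have "p \<in> interior (cylinder N \<alpha> (int d))"
  proof (rule interiorI)
    show "open {n / (real d + 1 + \<alpha>)<..<\<alpha> + 1}" by simp
    show "p \<in> {n / (real d + 1 + \<alpha>)<..<\<alpha> + 1}" using p_gt_cut p_lt by simp
    show "{n / (real d + 1 + \<alpha>)<..<\<alpha> + 1} \<subseteq> cylinder N \<alpha> (int d)"
    proof
      fix x assume x: "x \<in> {n / (real d + 1 + \<alpha>)<..<\<alpha> + 1}"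
      then have "dig x = int d" by (intro dig_first) auto
      moreover have "x \<in> I" using x cut_order q_le q_ge by (auto simp: I_iff)
      ultimately show "x \<in> cylinder N \<alpha> (int d)" by (simp add: cylinder_def)
    qed
  qed
  moreover have "q \<in> interior (cylinder N \<alpha> (int (d + i)))"
  proof (rule interiorI)
    show "open {\<alpha><..<n / (s + \<alpha>)}" by simp
    show "q \<in> {\<alpha><..<n / (s + \<alpha>)}" using q_gt q_lt_cut by simp
    show "{\<alpha><..<n / (s + \<alpha>)} \<subseteq> cylinder N \<alpha> (int (d + i))"
    proof
      fix x assume x: "x \<in> {\<alpha><..<n / (s + \<alpha>)}"
      then have "dig x = int (d + i)" by (intro dig_last) auto
      moreover have "x \<in> I" using x cut_order p_ge p_le by (auto simp: I_iff)
      ultimately show "x \<in> cylinder N \<alpha> (int (d + i))" by (simp add: cylinder_def)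
    qed
  qed
  ultimately show ?thesis using in_A_set by (simp add: X_set_def T_alpha_left T_alpha_right)
qed

end

text \<open>\<open>T \<alpha> < \<alpha> + 1\<close> is a quadratic inequality in \<open>\<alpha>\<close> with root \<open>A\<close>, and \<open>\<alpha> < T (\<alpha> + 1)\<close> one with root \<open>B\<close>.  So the
  interior conditions imply \<open>A < \<alpha> < B\<close>; the converse uses the hypothesis on \<open>N\<close>.\<close>

lemma (in matching) X_set_eq: "X_set N d i = {A<..<B}"
proof (intro equalityI subsetI)
  fix \<alpha> assume "\<alpha> \<in> {A<..<B}"
  then interpret matching_interior N d i \<alpha> by unfold_locales auto
  show "\<alpha> \<in> X_set N d i" by (rule in_X_set)
next
  fix \<alpha> assume X: "\<alpha> \<in> X_set N d i"
  then have a: "0 < \<alpha>" "\<alpha> \<le> sqrt n - 1" and digs: "digit N \<alpha> ` I_alpha \<alpha> = {int d..int (d + i)}"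
    by (auto simp: X_set_def A_set_def)
  have "(\<alpha> + 1)\<^sup>2 \<le> (sqrt n)\<^sup>2" using a by (intro power_mono) auto
  then interpret nexp N \<alpha> using a by unfold_locales auto
  have aI: "\<alpha> \<in> I" "\<alpha> + 1 \<in> I" by (auto simp: I_iff)
  have "int (d + i) \<in> dig ` I" "int d \<in> dig ` I" using digs by auto
  then have "int (d + i) \<le> dig \<alpha>" "dig (\<alpha> + 1) \<le> int d"
    using dig_le_left dig_ge_right by auto
  moreover have "dig \<alpha> \<in> {int d..int (d + i)}" "dig (\<alpha> + 1) \<in> {int d..int (d + i)}"
    using digs aI by (metis imageI)+
  ultimately have dl: "dig \<alpha> = int (d + i)" and dr: "dig (\<alpha> + 1) = int d" by auto
  have int: "interior (cylinder N \<alpha> k) \<subseteq> {\<alpha><..<\<alpha> + 1}" for k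
  proof -
    have "cylinder N \<alpha> k \<subseteq> {\<alpha>..\<alpha> + 1}" by (auto simp: cylinder_def I_iff)
    then have "interior (cylinder N \<alpha> k) \<subseteq> interior {\<alpha>..\<alpha> + 1}" by (rule interior_mono)
    then show ?thesis by (simp only: interior_atLeastAtMost_real)
  qed
  have "T \<alpha> \<in> {\<alpha><..<\<alpha> + 1}" "T (\<alpha> + 1) \<in> {\<alpha><..<\<alpha> + 1}"
    using X unfolding X_set_def by (blast intro: subsetD[OF int])+
  then have T1: "T \<alpha> < \<alpha> + 1" and T2: "\<alpha> < T (\<alpha> + 1)" by auto
  have "A < \<alpha>"
  proof (rule ccontr)
    assume "\<not> ?thesis"
    then have "\<alpha> * (\<alpha> + s + 1) \<le> A * (A + s + 1)" using a s_pos by (intro mult_mono) auto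
    then have "\<alpha> * (\<alpha> + s + 1) \<le> n" by (simp only: A_root)
    then have "\<alpha> + 1 \<le> n / \<alpha> - s" using a by (simp add: field_simps)
    then show False using T1 by (simp add: T_eq dl)
  qed
  moreover have "\<alpha> < B"
  proof (rule ccontr)
    assume "\<not> ?thesis"
    then have "(B + 1) * (B + real d) \<le> (\<alpha> + 1) * (\<alpha> + real d)" using a B_pos by (intro mult_mono) auto
    then have "n \<le> (\<alpha> + 1) * (\<alpha> + real d)" by (simp only: B_root)
    then have "n / (\<alpha> + 1) - real d \<le> \<alpha>" using a by (simp add: field_simps)
    then show False using T2 by (simp add: T_eq dr)
  qed
  ultimately show "\<alpha> \<in> {A<..<B}" by simp
qed

section \<open>The planar domain and its projection\<close>

lemma closed_segment_horizontal:
  fixes u v w :: real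
  shows "closed_segment (u, w) (v, w) = {min u v..max u v} \<times> {w}"
proof -
  have "(1 - t) *\<^sub>R (u, w) + t *\<^sub>R (v, w) = ((1 - t) *\<^sub>R u + t *\<^sub>R v, w)" for t
    by (simp add: algebra_simps)
  then have "closed_segment (u, w) (v, w) = closed_segment u v \<times> {w}"
    by (auto simp: closed_segment_image_interval)
  then show ?thesis by (auto simp: closed_segment_eq_real_ivl)
qed

lemma closed_segment_vertical:
  fixes u v w :: real
  shows "closed_segment (w, u) (w, v) = {w} \<times> {min u v..max u v}"
proof -
  have "(1 - t) *\<^sub>R (w, u) + t *\<^sub>R (w, v) = (w, (1 - t) *\<^sub>R u + t *\<^sub>R v)" for t
    by (simp add: algebra_simps)
  then have "closed_segment (w, u) (w, v) = {w} \<times> closed_segment u v"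
    by (auto simp: closed_segment_image_interval)
  then show ?thesis by (auto simp: closed_segment_eq_real_ivl)
qed

lemma not_inside_ray:
  fixes z v :: "'a::real_normed_vector"
  assumes ray: "\<And>t. t \<ge> 0 \<Longrightarrow> z + t *\<^sub>R v \<notin> S" and v: "norm v = 1"
  shows "z \<notin> inside S"
proof
  assume z: "z \<in> inside S"
  let ?ray = "(\<lambda>t. z + t *\<^sub>R v) ` {0..}"
  have "connected ?ray" by (intro connected_continuous_image continuous_intros) simp
  moreover have "?ray \<subseteq> - S" using ray by auto
  moreover have "z \<in> ?ray" by (rule image_eqI[of _ _ 0]) auto
  ultimately have "?ray \<subseteq> connected_component_set (- S) z" by (intro connected_component_maximal)
  moreover have "bounded (connected_component_set (- S) z)" using z by (simp add: inside_def)
  ultimately have "bounded ?ray" by (rule bounded_subset[rotated])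
  then obtain K where K: "\<And>t. t \<ge> 0 \<Longrightarrow> norm (z + t *\<^sub>R v) \<le> K" by (auto simp: bounded_iff)
  define t where "t = \<bar>K\<bar> + norm z + 1"
  have t: "t \<ge> 0" by (simp add: t_def)
  have "t = norm (t *\<^sub>R v)" using v t by simp
  also have "\<dots> \<le> norm (z + t *\<^sub>R v) + norm z"
    using norm_triangle_ineq4[of "z + t *\<^sub>R v" z] by simp
  also have "\<dots> \<le> K + norm z" using K[OF t] by simp
  finally show False by (simp add: t_def)
qed

text \<open>The interior \<open>S\<close> of the right-hand side is open and closed in the complement of the curve, so it is a union
  of bounded components.  From a point outside one can move along a horizontal or vertical ray without
  ever entering, so such points lie in unbounded components.\<close>

lemma polygon_staircase:
  fixes a b A B C D E F p q p2 q2 :: real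
  assumes x: "a < q2" "q2 \<le> p" "p < b" "a < q" "q \<le> p2" "p2 < b"
    and y: "A < B" "B < C" "C < D" "D < E" "E < F"
  shows "polygon [(a, A), (q2, A), (q2, B), (p, B), (p, C), (b, C), (b, F), (p2, F), (p2, E), (q, E), (q, D), (a, D)]
    = {(x, y). a \<le> x \<and> x \<le> b \<and> A \<le> y \<and> (x \<le> q2 \<or> B \<le> y) \<and> (x \<le> p \<or> C \<le> y)
        \<and> y \<le> F \<and> (p2 \<le> x \<or> y \<le> E) \<and> (q \<le> x \<or> y \<le> D)}" (is "polygon ?vs = ?R")
proof -
  define \<Gamma> where "\<Gamma> = {a..q2} \<times> {A} \<union> {q2} \<times> {A..B} \<union> {q2..p} \<times> {B} \<union> {p} \<times> {B..C} \<union> {p..b} \<times> {C}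
    \<union> {b} \<times> {C..F} \<union> {p2..b} \<times> {F} \<union> {p2} \<times> {E..F} \<union> {q..p2} \<times> {E} \<union> {q} \<times> {D..E} \<union> {a..q} \<times> {D} \<union> {a} \<times> {A..D}"
  define sg where "sg k = closed_segment (?vs ! k) (?vs ! (Suc k mod length ?vs))" for k
  have sg: "sg 0 = {a..q2} \<times> {A}" "sg 1 = {q2} \<times> {A..B}" "sg 2 = {q2..p} \<times> {B}" "sg 3 = {p} \<times> {B..C}"
    "sg 4 = {p..b} \<times> {C}" "sg 5 = {b} \<times> {C..F}" "sg 6 = {p2..b} \<times> {F}" "sg 7 = {p2} \<times> {E..F}"
    "sg 8 = {q..p2} \<times> {E}" "sg 9 = {q} \<times> {D..E}" "sg 10 = {a..q} \<times> {D}" "sg 11 = {a} \<times> {A..D}"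
    using x y by (simp_all add: sg_def closed_segment_horizontal closed_segment_vertical)
  have "(\<Union>k<12. sg k) = sg 0 \<union> sg 1 \<union> sg 2 \<union> sg 3 \<union> sg 4 \<union> sg 5 \<union> sg 6 \<union> sg 7 \<union> sg 8 \<union> sg 9 \<union> sg 10 \<union> sg 11"
    by (simp add: lessThan_nat_numeral lessThan_Suc Un_ac)
  moreover have len: "length ?vs = 12" by simp
  ultimately have "(\<Union>k<length ?vs. sg k) = \<Gamma>"
    unfolding \<Gamma>_def sg[symmetric] len by (simp only:)
  then have "(\<Union>k<length ?vs. closed_segment (?vs ! k) (?vs ! (Suc k mod length ?vs))) = \<Gamma>"
    unfolding sg_def .
  then have poly: "polygon ?vs = \<Gamma> \<union> inside \<Gamma>" unfolding polygon_def Let_def by simp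
  define S where "S = {(x, y). a < x \<and> x < b \<and> A < y \<and> (x < q2 \<or> B < y) \<and> (x < p \<or> C < y)
        \<and> y < F \<and> (p2 < x \<or> y < E) \<and> (q < x \<or> y < D)}"
  have GR: "\<Gamma> \<subseteq> ?R" using x y by (auto simp: \<Gamma>_def)
  have SR: "S \<subseteq> ?R" by (auto simp: S_def)
  have RS: "?R \<subseteq> S \<union> \<Gamma>"
  proof
    fix z assume "z \<in> ?R"
    then obtain u v where z: "z = (u, v)" and R: "(u, v) \<in> ?R" by (cases z) auto
    show "z \<in> S \<union> \<Gamma>"
    proof (rule ccontr)
      assume "\<not> ?thesis"
      then have nS: "(u, v) \<notin> S" and nG: "(u, v) \<notin> \<Gamma>" by (auto simp: z)
      show False using R nS nG x y unfolding S_def \<Gamma>_def by (simp only: mem_Collect_eq case_prod_conv Un_iff mem_Sigma_iff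
            atLeastAtMost_iff singleton_iff) argo
    qed
  qed
  have SG: "S \<inter> \<Gamma> = {}" using x y by (auto simp: S_def \<Gamma>_def)
  have openS: "open S"
    unfolding S_def case_prod_beta
    by (intro open_Collect_conj open_Collect_disj open_Collect_less continuous_intros)
  have closedR: "closed ?R"
    unfolding case_prod_beta
    by (intro closed_Collect_conj closed_Collect_disj closed_Collect_le continuous_intros)
  have "S \<subseteq> inside \<Gamma>"
  proof
    fix z assume z: "z \<in> S"
    let ?K = "connected_component_set (- \<Gamma>) z"
    have zK: "z \<in> ?K" using z SG by auto
    have "?K \<subseteq> - \<Gamma>" by (rule connected_component_subset)
    then have "?K \<subseteq> S \<union> - ?R" using RS by blast
    then have "S \<inter> ?K = {} \<or> - ?R \<inter> ?K = {}"
      using SR openS closedR by (intro connectedD[OF connected_connected_component]) (auto simp: open_Compl)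
    then have "- ?R \<inter> ?K = {}" using z zK by blast
    then have "?K \<subseteq> ?R"
      by (simp only: Int_commute[of "- ?R"] disjoint_eq_subset_Compl double_complement)
    also have "\<dots> \<subseteq> {a..b} \<times> {A..F}" by auto
    finally have "?K \<subseteq> {a..b} \<times> {A..F}" .
    then have "bounded ?K" by (rule bounded_subset[rotated]) (intro bounded_Times bounded_closed_interval)
    then show "z \<in> inside \<Gamma>" using z SG by (auto simp: inside_def)
  qed
  moreover have "inside \<Gamma> \<subseteq> ?R"
  proof
    fix z assume z: "z \<in> inside \<Gamma>"
    show "z \<in> ?R"
    proof (rule ccontr)
      assume nR: "z \<notin> ?R"
      obtain u v where uv: "z = (u, v)" by (cases z)
      have "\<exists>w. norm w = 1 \<and> (\<forall>t\<ge>0. z + t *\<^sub>R w \<notin> ?R)"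
      proof -
        consider "u < a" | "b < u" | "v < A" | "q2 < u" "v < B" | "p < u" "v < C"
          | "F < v" | "u < p2" "E < v" | "u < q" "D < v"
          using nR unfolding uv by fastforce
        then show ?thesis
        proof cases
          case 1 then show ?thesis by (intro exI[of _ "(-1, 0)"]) (auto simp: uv norm_prod_def)
        next
          case 2 then show ?thesis by (intro exI[of _ "(1, 0)"]) (auto simp: uv norm_prod_def)
        next
          case 3 then show ?thesis by (intro exI[of _ "(0, -1)"]) (auto simp: uv norm_prod_def)
        next
          case 4 then show ?thesis by (intro exI[of _ "(0, -1)"]) (auto simp: uv norm_prod_def)
        next
          case 5 then show ?thesis by (intro exI[of _ "(0, -1)"]) (auto simp: uv norm_prod_def)
        next
          case 6 then show ?thesis by (intro exI[of _ "(0, 1)"]) (auto simp: uv norm_prod_def)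
        next
          case 7 then show ?thesis by (intro exI[of _ "(0, 1)"]) (auto simp: uv norm_prod_def)
        next
          case 8 then show ?thesis by (intro exI[of _ "(0, 1)"]) (auto simp: uv norm_prod_def)
        qed
      qed
      then obtain w where w: "norm w = 1" "\<And>t. t \<ge> 0 \<Longrightarrow> z + t *\<^sub>R w \<notin> ?R" by blast
      have "z \<notin> inside \<Gamma>"
      proof (rule not_inside_ray[OF _ w(1)])
        fix t :: real assume "t \<ge> 0"
        then have "z + t *\<^sub>R w \<notin> ?R" by (rule w(2))
        then show "z + t *\<^sub>R w \<notin> \<Gamma>" by (rule contra_subsetD[OF GR])
      qed
      then show False using z by simp
    qed
  qed
  ultimately have "inside \<Gamma> \<union> \<Gamma> = ?R"
    by (intro subset_antisym Un_least GR subset_trans[OF RS Un_mono[OF _ subset_refl]])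
  then show ?thesis unfolding poly by (simp only: Un_commute)
qed

context matching_interior
begin

abbreviation "\<Omega> \<equiv> Omega_alpha N d i \<alpha>"

lemma Omega_eq: "\<Omega> = {(x, y). \<alpha> \<le> x \<and> x \<le> \<alpha> + 1 \<and> A \<le> y \<and> (x \<le> q2 \<or> B \<le> y) \<and> (x \<le> p \<or> C \<le> y)
        \<and> y \<le> F \<and> (p2 \<le> x \<or> y \<le> E) \<and> (q \<le> x \<or> y \<le> D)}"
  unfolding Omega_alpha_def Let_def T_alpha_left T_alpha_right T_p T_q
  by (rule polygon_staircase[OF q2_gt q2_le_p p_lt q_gt p2_ge_q p2_lt A_lt_B B_lt_C C_lt_D D_lt_E E_lt_F])

lemma Omega_borel: "\<Omega> \<in> sets borel"
proof -
  have "closed \<Omega>"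
    unfolding Omega_eq case_prod_beta
    by (intro closed_Collect_conj closed_Collect_disj closed_Collect_le continuous_intros)
  then show ?thesis by (rule borel_closed)
qed

lemma Omega_fibre:
  assumes "x \<in> I" "x \<notin> {p, q, p2, q2}"
  shows "(x, y) \<in> \<Omega> \<longleftrightarrow> lower_height x \<le> y \<and> y \<le> upper_height x"
  using assms A_lt_B B_lt_C C_lt_D D_lt_E E_lt_F q2_le_p p2_ge_q
  by (auto simp: Omega_eq lower_height_def upper_height_def I_iff)

text \<open>\<open>y / (N + x y)\<close> is a primitive in \<open>y\<close>.\<close>

lemma nn_integral_fibre:
  assumes "x \<in> I" "x \<notin> {p, q, p2, q2}"
  shows "(\<integral>\<^sup>+y. ennreal (inverse Z * (n / (n + x * y)\<^sup>2)) * indicator \<Omega> (x, y) \<partial>lborel) = ennreal (inverse Z * fibre_mass x)"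
proof -
  have xp: "x > 0" by (rule I_pos[OF assms(1)])
  have fp: "lower_height x > 0" using A_pos B_pos C_pos by (simp add: lower_height_def)
  have le: "lower_height x \<le> upper_height x"
    using A_lt_B B_lt_C C_lt_D D_lt_E E_lt_F by (auto simp: lower_height_def upper_height_def)
  have "(\<integral>\<^sup>+y. ennreal (inverse Z * (n / (n + x * y)\<^sup>2)) * indicator \<Omega> (x, y) \<partial>lborel)
      = (\<integral>\<^sup>+y. ennreal (inverse Z * (n / (n + x * y)\<^sup>2)) * indicator {lower_height x..upper_height x} y \<partial>lborel)"
    by (intro nn_integral_cong) (simp add: Omega_fibre[OF assms] indicator_def)
  also have "\<dots> = ennreal (inverse Z * (upper_height x / (n + x * upper_height x)) - inverse Z * (lower_height x / (n + x * lower_height x)))"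
  proof (rule nn_integral_FTC_Icc)
    show "(\<lambda>y. inverse Z * (n / (n + x * y)\<^sup>2)) \<in> borel_measurable borel" by measurable
    fix y assume "y \<in> {lower_height x..upper_height x}"
    then have "n + x * y > 0" using xp fp N_pos by (intro add_pos_pos mult_pos_pos) auto
    then have "((\<lambda>y. y / (n + x * y)) has_real_derivative n / (n + x * y)\<^sup>2) (at y)"
      by (auto intro!: derivative_eq_intros simp: power2_eq_square algebra_simps)
    then show "DERIV (\<lambda>y. inverse Z * (y / (n + x * y))) y :> inverse Z * (n / (n + x * y)\<^sup>2)"
      by (rule DERIV_cmult)
    show "0 \<le> inverse Z * (n / (n + x * y)\<^sup>2)" using Z_pos N_pos by simp
  qed (rule le)
  also have "inverse Z * (upper_height x / (n + x * upper_height x)) - inverse Z * (lower_height x / (n + x * lower_height x)) = inverse Z * fibre_mass x"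
    by (simp add: fibre_mass_def psi_def right_diff_distrib mult.commute)
  finally show ?thesis .
qed

lemma Omega_measure_eq:
  "Omega_measure N d i (inverse Z) \<alpha> = density (restrict_space lborel \<Omega>) (\<lambda>(x, y). ennreal (inverse Z * (n / (n + x * y)\<^sup>2)))"
  by (simp add: Omega_measure_def)

lemma fst_measurable_Omega:
  "fst \<in> measurable (Omega_measure N d i (inverse Z) \<alpha>) (restrict_space borel I)"
proof -
  have "fst \<in> measurable (restrict_space lborel \<Omega>) (restrict_space borel I)"
    by (rule measurable_restrict_space3) (auto simp: Omega_eq I_iff borel_prod[symmetric])
  then show ?thesis unfolding Omega_measure_eq by simp
qed

text \<open>Tonelli's theorem; the fibres over the four jumps of the boundary form a null set.\<close>

lemma distr_Omega: "distr (Omega_measure N d i (inverse Z) \<alpha>) (restrict_space borel I) fst = \<mu>"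
proof (rule measure_eqI)
  show "sets (distr (Omega_measure N d i (inverse Z) \<alpha>) (restrict_space borel I) fst) = sets \<mu>"
    by (simp add: sets_mu)
  fix X assume "X \<in> sets (distr (Omega_measure N d i (inverse Z) \<alpha>) (restrict_space borel I) fst)"
  then have X: "X \<in> sets (restrict_space borel I)" by simp
  then have Xm: "X \<in> sets \<mu>" by (simp add: sets_mu)
  then have Xb [measurable]: "X \<in> sets borel" and XI: "X \<subseteq> I" by (auto simp: sets_mu_iff)
  let ?w = "\<lambda>z. ennreal (inverse Z * (n / (n + fst z * snd z)\<^sup>2))"
  have w [measurable]: "?w \<in> borel_measurable (borel \<Otimes>\<^sub>M borel)" by measurable
  have w': "?w \<in> borel_measurable borel" using w by (simp add: borel_prod)
  have Ob: "\<Omega> \<in> sets (borel \<Otimes>\<^sub>M borel)" unfolding borel_prod by (rule Omega_borel)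
  note [measurable] = Ob
  have space: "space (Omega_measure N d i (inverse Z) \<alpha>) = \<Omega>"
    by (simp add: Omega_measure_eq space_restrict_space)
  have V: "fst -` X \<inter> \<Omega> \<in> sets borel"
  proof -
    have "fst -` X \<inter> space (borel \<Otimes>\<^sub>M (borel :: real measure)) \<in> sets (borel \<Otimes>\<^sub>M borel)"
      by (rule measurable_sets[OF measurable_fst Xb])
    then have "fst -` X \<in> sets (borel :: (real \<times> real) measure)" unfolding borel_prod by simp
    then show ?thesis using Omega_borel by auto
  qed
  have "emeasure (distr (Omega_measure N d i (inverse Z) \<alpha>) (restrict_space borel I) fst) X
      = emeasure (Omega_measure N d i (inverse Z) \<alpha>) (fst -` X \<inter> \<Omega>)"
    by (subst emeasure_distr[OF fst_measurable_Omega X]) (simp add: space)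
  also have "\<dots> = (\<integral>\<^sup>+z. ?w z * indicator (fst -` X \<inter> \<Omega>) z \<partial>restrict_space lborel \<Omega>)"
    unfolding Omega_measure_eq case_prod_beta
    using V w' Omega_borel
    by (intro emeasure_density) (auto simp: sets_restrict_space_iff intro!: measurable_restrict_space1)
  also have "\<dots> = (\<integral>\<^sup>+z. ?w z * indicator (fst -` X \<inter> \<Omega>) z * indicator \<Omega> z \<partial>lborel)"
    using Omega_borel by (intro nn_integral_restrict_space) simp
  also have "\<dots> = (\<integral>\<^sup>+z. ?w z * indicator \<Omega> z * indicator X (fst z) \<partial>(lborel \<Otimes>\<^sub>M lborel))"
    unfolding lborel_prod by (intro nn_integral_cong) (auto simp: indicator_def)
  also have "\<dots> = (\<integral>\<^sup>+x. \<integral>\<^sup>+y. ?w (x, y) * indicator \<Omega> (x, y) * indicator X (fst (x, y)) \<partial>lborel \<partial>lborel)"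
    by (rule lborel.nn_integral_fst[symmetric]) measurable
  also have "\<dots> = (\<integral>\<^sup>+x. ennreal (inverse Z * fibre_mass x) * indicator X x \<partial>lborel)"
  proof (rule nn_integral_cong_AE)
    have "AE x in lborel. x \<notin> {p, q, p2, q2}" by (rule AE_not_finite) simp
    then show "AE x in lborel. (\<integral>\<^sup>+y. ?w (x, y) * indicator \<Omega> (x, y) * indicator X (fst (x, y)) \<partial>lborel)
        = ennreal (inverse Z * fibre_mass x) * indicator X x"
    proof eventually_elim
      case (elim x)
      show ?case
      proof (cases "x \<in> X")
        case True
        then show ?thesis using nn_integral_fibre[of x] elim XI by auto
      qed simp
    qed
  qed
  also have "\<dots> = emeasure \<mu> X" by (rule emeasure_mu[OF Xm, symmetric])
  finally show "emeasure (distr (Omega_measure N d i (inverse Z) \<alpha>) (restrict_space borel I) fst) X = emeasure \<mu> X" .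
qed

lemma prob_space_Omega: "prob_space (Omega_measure N d i (inverse Z) \<alpha>)"
  by (rule prob_space_distrD[OF fst_measurable_Omega]) (simp add: distr_Omega prob_space_mu)

end

section \<open>Constancy of the entropy on the matching interval\<close>

theorem theorem8:
  fixes N d i :: nat
  assumes "N \<ge> 2" and "d \<ge> 1" and "i \<ge> 2"
    and "real N = real d * (real d + real i) / (real i - 1)"
  shows "let A = cA N d i; B = cB N d; C = cC N d i; D = cD N d; E = cE N d i;
             H = inverse (2 * ln A + 2 * ln (B + 1) - ln (real N - (A + 1) * real d)
                            - ln (real N - (real d + real i) * B));
             G = (\<lambda>c x. Li2 (- (c * x / real N)) + ln x * ln (c * x / real N + 1))
         in closure (X_set N d i) = {A..B} \<and>
            entropy_T N constant_on {A..B} \<and>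
            (\<forall>\<alpha>\<in>{A..B}. entropy_T N \<alpha> =
               ereal (ln (real N) - 2 * H * ((G E (B + 1) - G E B) - (G A D - G A B)
                                              - (G C (B + 1) - G C D)))) \<and>
            (\<forall>\<alpha>\<in>X_set N d i.
               prob_space (Omega_measure N d i H \<alpha>) \<and>
               mu_alpha N \<alpha> =
                 distr (Omega_measure N d i H \<alpha>) (restrict_space borel (I_alpha \<alpha>)) fst)"
proof -
  interpret matching N d i using assms by unfold_locales
  have closure: "closure (X_set N d i) = {A..B}"
    unfolding X_set_eq using A_lt_B by simp
  have formula: "\<forall>\<alpha>\<in>{A..B}. entropy_T N \<alpha> = ereal (ln n - 2 * inverse Z *
      ((dilog_prim E (B + 1) - dilog_prim E B) - (dilog_prim A D - dilog_prim A B)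
        - (dilog_prim C (B + 1) - dilog_prim C D)))"
    using entropy_T_formula by (simp add: log_moment_B)
  have const: "entropy_T N constant_on {A..B}"
    unfolding constant_on_def using entropy_T_formula by blast
  have proj: "\<forall>\<alpha>\<in>X_set N d i. prob_space (Omega_measure N d i (inverse Z) \<alpha>) \<and>
      mu_alpha N \<alpha> = distr (Omega_measure N d i (inverse Z) \<alpha>) (restrict_space borel (I_alpha \<alpha>)) fst"
  proof
    fix \<alpha> assume "\<alpha> \<in> X_set N d i"
    then interpret matching_interior N d i \<alpha> by unfold_locales (auto simp: X_set_eq)
    show "prob_space (Omega_measure N d i (inverse Z) \<alpha>) \<and>
      mu_alpha N \<alpha> = distr (Omega_measure N d i (inverse Z) \<alpha>) (restrict_space borel (I_alpha \<alpha>)) fst"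
      using prob_space_Omega distr_Omega mu_alpha_eq by simp
  qed
  show ?thesis
    unfolding Let_def Z_def[symmetric] dilog_prim_def[symmetric]
    using closure const formula proj by blast
qed

end
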